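(* Let $d\ge 2$ and set $\varepsilon_n := 2^{-2n}$ for $n\in\mathbb{N}$. There exist a sequence of $C^\infty$-smooth initial data $u_0^{\varepsilon_n}:\mathbb{R}^d\to\mathbb{R}^d$ satisfying a uniform $L^2$ bound, i.e. $\sup_n \|u_0^{\varepsilon_n}\|_{L^2(\mathbb{R}^d)}<\infty$, and a corresponding family of smooth solutions $u^{\varepsilon_n}\in C^\infty([0,1]\times\mathbb{R}^d)$ (with associated pressures $p^{\varepsilon_n}$) to the incompressible Navier--Stokes equations with zero external force and viscosity $\varepsilon_n$, $$\partial_t u^{\varepsilon_n}+u^{\varepsilon_n}\cdot\nabla u^{\varepsilon_n}-\varepsilon_n\Delta u^{\varepsilon_n}+\nabla p^{\varepsilon_n}=0,\qquad \operatorname{div} u^{\varepsilon_n}=0,\qquad u^{\varepsilon_n}(0,\cdot)=u_0^{\varepsilon_n},$$ on $[0,1]\times\mathbb{R}^d$, such that there is a constant $c>0$ independent of $n$ with $$\varepsilon_n\int_0^1\|\nabla u^{\varepsilon_n}(t,\cdot)\|_{L^2(\mathbb{R}^d)}^2\,\mathrm{d}t\ \ge\ c\,\|u_0^{\varepsilon_n}\|_{L^2(\mathbb{R}^d)}\quad\text{for all } n.$$ In particular, $$\liminf_{n\to\infty}\ \varepsilon_n\int_0^1\|\nabla u^{\varepsilon_n}(t,\cdot)\|_{L^2(\mathbb{R}^d)}^2\,\mathrm{d}t\ \ge\ \eta$$ for some absolute constant $\eta>0$.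
   Context: The velocity is $u^{\varepsilon}:[0,1]\times\mathbb{R}^d\to\mathbb{R}^d$ and the pressure is $p^{\varepsilon}:[0,1]\times\mathbb{R}^d\to\mathbb{R}$; the number $\varepsilon>0$ is the viscosity. All differential operators $\nabla,\Delta,\operatorname{div}$ act in the space variable $x\in\mathbb{R}^d$. *)

theory Defs
  imports "HOL-Analysis.Analysis"
begin

section \<open>Smooth functions on a set\<close>

text \<open>
  Derivatives are taken relative to \<open>S\<close>. For \<open>S = [0,1] \<times> \<real>\<^sup>d\<close> (convex with nonempty interior) the
  derivative within \<open>S\<close> is unique, and it is one-sided in time at \<open>t = 0\<close> and \<open>t = 1\<close>; so this is
  smoothness up to the temporal boundary. In finite dimension, \<open>f\<close> is \<open>C\<^sup>k\<^sup>+\<^sup>1\<close> iff all its directional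
  derivatives \<open>x \<mapsto> f' x v\<close> are \<open>C\<^sup>k\<close>.
\<close>

primrec Ck_on ::
  "nat \<Rightarrow> ('a::euclidean_space \<Rightarrow> 'b::real_normed_vector) \<Rightarrow> 'a set \<Rightarrow> bool" where
  "Ck_on 0 f S \<longleftrightarrow> continuous_on S f"
| "Ck_on (Suc k) f S \<longleftrightarrow>
     (\<exists>f'. (\<forall>x\<in>S. (f has_derivative f' x) (at x within S)) \<and> (\<forall>v. Ck_on k (\<lambda>x. f' x v) S))"

definition Cinf_on :: "('a::euclidean_space \<Rightarrow> 'b::real_normed_vector) \<Rightarrow> 'a set \<Rightarrow> bool" where
  "Cinf_on f S \<longleftrightarrow> (\<forall>k. Ck_on k f S)"


section \<open>Spatial differential operators\<close>

definition pdiff :: "'n::finite \<Rightarrow> (real^'n \<Rightarrow> 'b::real_normed_vector) \<Rightarrow> real^'n \<Rightarrow> 'b" where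
  "pdiff i f x = frechet_derivative f (at x) (axis i 1)"

definition gradient :: "(real^'n \<Rightarrow> real) \<Rightarrow> real^'n \<Rightarrow> real^'n" where
  "gradient f x = (\<chi> i. pdiff i f x)"

definition divergence :: "(real^'n \<Rightarrow> real^'n) \<Rightarrow> real^'n \<Rightarrow> real" where
  "divergence v x = (\<Sum>i\<in>UNIV. pdiff i v x $ i)"

definition laplacian :: "(real^'n \<Rightarrow> 'b::real_normed_vector) \<Rightarrow> real^'n \<Rightarrow> 'b" where
  "laplacian f x = (\<Sum>i\<in>UNIV. pdiff i (pdiff i f) x)"

definition convection :: "(real^'n \<Rightarrow> real^'n) \<Rightarrow> (real^'n \<Rightarrow> real^'n) \<Rightarrow> real^'n \<Rightarrow> real^'n" where
  "convection w v x = (\<Sum>i\<in>UNIV. w x $ i *\<^sub>R pdiff i v x)"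

text \<open>The norm of \<^typ>\<open>real^'n^'n\<close> is the Euclidean norm of the entries, so \<open>norm (vgradient v x)\<close> is
  the Frobenius norm of the matrix with entries \<open>\<partial>\<^sub>j v\<^sub>i\<close>.\<close>

definition vgradient :: "(real^'n \<Rightarrow> real^'n) \<Rightarrow> real^'n \<Rightarrow> real^'n^'n" where
  "vgradient v x = (\<chi> i j. pdiff j v x $ i)"


section \<open>Square-integrable functions on the whole space\<close>

definition in_L2 :: "('a::euclidean_space \<Rightarrow> 'b::real_normed_vector) \<Rightarrow> bool" where
  "in_L2 f \<longleftrightarrow> f \<in> borel_measurable lborel \<and> integrable lborel (\<lambda>x. (norm (f x))\<^sup>2)"

text \<open>Only meaningful together with \<^const>\<open>in_L2\<close>, since the Bochner integral of a non-integrable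
  function is \<open>0\<close>.\<close>

definition L2_norm :: "('a::euclidean_space \<Rightarrow> 'b::real_normed_vector) \<Rightarrow> real" where
  "L2_norm f = sqrt (LINT x|lborel. (norm (f x))\<^sup>2)"


section \<open>The incompressible Navier--Stokes equations on the time interval [0,1]\<close>

definition smooth_NS_solution ::
  "real \<Rightarrow> (real^'n \<Rightarrow> real^'n) \<Rightarrow> (real \<Rightarrow> real^'n \<Rightarrow> real^'n) \<Rightarrow> (real \<Rightarrow> real^'n \<Rightarrow> real) \<Rightarrow> bool"
  where
  "smooth_NS_solution \<nu> u\<^sub>0 u p \<longleftrightarrow>
     Cinf_on (\<lambda>(t, x). u t x) ({0..1} \<times> UNIV) \<and>
     Cinf_on (\<lambda>(t, x). p t x) ({0..1} \<times> UNIV) \<and>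
     (\<forall>t\<in>{0..1}. \<forall>x.
        vector_derivative (\<lambda>s. u s x) (at t within {0..1}) + convection (u t) (u t) x
          - \<nu> *\<^sub>R laplacian (u t) x + gradient (p t) x = 0 \<and>
        divergence (u t) x = 0) \<and>
     u 0 = u\<^sub>0"

text \<open>\<open>\<nabla>u\<close> belongs to \<open>L\<^sup>2([0,1] \<times> \<real>\<^sup>d)\<close>, i.e. the dissipation integral below is finite. Without this
  the integral could be infinite (Tychonoff-type solutions with zero initial data), or receive a
  junk value.\<close>

definition finite_dissipation :: "(real \<Rightarrow> real^'n \<Rightarrow> real^'n) \<Rightarrow> bool" where
  "finite_dissipation u \<longleftrightarrow>
     (AE t in lborel. t \<in> {0..1} \<longrightarrow> in_L2 (vgradient (u t))) \<and>
     set_integrable lborel {0..1} (\<lambda>t. (L2_norm (vgradient (u t)))\<^sup>2)"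

definition dissipation :: "real \<Rightarrow> (real \<Rightarrow> real^'n \<Rightarrow> real^'n) \<Rightarrow> real" where
  "dissipation \<nu> u = \<nu> * (LINT t:{0..1}|lborel. (L2_norm (vgradient (u t)))\<^sup>2)"

definition visc :: "nat \<Rightarrow> real" where
  "visc n = 2 powi (- 2 * int n)"

end

theory Submission
  imports Defs "HOL-Probability.Probability"
begin

text \<open>
  Only a uniform \<open>L\<^sup>2\<close> bound is imposed on the data, so they may vary on the length scale \<open>\<surd>\<nu>\<close>, where
  the heat flow alone destroys a fixed fraction of the energy within unit time. What remains is to
  choose such data for which the nonlinearity is a small perturbation on the whole time interval.
  Take a shear layer: its width is \<open>1/N = \<surd>\<nu>\<close> in one direction \<open>i1\<close>, it points essentially in a second
  direction \<open>i2\<close>, and it extends over a length \<open>1/q\<close> in every direction other than \<open>i1\<close>. With the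
  energy normalised, letting \<open>q \<rightarrow> 0\<close> makes the velocity uniformly small without changing the rate at which
  viscosity dissipates it.

  In Fourier variables the amplitude of the data lives on a box with half sides \<open>r i\<close> and volume of order
  \<open>\<rho> = \<Prod> r i = N q\<^sup>d\<^sup>-\<^sup>1\<close>, has height of order \<open>1/\<surd>\<rho>\<close>, hence \<open>L\<^sup>2\<close> norm of order \<open>1\<close> and \<open>L\<^sup>1\<close> norm of
  order \<open>\<surd>\<rho>\<close>. Since \<open>L\<^sup>1\<close> norms of amplitudes bound the velocity, the nonlinearity has relative
  size \<open>N \<surd>\<rho>\<close>, which tends to \<open>0\<close> with \<open>q\<close>.

  The solution is sought in the form \<open>u(t,x) = \<integral> sin (\<xi> \<bullet> x) b(t,\<xi>) d\<xi>\<close> with \<open>b\<close> real, odd in \<open>\<xi>\<close> and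
  orthogonal to \<open>\<xi>\<close>. Oddness of the velocity is preserved by the equations, and it keeps all amplitudes real.
  Products turn into convolutions (\<open>synth_mult\<close>), the pressure is removed by
  the Leray projection, which is a bounded symbol, and the equations become
  \<open>b' = -\<nu> |\<xi>|\<^sup>2 b - leray_conv b b\<close>. The integrated equation is a contraction on the functions dominated
  by one time-independent weight \<open>W\<close> (\<open>mild_solution\<close>): the essential property of \<open>W\<close> is
  \<open>W * W \<le> \<kappa> W\<close> with \<open>\<kappa>\<close> small against \<open>\<surd>\<nu>\<close>, because integrating the heat kernel in time compensates the
  derivative in the nonlinearity at the cost of a factor \<open>1/\<surd>\<nu>\<close>. The weight decays exponentially,
  so the velocity has derivatives of all orders in \<open>x\<close>; derivatives in \<open>t\<close> follow by inserting the differential equation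
  into itself (\<open>smooth_amp_b\<close>).

  Finiteness of all norms follows from the inequality half of Plancherel's theorem (\<open>synth_L2\<close>). For the lower
  bound on the dissipation (\<open>packet_solution\<close>), the single derivative of \<open>u\<^sub>i\<^sub>2\<close> in direction \<open>i1\<close> is
  paired with a Gaussian; by Fubini this is an integral over frequencies, whose linear part is a Gaussian moment and whose
  nonlinear part is smaller by the factor \<open>N \<surd>\<rho>\<close>.
\<close>

section \<open>Product integrals and Gaussians\<close>

lemma Basis_vec_eq: "(Basis :: (real^'n) set) = range (\<lambda>i. axis i 1)"
  by (auto simp: Basis_vec_def)

lemma inj_axis_one: "inj (\<lambda>i. axis i (1::real) :: real^'n)"
  by (auto simp: inj_on_def axis_eq_axis)

text \<open>
  Lebesgue measure on \<^typ>\<open>real^'n\<close> is the image of a product measure indexed by the basis vectors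
  \<open>axis i 1\<close>; reindexing that product by \<open>'n\<close> gives Fubini for functions that factor over the coordinates.
\<close>

lemma
  fixes f :: "'n::finite \<Rightarrow> real \<Rightarrow> 'c::{real_normed_field,banach,second_countable_topology}"
  assumes int: "\<And>i. integrable lborel (f i)"
  shows integrable_prod_vec: "integrable (lborel::(real^'n) measure) (\<lambda>x. \<Prod>i\<in>UNIV. f i (x $ i))"
    and integral_prod_vec: "(LINT x|(lborel::(real^'n) measure). (\<Prod>i\<in>UNIV. f i (x $ i))) = (\<Prod>i\<in>UNIV. LBINT y. f i y)"
proof -
  have [measurable]: "f i \<in> borel_measurable borel" for i
    using int[of i] by simp
  interpret product_sigma_finite "\<lambda>_::real^'n. lborel::real measure"
    by standard
  define g :: "real^'n \<Rightarrow> real \<Rightarrow> 'c" where "g b = f (inv (\<lambda>i. axis i 1) b)" for b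
  have g: "g (axis i 1) = f i" for i
    by (simp add: g_def inv_f_f[OF inj_axis_one])
  have gi: "integrable lborel (g b)" for b
    by (simp add: g_def int)
  have T[measurable]: "(\<lambda>f. \<Sum>b\<in>Basis. f b *\<^sub>R b) \<in> measurable (\<Pi>\<^sub>M b\<in>Basis. lborel) (borel::(real^'n) measure)"
    by measurable
  have comp: "(\<Prod>i\<in>UNIV. f i ((\<Sum>b\<in>Basis. y b *\<^sub>R b) $ i)) = (\<Prod>b\<in>Basis. g b (y b))" for y :: "real^'n \<Rightarrow> real"
  proof -
    have "(\<Sum>b\<in>Basis. y b *\<^sub>R b) $ i = y (axis i 1)" for i
      using inner_sum_left_Basis[of "axis i 1" y] by (simp add: inner_axis Basis_vec_eq)
    then show ?thesis
      unfolding Basis_vec_eq prod.reindex[OF inj_axis_one] by (simp add: g)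
  qed
  show "integrable (lborel::(real^'n) measure) (\<lambda>x. \<Prod>i\<in>UNIV. f i (x $ i))"
    unfolding lborel_eq[where 'a="real^'n"]
  proof (subst integrable_distr_eq[OF T])
    show "(\<lambda>x. \<Prod>i\<in>UNIV. f i (x $ i)) \<in> borel_measurable (borel :: (real^'n) measure)"
      by measurable
    show "integrable (\<Pi>\<^sub>M b\<in>Basis. lborel) (\<lambda>x. \<Prod>i\<in>UNIV. f i ((\<Sum>b\<in>Basis. x b *\<^sub>R b) $ i))"
      unfolding comp by (intro product_integrable_prod gi) auto
  qed
  have "(LINT x|(lborel::(real^'n) measure). (\<Prod>i\<in>UNIV. f i (x $ i))) = (LINT y|(\<Pi>\<^sub>M b\<in>Basis. lborel). (\<Prod>b\<in>Basis. g b (y b)))"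
    unfolding lborel_eq[where 'a="real^'n"]
    unfolding comp[symmetric] by (subst integral_distr[OF T]) auto
  also have "\<dots> = (\<Prod>b\<in>(Basis::(real^'n) set). LBINT y. g b y)"
    by (intro product_integral_prod gi) auto
  finally show "(LINT x|(lborel::(real^'n) measure). (\<Prod>i\<in>UNIV. f i (x $ i))) = (\<Prod>i\<in>UNIV. LBINT y. f i y)"
    unfolding Basis_vec_eq prod.reindex[OF inj_axis_one] by (simp add: g)
qed

lemma lborel_integral_scale:
  fixes f :: "real \<Rightarrow> 'a::{banach,second_countable_topology}"
  assumes "r > 0" "integrable lborel f"
  shows "integrable lborel (\<lambda>x. f (x / r))" "(LBINT x. f (x / r)) = r *\<^sub>R (LBINT x. f x)"
proof -
  have "integrable lborel (\<lambda>x. f (0 + (1/r) * x))"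
    using assms by (intro lborel_integrable_real_affine) auto
  then show "integrable lborel (\<lambda>x. f (x / r))" by simp
  show "(LBINT x. f (x / r)) = r *\<^sub>R (LBINT x. f x)"
    using lborel_integral_real_affine[of "1/r" f 0] assms by simp
qed

text \<open>
  Up to normalisation the last integral is the characteristic function of the standard normal distribution.
\<close>

lemma
  shows integrable_gauss: "integrable lborel (\<lambda>x::real. exp (- x\<^sup>2 / 2))"
    and integral_gauss: "(LBINT x. exp (- (x::real)\<^sup>2 / 2)) = sqrt (2 * pi)"
    and integrable_gauss_iexp: "integrable lborel (\<lambda>x::real. iexp (s * x) * complex_of_real (exp (- x\<^sup>2 / 2)))"
    and integral_gauss_iexp: "(LBINT x. iexp (s * x) * complex_of_real (exp (- x\<^sup>2 / 2))) = sqrt (2 * pi) * exp (- s\<^sup>2 / 2)"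
proof -
  have eq: "exp (- x\<^sup>2 / 2) = sqrt (2 * pi) * std_normal_density x" for x :: real
    by (simp add: std_normal_density_def)
  show i: "integrable lborel (\<lambda>x::real. exp (- x\<^sup>2 / 2))"
    unfolding eq by (intro integrable_mult_right integrable_normal_density) auto
  show "(LBINT x. exp (- (x::real)\<^sup>2 / 2)) = sqrt (2 * pi)"
    unfolding eq by simp
  show "integrable lborel (\<lambda>x::real. iexp (s * x) * complex_of_real (exp (- x\<^sup>2 / 2)))"
    by (rule Bochner_Integration.integrable_bound[OF i]) (auto simp: norm_mult)
  have "complex_of_real (exp (- s\<^sup>2 / 2)) = (LINT x|density lborel std_normal_density. iexp (s * x))"
    using fun_cong[OF char_std_normal_distribution, of s] by (simp add: char_def)
  also have "\<dots> = (LBINT x. std_normal_density x *\<^sub>R iexp (s * x))"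
    by (subst integral_density) (auto simp: normal_density_nonneg)
  finally have *: "complex_of_real (exp (- s\<^sup>2 / 2)) = (LBINT x. std_normal_density x *\<^sub>R iexp (s * x))" .
  have "(LBINT x. iexp (s * x) * complex_of_real (exp (- x\<^sup>2 / 2))) = (LBINT x. sqrt (2 * pi) * (std_normal_density x *\<^sub>R iexp (s * x)))"
    by (intro Bochner_Integration.integral_cong refl) (simp only: eq scaleR_conv_of_real of_real_mult mult_ac)
  also have "\<dots> = sqrt (2 * pi) * exp (- s\<^sup>2 / 2)"
    by (subst integral_mult_right_zero) (simp only: *[unfolded of_real_mult, symmetric] of_real_mult)
  finally show "(LBINT x. iexp (s * x) * complex_of_real (exp (- x\<^sup>2 / 2))) = sqrt (2 * pi) * exp (- s\<^sup>2 / 2)" .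
qed

lemma
  shows integrable_cauchy: "integrable lborel (\<lambda>x::real. 1 / (1 + x\<^sup>2))"
    and integral_cauchy: "(LBINT x. 1 / (1 + (x::real)\<^sup>2)) = pi"
proof -
  have "einterval (-\<infinity>) \<infinity> = UNIV" by auto
  then show "integrable lborel (\<lambda>x::real. 1 / (1 + x\<^sup>2))" "(LBINT x. 1 / (1 + (x::real)\<^sup>2)) = pi"
    using integrable_inverse_1_plus_square LBINT_inverse_1_plus_square
    by (simp_all add: set_integrable_def interval_lebesgue_integral_def set_lebesgue_integral_def inverse_eq_divide)
qed

text \<open>
  Dominated by a multiple of \<open>1 / (1 + x\<^sup>2)\<close>, since \<open>(\<delta> \<bar>x\<bar>)\<^sup>2 / 2 \<le> exp (\<delta> \<bar>x\<bar>)\<close>.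
\<close>

lemma integrable_exp_abs:
  assumes d: "\<delta> > 0"
  shows "integrable lborel (\<lambda>x::real. exp (- \<delta> * \<bar>x\<bar>))"
proof (rule Bochner_Integration.integrable_bound)
  show "integrable lborel (\<lambda>x::real. (1 + 2 / \<delta>\<^sup>2) * (1 / (1 + x\<^sup>2)))"
    by (intro integrable_mult_right integrable_cauchy)
  have "exp (- \<delta> * \<bar>x\<bar>) \<le> (1 + 2 / \<delta>\<^sup>2) * (1 / (1 + x\<^sup>2))" for x :: real
  proof -
    have 1: "(\<delta> * \<bar>x\<bar>)\<^sup>2 / 2 \<le> exp (\<delta> * \<bar>x\<bar>)" "1 \<le> exp (\<delta> * \<bar>x\<bar>)"
      using exp_lower_Taylor_quadratic[of "\<delta> * \<bar>x\<bar>"] mult_nonneg_nonneg[of \<delta> "\<bar>x\<bar>"] d by (simp, linarith, simp)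
    have "x\<^sup>2 \<le> 2 / \<delta>\<^sup>2 * exp (\<delta> * \<bar>x\<bar>)"
      using 1(1) d by (simp add: power_mult_distrib field_simps)
    then have "1 + x\<^sup>2 \<le> (1 + 2 / \<delta>\<^sup>2) * exp (\<delta> * \<bar>x\<bar>)"
      using 1(2) unfolding distrib_right by linarith
    then show ?thesis
      by (simp add: exp_minus field_simps add_pos_nonneg)
  qed
  then show "AE x in lborel. norm (exp (- \<delta> * \<bar>x\<bar>)) \<le> norm ((1 + 2 / \<delta>\<^sup>2) * (1 / (1 + x\<^sup>2)))"
    by (intro always_eventually allI) (simp add: order_trans[OF _ abs_ge_self])
qed auto

definition gaussian :: "('n \<Rightarrow> real) \<Rightarrow> real^'n \<Rightarrow> real" where
  "gaussian r x = exp (- (\<Sum>i\<in>UNIV. (r i * x $ i)\<^sup>2) / 2)"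

lemma gaussian_prod: "gaussian r x = (\<Prod>i\<in>UNIV. exp (- (r i * x $ i)\<^sup>2 / 2))"
  by (simp add: gaussian_def exp_sum[symmetric] sum_negf sum_divide_distrib)

lemma gaussian_pos: "gaussian r x > 0" by (simp add: gaussian_def)

lemma gaussian_le1: "gaussian r x \<le> 1" by (simp add: gaussian_def sum_nonneg)

lemma measurable_gaussian[measurable]: "gaussian r \<in> borel_measurable borel"
  unfolding gaussian_def by measurable

text \<open>
  The Gaussian is a product over the coordinates and \<open>exp (\<i> \<xi> \<bullet> x)\<close> factors in the same way, which a cosine
  does not. So the complex integral is computed first and the cosine integral is its real part.
\<close>

lemma
  fixes r :: "'n::finite \<Rightarrow> real"
  assumes r: "\<And>i. r i > 0"
  shows integrable_gaussian: "integrable lborel (gaussian r)"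
    and integral_gaussian: "(LBINT x. gaussian r x) = (\<Prod>i\<in>UNIV. sqrt (2 * pi) / r i)"
    and gaussian_fourier: "(LBINT x. cos (\<xi> \<bullet> x) * gaussian r x)
       = (\<Prod>i\<in>UNIV. sqrt (2 * pi) / r i) * gaussian (\<lambda>i. 1 / r i) \<xi>"
proof -
  have 1: "integrable lborel (\<lambda>x. exp (- (r i * x)\<^sup>2 / 2))"
     "(LBINT x. exp (- (r i * x)\<^sup>2 / 2)) = sqrt (2 * pi) / r i" for i
    using lborel_integral_scale[OF _ integrable_gauss, of "1 / r i"] r[of i]
    by (simp_all add: integral_gauss[simplified] mult.commute)
  show i: "integrable lborel (gaussian r)"
    unfolding gaussian_prod[abs_def] by (rule integrable_prod_vec) (rule 1)
  show "(LBINT x. gaussian r x) = (\<Prod>i\<in>UNIV. sqrt (2 * pi) / r i)"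
    unfolding gaussian_prod by (subst integral_prod_vec[OF 1(1)]) (simp only: 1(2))
  have 2: "integrable lborel (\<lambda>x. iexp (\<xi> $ i * x) * complex_of_real (exp (- (r i * x)\<^sup>2 / 2)))"
     "(LBINT x. iexp (\<xi> $ i * x) * complex_of_real (exp (- (r i * x)\<^sup>2 / 2))) = complex_of_real (sqrt (2 * pi) / r i * exp (- ((1 / r i) * \<xi> $ i)\<^sup>2 / 2))" for i
  proof -
    have e: "iexp (\<xi> $ i / r i * (x / (1 / r i))) = iexp (\<xi> $ i * x)" "x / (1 / r i) = r i * x" for x
      using r[of i] by (auto simp: field_simps)
    show "integrable lborel (\<lambda>x. iexp (\<xi> $ i * x) * complex_of_real (exp (- (r i * x)\<^sup>2 / 2)))"
      using lborel_integral_scale(1)[OF _ integrable_gauss_iexp[of "\<xi> $ i / r i"], of "1 / r i"] r[of i]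
      unfolding e by simp
    show "(LBINT x. iexp (\<xi> $ i * x) * complex_of_real (exp (- (r i * x)\<^sup>2 / 2)))
      = complex_of_real (sqrt (2 * pi) / r i * exp (- ((1 / r i) * \<xi> $ i)\<^sup>2 / 2))"
      using lborel_integral_scale(2)[OF _ integrable_gauss_iexp[of "\<xi> $ i / r i"], of "1 / r i"] r[of i]
      unfolding e integral_gauss_iexp by (simp add: scaleR_conv_of_real)
  qed
  have 3: "(\<Prod>i\<in>UNIV. iexp (\<xi> $ i * x $ i) * complex_of_real (exp (- (r i * x $ i)\<^sup>2 / 2))) = iexp (\<xi> \<bullet> x) * gaussian r x" for x
  proof -
    have "(\<Prod>i\<in>UNIV. iexp (\<xi> $ i * x $ i)) = iexp (\<xi> \<bullet> x)"
      by (simp add: inner_vec_def exp_sum[symmetric] sum_distrib_left)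
    then show ?thesis
      by (simp only: prod.distrib gaussian_prod of_real_prod)
  qed
  have "(LBINT x. iexp (\<xi> \<bullet> x) * gaussian r x) = (\<Prod>i\<in>UNIV. LBINT x. iexp (\<xi> $ i * x) * complex_of_real (exp (- (r i * x)\<^sup>2 / 2)))"
    unfolding 3[symmetric] by (rule integral_prod_vec) (rule 2)
  also have "\<dots> = complex_of_real ((\<Prod>i\<in>UNIV. sqrt (2 * pi) / r i) * gaussian (\<lambda>i. 1 / r i) \<xi>)"
    unfolding 2(2) gaussian_prod by (simp only: of_real_prod prod.distrib[symmetric])
  finally have 4: "(LBINT x. iexp (\<xi> \<bullet> x) * gaussian r x) = complex_of_real ((\<Prod>i\<in>UNIV. sqrt (2 * pi) / r i) * gaussian (\<lambda>i. 1 / r i) \<xi>)" .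
  have "integrable lborel (\<lambda>x. iexp (\<xi> \<bullet> x) * gaussian r x)"
    by (rule Bochner_Integration.integrable_bound[OF i]) (auto simp: norm_mult)
  then have "(LBINT x. Re (iexp (\<xi> \<bullet> x) * gaussian r x)) = Re (LBINT x. iexp (\<xi> \<bullet> x) * gaussian r x)"
    by (rule integral_Re)
  then show "(LBINT x. cos (\<xi> \<bullet> x) * gaussian r x) = (\<Prod>i\<in>UNIV. sqrt (2 * pi) / r i) * gaussian (\<lambda>i. 1 / r i) \<xi>"
    unfolding 4 Re_complex_of_real by (simp add: Re_exp)
qed

section \<open>Exponential decay of amplitudes\<close>

definition l1 :: "real^'n \<Rightarrow> real" where "l1 \<xi> = (\<Sum>i\<in>UNIV. \<bar>\<xi> $ i\<bar>)"

text \<open>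
  The \<open>l\<^sup>1\<close> norm is used in the exponent because \<open>E \<delta>\<close> then factors over the coordinates, which makes it
  explicitly integrable.
\<close>

definition E :: "real \<Rightarrow> real^'n \<Rightarrow> real" where "E \<delta> \<xi> = exp (- \<delta> * l1 \<xi>)"

lemma l1_nonneg: "l1 \<xi> \<ge> 0" by (simp add: l1_def sum_nonneg)

lemma l1_triangle: "l1 \<xi> \<le> l1 \<eta> + l1 (\<xi> - \<eta>)"
  unfolding l1_def sum.distrib[symmetric] by (intro sum_mono) auto

lemma abs_le_l1: "\<bar>\<xi> $ i\<bar> \<le> l1 \<xi>"
  unfolding l1_def by (rule member_le_sum) auto

lemma norm_le_l1: "norm \<xi> \<le> l1 \<xi>"
  unfolding l1_def by (rule norm_le_l1_cart)

lemma E_pos: "E \<delta> \<xi> > 0" by (simp add: E_def)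

lemma E_mono: "\<delta> \<le> \<delta>' \<Longrightarrow> E \<delta>' \<xi> \<le> E \<delta> \<xi>"
  by (simp add: E_def mult_right_mono l1_nonneg)

lemma E_le_1: "\<delta> \<ge> 0 \<Longrightarrow> E \<delta> \<xi> \<le> 1"
  by (simp add: E_def l1_nonneg)

lemma E_half: "E \<delta> \<xi> = E (\<delta>/2) \<xi> * E (\<delta>/2) \<xi>"
  by (simp add: E_def exp_add[symmetric])

lemma l1_E_le: assumes "\<delta> > 0" shows "l1 \<xi> * E \<delta> \<xi> \<le> 1 / \<delta>"
proof -
  have "\<delta> * l1 \<xi> \<le> exp (\<delta> * l1 \<xi>)"
    using exp_ge_add_one_self[of "\<delta> * l1 \<xi>"] by linarith
  then show ?thesis using assms by (simp add: E_def exp_minus field_simps)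
qed

text \<open>
  Half of the decay pays for the integration in \<open>\<eta>\<close>, the other half survives in \<open>\<xi>\<close> by the triangle
  inequality. This is why convolutions of exponentially decaying functions decay exponentially.
\<close>

lemma E_conv_split:
  assumes "\<delta> > 0"
  shows "E \<delta> \<eta> * E \<delta> (\<xi> - \<eta>) \<le> E (\<delta>/2) \<xi> * E (\<delta>/2) \<eta>"
proof -
  have "\<delta> * (l1 \<eta> + l1 (\<xi> - \<eta>)) \<ge> \<delta> / 2 * (l1 \<xi> + l1 \<eta>)"
  proof -
    have "\<delta> * ((l1 \<xi> + l1 \<eta>)/2) \<le> \<delta> * (l1 \<eta> + l1 (\<xi> - \<eta>))"
      using l1_triangle[of \<xi> \<eta>] l1_nonneg[of \<eta>] l1_nonneg[of "\<xi> - \<eta>"] assms by (intro mult_left_mono) auto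
    then show ?thesis by simp
  qed
  then show ?thesis unfolding E_def by (simp add: exp_add[symmetric] algebra_simps)
qed

lemma measurable_l1[measurable]: "l1 \<in> borel_measurable borel"
  unfolding l1_def by measurable

lemma measurable_E[measurable]: "E \<delta> \<in> borel_measurable borel"
  unfolding E_def by measurable

lemma integrable_E: "\<delta> > 0 \<Longrightarrow> integrable lborel (E \<delta> :: real^'n \<Rightarrow> real)"
proof -
  assume "\<delta> > 0"
  then have "integrable lborel (\<lambda>\<xi>::real^'n. \<Prod>i\<in>UNIV. exp (- \<delta> * \<bar>\<xi> $ i\<bar>))"
    by (intro integrable_prod_vec integrable_exp_abs)
  moreover have "(\<Prod>i\<in>UNIV. exp (- \<delta> * \<bar>\<xi> $ i\<bar>)) = E \<delta> \<xi>" for \<xi> :: "real^'n"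
    by (simp add: E_def l1_def exp_sum[symmetric] sum_distrib_left sum_negf)
  ultimately show ?thesis by simp
qed

section \<open>Exponentially dominated families\<close>

definition edec :: "(real^'n \<Rightarrow> real) \<Rightarrow> bool" where
  "edec f \<longleftrightarrow> f \<in> borel_measurable borel \<and> (\<exists>C \<delta>. \<delta> > 0 \<and> (\<forall>\<xi>. \<bar>f \<xi>\<bar> \<le> C * E \<delta> \<xi>))"

text \<open>
  For a family, the constant and the rate must not depend on the index. Index sets will be the time
  interval and its square: the latter carries difference quotients, so that Lipschitz bounds and Taylor
  remainders become domination statements as well.
\<close>

definition edom :: "'i set \<Rightarrow> ('i \<Rightarrow> real^'n \<Rightarrow> real) \<Rightarrow> bool" where
  "edom T f \<longleftrightarrow> (\<forall>\<tau>\<in>T. f \<tau> \<in> borel_measurable borel) \<and> (\<exists>C \<delta>. \<delta> > 0 \<and> (\<forall>\<tau>\<in>T. \<forall>\<xi>. \<bar>f \<tau> \<xi>\<bar> \<le> C * E \<delta> \<xi>))"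

lemma edomI: "(\<And>\<tau>. \<tau> \<in> T \<Longrightarrow> f \<tau> \<in> borel_measurable borel) \<Longrightarrow> \<delta> > 0 \<Longrightarrow>
    (\<And>\<tau> \<xi>. \<tau> \<in> T \<Longrightarrow> \<bar>f \<tau> \<xi>\<bar> \<le> C * E \<delta> \<xi>) \<Longrightarrow> edom T f"
  unfolding edom_def by blast

lemma edomE:
  assumes "edom T f"
  obtains C \<delta> where "C > 0" "\<delta> > 0" "\<And>\<tau> \<xi>. \<tau> \<in> T \<Longrightarrow> \<bar>f \<tau> \<xi>\<bar> \<le> C * E \<delta> \<xi>"
proof -
  obtain C \<delta> where *: "\<delta> > 0" "\<And>\<tau> \<xi>. \<tau> \<in> T \<Longrightarrow> \<bar>f \<tau> \<xi>\<bar> \<le> C * E \<delta> \<xi>"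
    using assms unfolding edom_def by blast
  have "\<bar>f \<tau> \<xi>\<bar> \<le> (\<bar>C\<bar> + 1) * E \<delta> \<xi>" if "\<tau> \<in> T" for \<tau> \<xi>
    by (rule order_trans[OF *(2)[OF that] mult_right_mono]) (auto simp: E_pos less_imp_le)
  with *(1) show ?thesis by (intro that[of "\<bar>C\<bar> + 1" \<delta>]) auto
qed

lemma edom_measurable: "edom T f \<Longrightarrow> \<tau> \<in> T \<Longrightarrow> f \<tau> \<in> borel_measurable borel"
  unfolding edom_def by blast

lemma edom_edec: "edom T f \<Longrightarrow> \<tau> \<in> T \<Longrightarrow> edec (f \<tau>)"
  unfolding edom_def edec_def by blast

lemma edec_edom: "edec f \<Longrightarrow> edom T (\<lambda>_. f)"
  unfolding edom_def edec_def by blast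

lemma edec_measurable: "edec f \<Longrightarrow> f \<in> borel_measurable borel"
  unfolding edec_def by blast

lemma edecE:
  assumes "edec f"
  obtains C \<delta> where "C > 0" "\<delta> > 0" "\<And>\<xi>. \<bar>f \<xi>\<bar> \<le> C * E \<delta> \<xi>"
  using edomE[OF edec_edom[OF assms, of UNIV]] by auto

lemma edec_integrable: assumes "edec f" shows "integrable lborel f"
proof -
  obtain C \<delta> where *: "C > 0" "\<delta> > 0" "\<And>\<xi>. \<bar>f \<xi>\<bar> \<le> C * E \<delta> \<xi>" using edecE[OF assms] by metis
  show ?thesis
  proof (rule Bochner_Integration.integrable_bound)
    show "integrable lborel (\<lambda>\<xi>. C * E \<delta> \<xi>)" by (intro integrable_mult_right integrable_E *)
    show "AE x in lborel. norm (f x) \<le> norm (C * E \<delta> x)"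
      using *(3) by (auto intro: order_trans[OF _ abs_ge_self])
    show "f \<in> borel_measurable lborel" using edec_measurable[OF assms] by simp
  qed
qed

lemma edom_reindex: "edom T f \<Longrightarrow> (\<And>\<sigma>. \<sigma> \<in> S \<Longrightarrow> h \<sigma> \<in> T) \<Longrightarrow> edom S (\<lambda>\<sigma>. f (h \<sigma>))"
  unfolding edom_def by meson

lemma edom_cong: "(\<And>\<tau>. \<tau> \<in> T \<Longrightarrow> f \<tau> = g \<tau>) \<Longrightarrow> edom T f \<longleftrightarrow> edom T g"
  unfolding edom_def by auto

lemma edom_add:
  assumes "edom T f" "edom T g"
  shows "edom T (\<lambda>\<tau> \<xi>. f \<tau> \<xi> + g \<tau> \<xi>)"
proof -
  obtain C \<delta> where f: "C > 0" "\<delta> > 0" "\<And>\<tau> \<xi>. \<tau> \<in> T \<Longrightarrow> \<bar>f \<tau> \<xi>\<bar> \<le> C * E \<delta> \<xi>" using edomE[OF assms(1)] by metis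
  obtain D \<epsilon> where g: "D > 0" "\<epsilon> > 0" "\<And>\<tau> \<xi>. \<tau> \<in> T \<Longrightarrow> \<bar>g \<tau> \<xi>\<bar> \<le> D * E \<epsilon> \<xi>" using edomE[OF assms(2)] by metis
  show ?thesis
  proof (rule edomI)
    show "min \<delta> \<epsilon> > 0" using f g by simp
    fix \<tau> \<xi> assume \<tau>: "\<tau> \<in> T"
    have "\<bar>f \<tau> \<xi> + g \<tau> \<xi>\<bar> \<le> C * E \<delta> \<xi> + D * E \<epsilon> \<xi>"
      using f(3)[OF \<tau>, of \<xi>] g(3)[OF \<tau>, of \<xi>] by linarith
    also have "\<dots> \<le> C * E (min \<delta> \<epsilon>) \<xi> + D * E (min \<delta> \<epsilon>) \<xi>"
      using f g by (intro add_mono mult_left_mono E_mono) auto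
    finally show "\<bar>f \<tau> \<xi> + g \<tau> \<xi>\<bar> \<le> (C + D) * E (min \<delta> \<epsilon>) \<xi>" by (simp add: distrib_right)
  qed (intro borel_measurable_add edom_measurable[OF assms(1)] edom_measurable[OF assms(2)])
qed

text \<open>
  Symbols that can be absorbed by an arbitrarily small loss in the exponential rate, such as polynomials and
  bounded functions.
\<close>

definition tempered :: "(real^'n \<Rightarrow> real) \<Rightarrow> bool" where
  "tempered m \<longleftrightarrow> m \<in> borel_measurable borel \<and> (\<forall>\<delta>>0. \<exists>C. \<forall>\<xi>. \<bar>m \<xi>\<bar> * E \<delta> \<xi> \<le> C)"

lemma tempered_bounded:
  assumes "m \<in> borel_measurable borel" "\<And>\<xi>. \<bar>m \<xi>\<bar> \<le> K"
  shows "tempered m"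
  unfolding tempered_def
proof (intro conjI allI impI exI)
  fix \<delta> :: real and \<xi> assume "\<delta> > 0"
  then have "\<bar>m \<xi>\<bar> * E \<delta> \<xi> \<le> K * 1"
    using E_le_1[of \<delta> \<xi>] E_pos[of \<delta> \<xi>] assms(2)[of \<xi>] by (intro mult_mono) auto
  then show "\<bar>m \<xi>\<bar> * E \<delta> \<xi> \<le> K" by simp
qed fact

lemma tempered_const: "tempered (\<lambda>_. c)"
  by (rule tempered_bounded[of _ "\<bar>c\<bar>"]) auto

lemma tempered_l1:
  assumes "m \<in> borel_measurable borel" "\<And>\<xi>. \<bar>m \<xi>\<bar> \<le> K * l1 \<xi>" "K \<ge> 0"
  shows "tempered m"
  unfolding tempered_def
proof (intro conjI allI impI exI)
  fix \<delta> :: real and \<xi> assume d: "\<delta> > 0"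
  have "\<bar>m \<xi>\<bar> * E \<delta> \<xi> \<le> (K * l1 \<xi>) * E \<delta> \<xi>"
    using assms(2) by (intro mult_right_mono) (auto simp: E_pos less_imp_le)
  also have "\<dots> \<le> K * (1 / \<delta>)"
    unfolding mult.assoc using assms(3) l1_E_le[OF d] by (intro mult_left_mono)
  finally show "\<bar>m \<xi>\<bar> * E \<delta> \<xi> \<le> K * (1 / \<delta>)" .
qed fact

lemma tempered_coord: "tempered (\<lambda>\<xi>. \<xi> $ i)"
  by (rule tempered_l1[of _ 1]) (auto simp: abs_le_l1)

lemma tempered_mult:
  assumes "tempered m" "tempered k"
  shows "tempered (\<lambda>\<xi>. m \<xi> * k \<xi>)"
  unfolding tempered_def
proof (intro conjI allI impI)
  show "(\<lambda>\<xi>. m \<xi> * k \<xi>) \<in> borel_measurable borel"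
    using assms unfolding tempered_def by auto
  fix \<delta> :: real assume "\<delta> > 0"
  then obtain C D where C: "\<And>\<xi>. \<bar>m \<xi>\<bar> * E (\<delta>/2) \<xi> \<le> C" and D: "\<And>\<xi>. \<bar>k \<xi>\<bar> * E (\<delta>/2) \<xi> \<le> D"
    using assms unfolding tempered_def by (meson half_gt_zero)
  have "\<bar>m \<xi> * k \<xi>\<bar> * E \<delta> \<xi> \<le> C * D" for \<xi>
  proof -
    have "0 \<le> \<bar>m \<xi>\<bar> * E (\<delta>/2) \<xi>" "0 \<le> \<bar>k \<xi>\<bar> * E (\<delta>/2) \<xi>"
      using E_pos[of "\<delta>/2" \<xi>] by auto
    then have "(\<bar>m \<xi>\<bar> * E (\<delta>/2) \<xi>) * (\<bar>k \<xi>\<bar> * E (\<delta>/2) \<xi>) \<le> C * D"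
      using C[of \<xi>] D[of \<xi>] by (intro mult_mono) auto
    then show ?thesis by (subst E_half) (simp add: abs_mult mult_ac)
  qed
  then show "\<exists>C. \<forall>\<xi>. \<bar>m \<xi> * k \<xi>\<bar> * E \<delta> \<xi> \<le> C" by blast
qed

lemma tempered_add:
  assumes "tempered m" "tempered k"
  shows "tempered (\<lambda>\<xi>. m \<xi> + k \<xi>)"
  unfolding tempered_def
proof (intro conjI allI impI)
  show "(\<lambda>\<xi>. m \<xi> + k \<xi>) \<in> borel_measurable borel"
    using assms unfolding tempered_def by auto
  fix \<delta> :: real assume "\<delta> > 0"
  then obtain C D where C: "\<And>\<xi>. \<bar>m \<xi>\<bar> * E \<delta> \<xi> \<le> C" and D: "\<And>\<xi>. \<bar>k \<xi>\<bar> * E \<delta> \<xi> \<le> D"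
    using assms unfolding tempered_def by meson
  have "\<bar>m \<xi> + k \<xi>\<bar> * E \<delta> \<xi> \<le> C + D" for \<xi>
  proof -
    have "\<bar>m \<xi> + k \<xi>\<bar> * E \<delta> \<xi> \<le> (\<bar>m \<xi>\<bar> + \<bar>k \<xi>\<bar>) * E \<delta> \<xi>"
      by (intro mult_right_mono) (auto simp: E_pos less_imp_le)
    then show ?thesis using C[of \<xi>] D[of \<xi>] by (simp add: distrib_right)
  qed
  then show "\<exists>C. \<forall>\<xi>. \<bar>m \<xi> + k \<xi>\<bar> * E \<delta> \<xi> \<le> C" by blast
qed

lemma tempered_sum:
  "finite A \<Longrightarrow> (\<And>i. i \<in> A \<Longrightarrow> tempered (m i)) \<Longrightarrow> tempered (\<lambda>\<xi>. \<Sum>i\<in>A. m i \<xi>)"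
  by (induction A rule: finite_induct) (auto intro: tempered_const tempered_add)

lemma edom_tempered:
  assumes m: "tempered m" and f: "edom T f"
  shows "edom T (\<lambda>\<tau> \<xi>. m \<xi> * f \<tau> \<xi>)"
proof -
  obtain C \<delta> where f': "C > 0" "\<delta> > 0" "\<And>\<tau> \<xi>. \<tau> \<in> T \<Longrightarrow> \<bar>f \<tau> \<xi>\<bar> \<le> C * E \<delta> \<xi>" using edomE[OF f] by metis
  obtain D where D: "\<And>\<xi>. \<bar>m \<xi>\<bar> * E (\<delta>/2) \<xi> \<le> D"
    using m f'(2) unfolding tempered_def by (meson half_gt_zero)
  show ?thesis
  proof (rule edomI)
    show "\<delta>/2 > 0" using f' by simp
    fix \<tau> \<xi> assume \<tau>: "\<tau> \<in> T"
    have "\<bar>m \<xi> * f \<tau> \<xi>\<bar> \<le> \<bar>m \<xi>\<bar> * (C * E \<delta> \<xi>)"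
      unfolding abs_mult using f'(3)[OF \<tau>] by (intro mult_left_mono) auto
    also have "\<dots> = (\<bar>m \<xi>\<bar> * E (\<delta>/2) \<xi>) * (C * E (\<delta>/2) \<xi>)"
      by (subst E_half) (simp add: mult_ac)
    also have "\<dots> \<le> D * (C * E (\<delta>/2) \<xi>)"
      using D f'(1) by (intro mult_right_mono) (auto simp: E_pos less_imp_le)
    finally show "\<bar>m \<xi> * f \<tau> \<xi>\<bar> \<le> (D * C) * E (\<delta>/2) \<xi>" by (simp add: mult_ac)
  qed (use m edom_measurable[OF f] in \<open>auto simp: tempered_def\<close>)
qed

lemma edom_zero: "edom T (\<lambda>_ _. 0)"
  by (rule edomI[of _ _ 1 0]) auto

section \<open>Convolution\<close>

definition conv :: "(real^'n \<Rightarrow> real) \<Rightarrow> (real^'n \<Rightarrow> real) \<Rightarrow> real^'n \<Rightarrow> real" where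
  "conv f g \<xi> = (LBINT \<eta>. f \<eta> * g (\<xi> - \<eta>))"

lemma measurable_conv:
  assumes [measurable]: "f \<in> borel_measurable borel" "g \<in> borel_measurable borel"
  shows "conv f g \<in> borel_measurable borel"
  unfolding conv_def by measurable

lemma conv_integrand_bound:
  assumes f: "\<And>\<eta>. \<bar>f \<eta>\<bar> \<le> C * E \<delta> \<eta>" and g: "\<And>\<eta>. \<bar>g \<eta>\<bar> \<le> D * E \<delta> \<eta>" and d: "\<delta> > 0" "C > 0" "D > 0"
  shows "\<bar>f \<eta> * g (\<xi> - \<eta>)\<bar> \<le> C * D * E (\<delta>/2) \<xi> * E (\<delta>/2) \<eta>"
proof -
  have "\<bar>f \<eta> * g (\<xi> - \<eta>)\<bar> \<le> (C * E \<delta> \<eta>) * (D * E \<delta> (\<xi> - \<eta>))"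
    unfolding abs_mult using d by (intro mult_mono f g) (auto simp: E_pos less_imp_le)
  also have "\<dots> = (C * D) * (E \<delta> \<eta> * E \<delta> (\<xi> - \<eta>))" by simp
  also have "\<dots> \<le> (C * D) * (E (\<delta>/2) \<xi> * E (\<delta>/2) \<eta>)"
    using d by (intro mult_left_mono E_conv_split) auto
  finally show ?thesis by (simp add: mult_ac)
qed

lemma edom_common:
  assumes "edom T f" "edom S g"
  obtains C D \<delta> where "C > 0" "D > 0" "\<delta> > 0" "\<And>\<tau> \<xi>. \<tau> \<in> T \<Longrightarrow> \<bar>f \<tau> \<xi>\<bar> \<le> C * E \<delta> \<xi>" "\<And>\<tau> \<xi>. \<tau> \<in> S \<Longrightarrow> \<bar>g \<tau> \<xi>\<bar> \<le> D * E \<delta> \<xi>"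
proof -
  obtain C \<delta> where f: "C > 0" "\<delta> > 0" "\<And>\<tau> \<xi>. \<tau> \<in> T \<Longrightarrow> \<bar>f \<tau> \<xi>\<bar> \<le> C * E \<delta> \<xi>" using edomE[OF assms(1)] by metis
  obtain D \<epsilon> where g: "D > 0" "\<epsilon> > 0" "\<And>\<tau> \<xi>. \<tau> \<in> S \<Longrightarrow> \<bar>g \<tau> \<xi>\<bar> \<le> D * E \<epsilon> \<xi>" using edomE[OF assms(2)] by metis
  have "\<bar>f \<tau> \<xi>\<bar> \<le> C * E (min \<delta> \<epsilon>) \<xi>" if "\<tau> \<in> T" for \<tau> \<xi>
    by (rule order_trans[OF f(3)[OF that]]) (use f(1) in \<open>auto intro!: mult_left_mono E_mono\<close>)
  moreover have "\<bar>g \<tau> \<xi>\<bar> \<le> D * E (min \<delta> \<epsilon>) \<xi>" if "\<tau> \<in> S" for \<tau> \<xi>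
    by (rule order_trans[OF g(3)[OF that]]) (use g(1) in \<open>auto intro!: mult_left_mono E_mono\<close>)
  ultimately show ?thesis
    using f(1,2) g(1,2) by (intro that[of C D "min \<delta> \<epsilon>"]) auto
qed

lemma conv_integrable:
  assumes f: "edec f" and g: "edec g"
  shows "integrable lborel (\<lambda>\<eta>. f \<eta> * g (\<xi> - \<eta>))"
proof -
  obtain C D \<delta> where *: "C > 0" "D > 0" "\<delta> > 0" "\<And>\<xi>. \<bar>f \<xi>\<bar> \<le> C * E \<delta> \<xi>" "\<And>\<xi>. \<bar>g \<xi>\<bar> \<le> D * E \<delta> \<xi>"
    using edom_common[OF edec_edom[OF f, of UNIV] edec_edom[OF g, of UNIV]] by (metis UNIV_I)
  have [measurable]: "f \<in> borel_measurable borel" "g \<in> borel_measurable borel"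
    using f g by (auto simp: edec_def)
  show ?thesis
  proof (rule Bochner_Integration.integrable_bound)
    show "integrable lborel (\<lambda>\<eta>. C * D * E (\<delta>/2) \<xi> * E (\<delta>/2) \<eta>)"
      using * by (intro integrable_mult_right integrable_E) auto
    show "AE \<eta> in lborel. norm (f \<eta> * g (\<xi> - \<eta>)) \<le> norm (C * D * E (\<delta>/2) \<xi> * E (\<delta>/2) \<eta>)"
      using conv_integrand_bound[OF *(4,5) *(3,1,2)]
      by (auto intro: order_trans[OF _ abs_ge_self])
  qed measurable
qed

lemma edom_conv:
  fixes f g :: "'i \<Rightarrow> real^'n \<Rightarrow> real"
  assumes f: "edom T f" and g: "edom T g"
  shows "edom T (\<lambda>\<tau>. conv (f \<tau>) (g \<tau>))"
proof -
  obtain C D \<delta> where *: "C > 0" "D > 0" "\<delta> > 0" "\<And>\<tau> \<xi>. \<tau> \<in> T \<Longrightarrow> \<bar>f \<tau> \<xi>\<bar> \<le> C * E \<delta> \<xi>" "\<And>\<tau> \<xi>. \<tau> \<in> T \<Longrightarrow> \<bar>g \<tau> \<xi>\<bar> \<le> D * E \<delta> \<xi>"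
    using edom_common[OF f g] by metis
  show ?thesis
  proof (rule edomI)
    show "\<delta>/2 > 0" using * by simp
    show "conv (f \<tau>) (g \<tau>) \<in> borel_measurable borel" if "\<tau> \<in> T" for \<tau>
      by (rule measurable_conv edom_measurable[OF f that] edom_measurable[OF g that])+
    fix \<tau> \<xi> assume \<tau>: "\<tau> \<in> T"
    have "\<bar>conv (f \<tau>) (g \<tau>) \<xi>\<bar> \<le> (LBINT \<eta>. \<bar>f \<tau> \<eta> * g \<tau> (\<xi> - \<eta>)\<bar>)"
      unfolding conv_def by (rule integral_abs_bound)
    also have "\<dots> \<le> (LBINT \<eta>. C * D * E (\<delta>/2) \<xi> * E (\<delta>/2) (\<eta>::real^'n))"
    proof (rule Bochner_Integration.integral_mono)
      show "integrable lborel (\<lambda>\<eta>. \<bar>f \<tau> \<eta> * g \<tau> (\<xi> - \<eta>)\<bar>)"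
        using conv_integrable[OF edom_edec[OF f \<tau>] edom_edec[OF g \<tau>]] by (rule Bochner_Integration.integrable_abs)
      show "integrable lborel (\<lambda>\<eta>. C * D * E (\<delta>/2) \<xi> * E (\<delta>/2) \<eta>)"
        using * by (intro integrable_mult_right integrable_E) auto
      show "\<bar>f \<tau> \<eta> * g \<tau> (\<xi> - \<eta>)\<bar> \<le> C * D * E (\<delta>/2) \<xi> * E (\<delta>/2) \<eta>" for \<eta>
        by (rule conv_integrand_bound[OF *(4)[OF \<tau>] *(5)[OF \<tau>] *(3,1,2)])
    qed
    also have "\<dots> = (C * D * (LBINT \<eta>. E (\<delta>/2) (\<eta>::real^'n))) * E (\<delta>/2) \<xi>"
      by simp
    finally show "\<bar>conv (f \<tau>) (g \<tau>) \<xi>\<bar> \<le> \<dots>" .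
  qed
qed

text \<open>
  The usual splitting of a difference of two products.
\<close>

lemma conv_combine:
  assumes "edec f" "edec f'" "edec g" "edec g'"
  shows "conv f g \<xi> - conv f' g' \<xi> = conv (\<lambda>\<xi>. f \<xi> - f' \<xi>) g \<xi> + conv f' (\<lambda>\<xi>. g \<xi> - g' \<xi>) \<xi>"
proof -
  have "conv (\<lambda>\<xi>. f \<xi> - f' \<xi>) g \<xi> = conv f g \<xi> - conv f' g \<xi>"
    unfolding conv_def left_diff_distrib
    by (intro Bochner_Integration.integral_diff conv_integrable assms)
  moreover have "conv f' (\<lambda>\<xi>. g \<xi> - g' \<xi>) \<xi> = conv f' g \<xi> - conv f' g' \<xi>"
    unfolding conv_def right_diff_distrib
    by (intro Bochner_Integration.integral_diff conv_integrable assms)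
  ultimately show ?thesis by simp
qed

lemma conv_cmult: "conv (\<lambda>\<xi>. f \<xi> / c) g \<xi> = conv f g \<xi> / c" "conv f (\<lambda>\<xi>. g \<xi> / c) \<xi> = conv f g \<xi> / c"
  unfolding conv_def by simp_all

section \<open>Smooth amplitudes\<close>

abbreviation "I01 \<equiv> {0..1::real}"

text \<open>
  On the diagonal \<open>s = t\<close> both quotients below take the value \<open>0\<close>, because division by zero yields \<open>0\<close>.
  So they may be bounded on the whole square.
\<close>

definition diffq :: "(real \<Rightarrow> real^'n \<Rightarrow> real) \<Rightarrow> real \<times> real \<Rightarrow> real^'n \<Rightarrow> real" where
  "diffq a = (\<lambda>(s, t) \<xi>. (a s \<xi> - a t \<xi>) / (s - t))"

definition taylorq :: "(real \<Rightarrow> real^'n \<Rightarrow> real) \<Rightarrow> (real \<Rightarrow> real^'n \<Rightarrow> real) \<Rightarrow> real \<times> real \<Rightarrow> real^'n \<Rightarrow> real" where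
  "taylorq a a' = (\<lambda>(s, t) \<xi>. (a s \<xi> - a t \<xi> - (s - t) * a' t \<xi>) / (s - t)\<^sup>2)"

definition tame :: "(real \<Rightarrow> real^'n \<Rightarrow> real) \<Rightarrow> bool" where
  "tame a \<longleftrightarrow> edom I01 a \<and> edom (I01 \<times> I01) (diffq a)"

text \<open>
  Time regularity of an amplitude of order \<open>k + 1\<close>: there is a candidate derivative of order \<open>k\<close> whose Taylor remainder
  is quadratic in \<open>s - t\<close>, with a dominated quotient. A quadratic remainder, rather than mere differentiability,
  allows the products, convolutions and Fourier integrals below to be differentiated by
  integrating inequalities instead of using dominated convergence.
\<close>

primrec smooth_amp :: "nat \<Rightarrow> (real \<Rightarrow> real^'n \<Rightarrow> real) \<Rightarrow> bool" where
  "smooth_amp 0 a \<longleftrightarrow> tame a"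
| "smooth_amp (Suc k) a \<longleftrightarrow> tame a \<and> (\<exists>a'. smooth_amp k a' \<and> edom (I01 \<times> I01) (taylorq a a'))"

lemma smooth_amp_tame: "smooth_amp k a \<Longrightarrow> tame a" by (cases k) auto

lemma smooth_amp_edom: "smooth_amp k a \<Longrightarrow> edom I01 a" using smooth_amp_tame tame_def by blast

lemma smooth_amp_Suc_D: "smooth_amp (Suc k) a \<Longrightarrow> smooth_amp k a"
proof (induction k arbitrary: a)
  case (Suc k)
  then obtain a' where "smooth_amp (Suc k) a'" "edom (I01 \<times> I01) (taylorq a a')" "tame a" by auto
  with Suc.IH[of a'] show ?case by auto
qed auto

lemma diffq_taylorq_linear:
  "diffq (\<lambda>t \<xi>. a t \<xi> + c t \<xi>) = (\<lambda>p \<xi>. diffq a p \<xi> + diffq c p \<xi>)"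
  "diffq (\<lambda>t \<xi>. m \<xi> * a t \<xi>) = (\<lambda>p \<xi>. m \<xi> * diffq a p \<xi>)"
  "taylorq (\<lambda>t \<xi>. a t \<xi> + c t \<xi>) (\<lambda>t \<xi>. a' t \<xi> + c' t \<xi>) = (\<lambda>p \<xi>. taylorq a a' p \<xi> + taylorq c c' p \<xi>)"
  "taylorq (\<lambda>t \<xi>. m \<xi> * a t \<xi>) (\<lambda>t \<xi>. m \<xi> * a' t \<xi>) = (\<lambda>p \<xi>. m \<xi> * taylorq a a' p \<xi>)"
  by (auto simp: diffq_def taylorq_def fun_eq_iff add_divide_distrib[symmetric] algebra_simps)

lemma tame_add: "tame a \<Longrightarrow> tame c \<Longrightarrow> tame (\<lambda>t \<xi>. a t \<xi> + c t \<xi>)"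
  unfolding tame_def diffq_taylorq_linear by (intro conjI edom_add) auto

lemma tame_mult: "tempered m \<Longrightarrow> tame a \<Longrightarrow> tame (\<lambda>t \<xi>. m \<xi> * a t \<xi>)"
  unfolding tame_def diffq_taylorq_linear by (intro conjI edom_tempered) auto

lemma smooth_amp_add: "smooth_amp k a \<Longrightarrow> smooth_amp k c \<Longrightarrow> smooth_amp k (\<lambda>t \<xi>. a t \<xi> + c t \<xi>)"
proof (induction k arbitrary: a c)
  case (Suc k)
  then obtain a' c' where "smooth_amp k a'" "edom (I01 \<times> I01) (taylorq a a')" "tame a"
     "smooth_amp k c'" "edom (I01 \<times> I01) (taylorq c c')" "tame c" by auto
  then show ?case using Suc.IH[of a' c']
    by (auto intro!: tame_add exI[of _ "\<lambda>t \<xi>. a' t \<xi> + c' t \<xi>"] edom_add simp: diffq_taylorq_linear)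
qed (simp add: tame_add)

lemma smooth_amp_mult: "tempered m \<Longrightarrow> smooth_amp k a \<Longrightarrow> smooth_amp k (\<lambda>t \<xi>. m \<xi> * a t \<xi>)"
proof (induction k arbitrary: a)
  case (Suc k)
  then obtain a' where "smooth_amp k a'" "edom (I01 \<times> I01) (taylorq a a')" "tame a" by auto
  then show ?case using Suc.IH[of a'] Suc.prems
    by (auto intro!: tame_mult exI[of _ "\<lambda>t \<xi>. m \<xi> * a' t \<xi>"] edom_tempered simp: diffq_taylorq_linear)
qed (simp add: tame_mult)

lemma smooth_amp_zero: "smooth_amp k (\<lambda>_ _. 0)"
  by (induction k) (auto simp: tame_def diffq_def taylorq_def case_prod_unfold intro!: edom_zero exI[of _ "\<lambda>_ _. 0"])

lemma smooth_amp_const: "edec f \<Longrightarrow> smooth_amp k (\<lambda>_. f)"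
  by (cases k) (auto simp: tame_def diffq_def taylorq_def case_prod_unfold intro!: edom_zero edec_edom smooth_amp_zero exI[of _ "\<lambda>_ _. 0"])

lemma smooth_amp_sum: "finite A \<Longrightarrow> (\<And>i. i \<in> A \<Longrightarrow> smooth_amp k (a i)) \<Longrightarrow> smooth_amp k (\<lambda>t \<xi>. \<Sum>i\<in>A. a i t \<xi>)"
  by (induction A rule: finite_induct) (auto intro: smooth_amp_zero smooth_amp_add)

lemma tame_edec: "tame a \<Longrightarrow> t \<in> I01 \<Longrightarrow> edec (a t)"
  unfolding tame_def by (blast intro: edom_edec)

lemma tame_conv:
  assumes a: "tame a" and c: "tame c"
  shows "tame (\<lambda>t. conv (a t) (c t))"
proof -
  have "diffq (\<lambda>t. conv (a t) (c t)) p = (\<lambda>\<xi>. conv (diffq a p) (c (fst p)) \<xi> + conv (a (snd p)) (diffq c p) \<xi>)"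
    if p: "p \<in> I01 \<times> I01" for p
  proof -
    obtain s t where st: "p = (s, t)" "s \<in> I01" "t \<in> I01" using p by auto
    show ?thesis
      using conv_combine[OF tame_edec[OF a st(2)] tame_edec[OF a st(3)] tame_edec[OF c st(2)] tame_edec[OF c st(3)]]
      unfolding st diffq_def by (simp add: conv_cmult add_divide_distrib[symmetric])
  qed
  moreover have "edom (I01 \<times> I01) (\<lambda>p \<xi>. conv (diffq a p) (c (fst p)) \<xi> + conv (a (snd p)) (diffq c p) \<xi>)"
    using a c unfolding tame_def
    by (intro edom_add edom_conv edom_reindex[of I01 c _ fst] edom_reindex[of I01 a _ snd]) auto
  ultimately have "edom (I01 \<times> I01) (diffq (\<lambda>t. conv (a t) (c t)))"
    by (simp cong: edom_cong)
  then show ?thesis using a c unfolding tame_def by (auto intro: edom_conv)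
qed

text \<open>
  The product rule with remainder, for \<open>a c\<close> in place of the convolution and \<open>\<tau> = s - t\<close>:
  \<open>a\<^sub>s c\<^sub>s - a\<^sub>t c\<^sub>t - \<tau> (a' c\<^sub>t + a\<^sub>t c') = (a\<^sub>s - a\<^sub>t - \<tau> a') c\<^sub>s + \<tau> a' (c\<^sub>s - c\<^sub>t) + a\<^sub>t (c\<^sub>s - c\<^sub>t - \<tau> c')\<close>.
\<close>

lemma taylorq_conv:
  assumes a: "edec (a s)" "edec (a t)" "edec (a' t)" and c: "edec (c s)" "edec (c t)" "edec (c' t)"
  shows "taylorq (\<lambda>t. conv (a t) (c t)) (\<lambda>t \<xi>. conv (a' t) (c t) \<xi> + conv (a t) (c' t) \<xi>) (s, t)
    = (\<lambda>\<xi>. (conv (taylorq a a' (s, t)) (c s) \<xi> + conv (a' t) (diffq c (s, t)) \<xi>) + conv (a t) (taylorq c c' (s, t)) \<xi>)"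
proof (cases "s = t")
  case True
  then show ?thesis by (simp add: taylorq_def diffq_def conv_def fun_eq_iff)
next
  case False
  note i = conv_integrable
  have 1: "conv (taylorq a a' (s, t)) (c s) \<xi> = (conv (a s) (c s) \<xi> - conv (a t) (c s) \<xi> - (s - t) * conv (a' t) (c s) \<xi>) / (s - t)\<^sup>2" for \<xi>
    unfolding taylorq_def prod.case conv_cmult unfolding conv_def
    by (simp add: left_diff_distrib mult.assoc i a c)
  have 2: "conv (a' t) (diffq c (s, t)) \<xi> = (conv (a' t) (c s) \<xi> - conv (a' t) (c t) \<xi>) / (s - t)" for \<xi>
    unfolding diffq_def prod.case conv_cmult unfolding conv_def
    by (simp add: right_diff_distrib i a c)
  have 3: "conv (a t) (taylorq c c' (s, t)) \<xi> = (conv (a t) (c s) \<xi> - conv (a t) (c t) \<xi> - (s - t) * conv (a t) (c' t) \<xi>) / (s - t)\<^sup>2" for \<xi>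
    unfolding taylorq_def prod.case conv_cmult unfolding conv_def
    by (simp add: right_diff_distrib mult.left_commute[of _ "s - t"] i a c)
  show ?thesis unfolding 1 2 3 unfolding taylorq_def prod.case
    using False by (simp add: fun_eq_iff power2_eq_square divide_simps) (simp add: algebra_simps)
qed

lemma smooth_amp_conv: "smooth_amp k a \<Longrightarrow> smooth_amp k c \<Longrightarrow> smooth_amp k (\<lambda>t. conv (a t) (c t))"
proof (induction k arbitrary: a c)
  case (Suc k)
  then obtain a' c' where a: "smooth_amp k a'" "edom (I01 \<times> I01) (taylorq a a')" "tame a" and
     c: "smooth_amp k c'" "edom (I01 \<times> I01) (taylorq c c')" "tame c" by auto
  have "smooth_amp k (\<lambda>t \<xi>. conv (a' t) (c t) \<xi> + conv (a t) (c' t) \<xi>)"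
    using Suc a c by (intro smooth_amp_add Suc.IH) (auto intro: smooth_amp_Suc_D simp del: smooth_amp.simps)
  moreover have "edom (I01 \<times> I01) (taylorq (\<lambda>t. conv (a t) (c t)) (\<lambda>t \<xi>. conv (a' t) (c t) \<xi> + conv (a t) (c' t) \<xi>))"
  proof (subst edom_cong)
    fix p assume "p \<in> I01 \<times> I01"
    then obtain s t where p: "p = (s, t)" "s \<in> I01" "t \<in> I01" by auto
    show "taylorq (\<lambda>t. conv (a t) (c t)) (\<lambda>t \<xi>. conv (a' t) (c t) \<xi> + conv (a t) (c' t) \<xi>) p =
      (\<lambda>\<xi>. (conv (taylorq a a' p) (c (fst p)) \<xi> + conv (a' (snd p)) (diffq c p) \<xi>) + conv (a (snd p)) (taylorq c c' p) \<xi>)"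
      unfolding p fst_conv snd_conv using a c p smooth_amp_tame[OF a(1)] smooth_amp_tame[OF c(1)] by (intro taylorq_conv tame_edec)
  next
    show "edom (I01 \<times> I01) (\<lambda>p \<xi>. (conv (taylorq a a' p) (c (fst p)) \<xi> + conv (a' (snd p)) (diffq c p) \<xi>) + conv (a (snd p)) (taylorq c c' p) \<xi>)"
      using a c smooth_amp_tame[OF a(1)] unfolding tame_def
      by (intro edom_add edom_conv edom_reindex[of I01 c _ fst] edom_reindex[of I01 a _ snd] edom_reindex[of I01 a' _ snd]) auto
  qed
  ultimately show ?case using tame_conv[OF a(3) c(3)] by auto
qed (simp add: tame_conv)

section \<open>Cosine synthesis\<close>

text \<open>
  The phase \<open>\<theta>\<close> treats sine and cosine together: differentiating in \<open>x\<close> shifts it by \<open>\<pi>/2\<close>, and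
  \<open>\<theta> = -\<pi>/2\<close> gives the sine integrals.
\<close>

definition synth :: "real \<Rightarrow> (real^'n \<Rightarrow> real) \<Rightarrow> real^'n \<Rightarrow> real" where
  "synth \<theta> a x = (LBINT \<xi>. cos (\<xi> \<bullet> x + \<theta>) * a \<xi>)"

lemma synth_integrable:
  assumes "edec a" shows "integrable lborel (\<lambda>\<xi>. cos (\<xi> \<bullet> x + \<theta>) * a \<xi>)"
proof (rule Bochner_Integration.integrable_bound[OF edec_integrable[OF assms]])
  have [measurable]: "a \<in> borel_measurable borel" by (rule edec_measurable[OF assms])
  show "(\<lambda>\<xi>. cos (\<xi> \<bullet> x + \<theta>) * a \<xi>) \<in> borel_measurable lborel" by measurable
  show "AE \<xi> in lborel. norm (cos (\<xi> \<bullet> x + \<theta>) * a \<xi>) \<le> norm (a \<xi>)"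
    by (intro always_eventually) (simp add: abs_mult mult_left_le_one_le)
qed

lemma synth_add: "edec a \<Longrightarrow> edec c \<Longrightarrow> synth \<theta> (\<lambda>\<xi>. a \<xi> + c \<xi>) x = synth \<theta> a x + synth \<theta> c x"
  unfolding synth_def distrib_left by (intro Bochner_Integration.integral_add synth_integrable)

lemma synth_diff: "edec a \<Longrightarrow> edec c \<Longrightarrow> synth \<theta> (\<lambda>\<xi>. a \<xi> - c \<xi>) x = synth \<theta> a x - synth \<theta> c x"
  unfolding synth_def right_diff_distrib by (intro Bochner_Integration.integral_diff synth_integrable)

lemma synth_cmult: "synth \<theta> (\<lambda>\<xi>. r * a \<xi>) x = r * synth \<theta> a x"
  unfolding synth_def by (simp add: mult.left_commute)

lemma synth_zero: "synth \<theta> (\<lambda>\<xi>. 0) x = 0"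
  unfolding synth_def by simp

lemma edec_edom_iff: "edec f \<longleftrightarrow> edom UNIV (\<lambda>_::unit. f)"
  by (auto intro: edec_edom edom_edec)

lemma edec_add: "edec a \<Longrightarrow> edec c \<Longrightarrow> edec (\<lambda>\<xi>. a \<xi> + c \<xi>)"
  unfolding edec_edom_iff by (rule edom_add)

lemma edec_zero: "edec (\<lambda>\<xi>. 0)"
  unfolding edec_edom_iff by (rule edom_zero)

lemma edec_mult: "tempered m \<Longrightarrow> edec a \<Longrightarrow> edec (\<lambda>\<xi>. m \<xi> * a \<xi>)"
  unfolding edec_edom_iff by (rule edom_tempered)

lemma edec_conv: "edec a \<Longrightarrow> edec c \<Longrightarrow> edec (conv a c)"
  unfolding edec_edom_iff by (rule edom_conv)

lemma edec_sum: "finite A \<Longrightarrow> (\<And>i. i \<in> A \<Longrightarrow> edec (a i)) \<Longrightarrow> edec (\<lambda>\<xi>. \<Sum>i\<in>A. a i \<xi>)"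
  by (induction A rule: finite_induct) (auto intro: edec_zero edec_add)

lemma synth_sum:
  "finite A \<Longrightarrow> (\<And>i. i \<in> A \<Longrightarrow> edec (a i)) \<Longrightarrow> synth \<theta> (\<lambda>\<xi>. \<Sum>i\<in>A. a i \<xi>) x = (\<Sum>i\<in>A. synth \<theta> (a i) x)"
  by (induction A rule: finite_induct) (auto simp: synth_zero synth_add edec_sum)

lemma edom_abs: assumes "edom T f" shows "edom T (\<lambda>\<tau> \<xi>. \<bar>f \<tau> \<xi>\<bar>)"
proof -
  have [measurable]: "\<tau> \<in> T \<Longrightarrow> f \<tau> \<in> borel_measurable borel" for \<tau> using edom_measurable[OF assms] .
  obtain C \<delta> where *: "C > 0" "\<delta> > 0" "\<And>\<tau> \<xi>. \<tau> \<in> T \<Longrightarrow> \<bar>f \<tau> \<xi>\<bar> \<le> C * E \<delta> \<xi>" using edomE[OF assms] by metis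
  show ?thesis by (rule edomI[OF _ *(2)]) (use *(3) in auto)
qed

lemma edom_integral_bound:
  fixes f :: "'i \<Rightarrow> real^'n \<Rightarrow> real"
  assumes "edom T f"
  shows "\<exists>K\<ge>0. \<forall>\<tau>\<in>T. (LBINT \<xi>. \<bar>f \<tau> \<xi>\<bar>) \<le> K"
proof -
  obtain C \<delta> where *: "C > 0" "\<delta> > 0" "\<And>\<tau> \<xi>. \<tau> \<in> T \<Longrightarrow> \<bar>f \<tau> \<xi>\<bar> \<le> C * E \<delta> \<xi>" using edomE[OF assms] by metis
  show ?thesis
  proof (intro exI conjI ballI)
    show "0 \<le> (LBINT \<xi>. C * E \<delta> (\<xi>::real^'n))"
      using *(1) by (intro Bochner_Integration.integral_nonneg) (auto simp: E_pos less_imp_le)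
    show "(LBINT \<xi>. \<bar>f \<tau> \<xi>\<bar>) \<le> (LBINT \<xi>. C * E \<delta> (\<xi>::real^'n))" if "\<tau> \<in> T" for \<tau>
      by (intro Bochner_Integration.integral_mono Bochner_Integration.integrable_abs edec_integrable edom_edec[OF assms that]
          integrable_mult_right integrable_E *)
         (use *(3) that in auto)
  qed
qed

lemma cos_lipschitz: "\<bar>cos y - cos x\<bar> \<le> \<bar>y - x\<bar>" and sin_lipschitz: "\<bar>sin y - sin x\<bar> \<le> \<bar>y - x\<bar>" for x y :: real
proof -
  show "\<bar>cos y - cos x\<bar> \<le> \<bar>y - x\<bar>"
    using field_differentiable_bound[of UNIV cos "\<lambda>x. - sin x" 1 y x] by (auto intro!: derivative_eq_intros)
  show "\<bar>sin y - sin x\<bar> \<le> \<bar>y - x\<bar>"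
    using field_differentiable_bound[of UNIV sin cos 1 y x] by (auto intro!: derivative_eq_intros)
qed

text \<open>
  Second-order Taylor bound for the cosine; \<open>cos (z + \<pi>/2)\<close> is its derivative.
\<close>

lemma cos_quadratic: "\<bar>cos (z + d) - cos z - d * cos (z + pi/2)\<bar> \<le> d\<^sup>2" for z d :: real
proof -
  have "\<bar>(cos (z + d) + (z + d) * sin z) - (cos z + z * sin z)\<bar> \<le> \<bar>d\<bar> * \<bar>(z + d) - z\<bar>"
    unfolding real_norm_def[symmetric]
  proof (rule field_differentiable_bound[of "closed_segment z (z + d)"])
    fix w assume w: "w \<in> closed_segment z (z + d)"
    show "((\<lambda>w. cos w + w * sin z) has_field_derivative (- sin w + sin z)) (at w within closed_segment z (z + d))"
      by (auto intro!: derivative_eq_intros)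
    have "\<bar>w - z\<bar> \<le> \<bar>d\<bar>" using w by (auto simp: closed_segment_eq_real_ivl split: if_splits)
    then show "norm (- sin w + sin z) \<le> norm d" using sin_lipschitz[of z w] by auto
  qed auto
  then show ?thesis by (simp add: cos_add algebra_simps power2_eq_square abs_mult[symmetric])
qed

lemma inner_abs_le: "\<bar>\<xi> \<bullet> h\<bar> \<le> l1 \<xi> * norm h"
  by (rule order_trans[OF Cauchy_Schwarz_ineq2]) (intro mult_right_mono norm_le_l1 norm_ge_zero)

lemma tempered_l1': "tempered l1"
  by (rule tempered_l1[of _ 1]) (auto simp: l1_nonneg)

lemma abs3_le: "\<bar>p\<bar> \<le> P \<Longrightarrow> \<bar>q\<bar> \<le> Q \<Longrightarrow> \<bar>r\<bar> \<le> R \<Longrightarrow> P + Q + R = S \<Longrightarrow> \<bar>p + q + r\<bar> \<le> S" for p q r P Q R S :: real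
  by linarith

lemma has_derivative_quadratic:
  assumes L: "bounded_linear L" and b: "\<And>y. y \<in> S \<Longrightarrow> norm (f y - f x - L (y - x)) \<le> K * (norm (y - x))\<^sup>2"
  shows "(f has_derivative L) (at x within S)"
proof (rule has_derivativeI_sandwich[of 1])
  show "bounded_linear L" by fact
  show "norm ((f y - f x) - L (y - x)) / norm (y - x) \<le> K * norm (y - x)" if "y \<in> S" "y \<noteq> x" for y
    using b[OF that(1)] that(2) by (simp add: divide_le_eq power2_eq_square mult.assoc)
  have "((\<lambda>y. K * norm (y - x)) \<longlongrightarrow> K * norm (x - x)) (at x within S)"
    by (intro tendsto_intros)
  then show "((\<lambda>y. K * norm (y - x)) \<longlongrightarrow> 0) (at x within S)" by simp
qed simp

definition synth_deriv where
  "synth_deriv \<theta> a a' t x v = fst v * synth \<theta> (a' t) x + (\<Sum>i\<in>UNIV. snd v $ i * synth (\<theta> + pi/2) (\<lambda>\<xi>. \<xi> $ i * a t \<xi>) x)"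

text \<open>
  The remainder at \<open>(s, y)\<close> splits into three integrals: the Taylor remainder of the amplitude in time, a mixed term
  \<open>(s - t) (cos (\<xi> \<bullet> y + \<theta>) - cos (\<xi> \<bullet> x + \<theta>)) a'\<close>, and the Taylor remainder of the cosine in space. Each
  integrand is at most the squared distance times a dominated amplitude, as powers of \<open>\<xi>\<close> are
  absorbed by the exponential.
\<close>

lemma synth_has_derivative:
  fixes a a' :: "real \<Rightarrow> real^'n \<Rightarrow> real"
  assumes a: "tame a" and a': "edom I01 a'" and r: "edom (I01 \<times> I01) (taylorq a a')" and t: "t \<in> I01"
  shows "((\<lambda>p. synth \<theta> (a (fst p)) (snd p)) has_derivative synth_deriv \<theta> a a' t x) (at (t, x) within I01 \<times> UNIV)"
proof -
  let ?G = "\<lambda>p \<xi>. \<bar>taylorq a a' p \<xi>\<bar> + l1 \<xi> * \<bar>a' (snd p) \<xi>\<bar> + l1 \<xi> * (l1 \<xi> * \<bar>a (snd p) \<xi>\<bar>)"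
  have G: "edom (I01 \<times> I01) ?G"
    using assms unfolding tame_def
    by (intro edom_add edom_abs edom_tempered[OF tempered_l1'] edom_reindex[of I01 a _ snd] edom_reindex[of I01 a' _ snd]) auto
  obtain K where K: "\<forall>p \<in> I01 \<times> I01. (LBINT \<xi>. \<bar>?G p \<xi>\<bar>) \<le> K"
    using edom_integral_bound[OF G] by blast
  show ?thesis
  proof (rule has_derivative_quadratic)
    show "bounded_linear (synth_deriv \<theta> a a' t x)"
      unfolding synth_deriv_def[abs_def]
      by (intro bounded_linear_add bounded_linear_sum bounded_linear_mult_const bounded_linear_fst
          bounded_linear_compose[OF bounded_linear_vec_nth bounded_linear_snd])
    fix q assume "q \<in> I01 \<times> (UNIV :: (real^'n) set)"
    then obtain s y where q: "q = (s, y)" and s: "s \<in> I01" by auto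
    let ?D = "norm ((s, y) - (t, x))"
    have D: "\<bar>s - t\<bar> \<le> ?D" "norm (y - x) \<le> ?D"
      using norm_fst_le[of "(s - t)" "y - x"] norm_snd_le[of "y - x" "s - t"] by auto
    note e = tame_edec[OF a s] tame_edec[OF a t] edom_edec[OF a' t]
    let ?h = "y - x"
    have lin: "(\<Sum>i\<in>UNIV. ?h $ i * synth (\<theta> + pi/2) (\<lambda>\<xi>. \<xi> $ i * a t \<xi>) x) = synth (\<theta> + pi/2) (\<lambda>\<xi>. (\<xi> \<bullet> ?h) * a t \<xi>) x"
    proof -
      have "synth (\<theta> + pi/2) (\<lambda>\<xi>. \<Sum>i\<in>UNIV. ?h $ i * (\<xi> $ i * a t \<xi>)) x = (\<Sum>i\<in>UNIV. ?h $ i * synth (\<theta> + pi/2) (\<lambda>\<xi>. \<xi> $ i * a t \<xi>) x)"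
        by (subst synth_sum) (auto intro!: edec_mult tempered_const tempered_coord e simp: synth_cmult)
      moreover have "(\<Sum>i\<in>UNIV. ?h $ i * (\<xi> $ i * a t \<xi>)) = (\<xi> \<bullet> ?h) * a t \<xi>" for \<xi>
        by (simp add: inner_vec_def sum_distrib_left sum_distrib_right mult_ac)
      ultimately show ?thesis by simp
    qed
    have eh: "edec (\<lambda>\<xi>. (\<xi> \<bullet> ?h) * a t \<xi>)"
      unfolding inner_vec_def by (intro edec_mult tempered_sum e) (auto intro: tempered_mult[OF tempered_coord tempered_const])
    have "synth \<theta> (a s) y - synth \<theta> (a t) x - synth_deriv \<theta> a a' t x ((s, y) - (t, x))
      = synth \<theta> (a s) y - synth \<theta> (a t) x - ((s - t) * synth \<theta> (a' t) x + synth (\<theta> + pi/2) (\<lambda>\<xi>. (\<xi> \<bullet> ?h) * a t \<xi>) x)"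
      unfolding synth_deriv_def using lin by simp
    also have "\<dots> = (LBINT \<xi>. cos (\<xi> \<bullet> y + \<theta>) * a s \<xi> - cos (\<xi> \<bullet> x + \<theta>) * a t \<xi>
       - ((s - t) * (cos (\<xi> \<bullet> x + \<theta>) * a' t \<xi>) + cos (\<xi> \<bullet> x + (\<theta> + pi/2)) * ((\<xi> \<bullet> ?h) * a t \<xi>)))"
      unfolding synth_def
      using e eh
      by (simp only: Bochner_Integration.integral_diff Bochner_Integration.integral_add synth_integrable
          Bochner_Integration.integrable_diff Bochner_Integration.integrable_add integrable_mult_right integral_mult_right_zero)
    finally have eq: "synth \<theta> (a s) y - synth \<theta> (a t) x - synth_deriv \<theta> a a' t x ((s, y) - (t, x)) = \<dots>" .
    have "\<bar>synth \<theta> (a s) y - synth \<theta> (a t) x - synth_deriv \<theta> a a' t x ((s, y) - (t, x))\<bar>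
       \<le> (LBINT \<xi>. \<bar>cos (\<xi> \<bullet> y + \<theta>) * a s \<xi> - cos (\<xi> \<bullet> x + \<theta>) * a t \<xi>
       - ((s - t) * (cos (\<xi> \<bullet> x + \<theta>) * a' t \<xi>) + cos (\<xi> \<bullet> x + (\<theta> + pi/2)) * ((\<xi> \<bullet> ?h) * a t \<xi>))\<bar>)"
      unfolding eq by (rule integral_abs_bound)
    also have "\<dots> \<le> (LBINT \<xi>. ?D\<^sup>2 * \<bar>?G (s, t) \<xi>\<bar>)"
    proof (rule Bochner_Integration.integral_mono)
      show "integrable lborel (\<lambda>\<xi>. \<bar>cos (\<xi> \<bullet> y + \<theta>) * a s \<xi> - cos (\<xi> \<bullet> x + \<theta>) * a t \<xi>
       - ((s - t) * (cos (\<xi> \<bullet> x + \<theta>) * a' t \<xi>) + cos (\<xi> \<bullet> x + (\<theta> + pi/2)) * ((\<xi> \<bullet> ?h) * a t \<xi>))\<bar>)"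
        by (intro Bochner_Integration.integrable_abs Bochner_Integration.integrable_diff Bochner_Integration.integrable_add
             synth_integrable integrable_mult_right e eh)
      show "integrable lborel (\<lambda>\<xi>. ?D\<^sup>2 * \<bar>?G (s, t) \<xi>\<bar>)"
        using edec_integrable[OF edom_edec[OF G, of "(s, t)"]] s t
        by (intro integrable_mult_right Bochner_Integration.integrable_abs) auto
      fix \<xi> :: "real^'n"
      let ?c = "cos (\<xi> \<bullet> y + \<theta>) - cos (\<xi> \<bullet> x + \<theta>)"
      let ?d = "?c - (\<xi> \<bullet> ?h) * cos (\<xi> \<bullet> x + \<theta> + pi/2)"
      have 1: "cos (\<xi> \<bullet> y + \<theta>) * a s \<xi> - cos (\<xi> \<bullet> x + \<theta>) * a t \<xi>
       - ((s - t) * (cos (\<xi> \<bullet> x + \<theta>) * a' t \<xi>) + cos (\<xi> \<bullet> x + (\<theta> + pi/2)) * ((\<xi> \<bullet> ?h) * a t \<xi>))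
        = cos (\<xi> \<bullet> y + \<theta>) * ((s - t)\<^sup>2 * taylorq a a' (s, t) \<xi>) + (s - t) * ?c * a' t \<xi> + ?d * a t \<xi>"
      proof -
        have e: "(s - t)\<^sup>2 * taylorq a a' (s, t) \<xi> = a s \<xi> - a t \<xi> - (s - t) * a' t \<xi>"
          by (cases "s = t") (simp_all add: taylorq_def)
        show ?thesis unfolding e by (simp add: algebra_simps)
      qed
      have D2: "(s - t)\<^sup>2 \<le> ?D\<^sup>2" using power_mono[OF D(1), of 2] by simp
      have b1: "\<bar>cos (\<xi> \<bullet> y + \<theta>) * ((s - t)\<^sup>2 * taylorq a a' (s, t) \<xi>)\<bar> \<le> 1 * (?D\<^sup>2 * \<bar>taylorq a a' (s, t) \<xi>\<bar>)"
        unfolding abs_mult using D2 by (intro mult_mono) auto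
      have ih: "\<bar>\<xi> \<bullet> ?h\<bar> \<le> l1 \<xi> * ?D"
        by (rule order_trans[OF inner_abs_le]) (use D l1_nonneg in \<open>auto intro: mult_left_mono\<close>)
      have c: "\<bar>?c\<bar> \<le> ?D * l1 \<xi>"
      proof -
        have "\<bar>?c\<bar> \<le> \<bar>\<xi> \<bullet> (y - x)\<bar>"
          using cos_lipschitz[of "\<xi> \<bullet> y + \<theta>" "\<xi> \<bullet> x + \<theta>"] by (simp add: inner_diff_right)
        with ih show ?thesis by (simp add: mult.commute)
      qed
      have d: "\<bar>?d\<bar> \<le> ?D\<^sup>2 * (l1 \<xi>)\<^sup>2"
      proof -
        have "\<bar>?d\<bar> \<le> (\<xi> \<bullet> ?h)\<^sup>2"
          using cos_quadratic[of "\<xi> \<bullet> x + \<theta>" "\<xi> \<bullet> ?h"] by (simp add: inner_diff_right add.commute[of \<theta>])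
        also have "\<dots> \<le> (l1 \<xi> * ?D)\<^sup>2" using power_mono[OF ih, of 2] by simp
        finally show ?thesis by (simp add: power_mult_distrib mult.commute)
      qed
      have b2: "\<bar>(s - t) * ?c * a' t \<xi>\<bar> \<le> (?D * (?D * l1 \<xi>)) * \<bar>a' t \<xi>\<bar>"
        unfolding abs_mult using D c by (intro mult_mono) auto
      have b3: "\<bar>?d * a t \<xi>\<bar> \<le> (?D\<^sup>2 * (l1 \<xi>)\<^sup>2) * \<bar>a t \<xi>\<bar>"
        unfolding abs_mult using d by (intro mult_mono) auto
      have "\<bar>cos (\<xi> \<bullet> y + \<theta>) * ((s - t)\<^sup>2 * taylorq a a' (s, t) \<xi>) + (s - t) * ?c * a' t \<xi> + ?d * a t \<xi>\<bar>
        \<le> ?D\<^sup>2 * ?G (s, t) \<xi>"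
        by (rule abs3_le[OF b1 b2 b3]) (simp add: distrib_left power2_eq_square mult_ac)
      also have "\<dots> \<le> ?D\<^sup>2 * \<bar>?G (s, t) \<xi>\<bar>" by (intro mult_left_mono) auto
      finally show "\<bar>cos (\<xi> \<bullet> y + \<theta>) * a s \<xi> - cos (\<xi> \<bullet> x + \<theta>) * a t \<xi>
       - ((s - t) * (cos (\<xi> \<bullet> x + \<theta>) * a' t \<xi>) + cos (\<xi> \<bullet> x + (\<theta> + pi/2)) * ((\<xi> \<bullet> ?h) * a t \<xi>))\<bar> \<le> ?D\<^sup>2 * \<bar>?G (s, t) \<xi>\<bar>"
        unfolding 1 .
    qed
    also have "\<dots> = ?D\<^sup>2 * (LBINT \<xi>. \<bar>?G (s, t) \<xi>\<bar>)" by simp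
    also have "\<dots> \<le> ?D\<^sup>2 * K" using bspec[OF K, of "(s, t)"] s t by (intro mult_left_mono) auto
    finally show "norm (synth \<theta> (a (fst q)) (snd q) - synth \<theta> (a (fst (t, x))) (snd (t, x)) - synth_deriv \<theta> a a' t x (q - (t, x))) \<le> K * (norm (q - (t, x)))\<^sup>2"
      by (simp add: q mult.commute)
  qed
qed

section \<open>Smoothness\<close>

lemma Ck_on_add: "Ck_on k f S \<Longrightarrow> Ck_on k g S \<Longrightarrow> Ck_on k (\<lambda>x. f x + g x) S"
proof (induction k arbitrary: f g)
  case (Suc k)
  obtain f' g' where "\<forall>x\<in>S. (f has_derivative f' x) (at x within S)" "\<forall>v. Ck_on k (\<lambda>x. f' x v) S"
    "\<forall>x\<in>S. (g has_derivative g' x) (at x within S)" "\<forall>v. Ck_on k (\<lambda>x. g' x v) S"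
    using Suc.prems unfolding Ck_on.simps by blast
  then show ?case
    using Suc.IH by (auto intro!: exI[of _ "\<lambda>x v. f' x v + g' x v"] has_derivative_add)
qed (simp add: continuous_on_add)

lemma Ck_on_linear: "bounded_linear h \<Longrightarrow> Ck_on k f S \<Longrightarrow> Ck_on k (\<lambda>x. h (f x)) S"
proof (induction k arbitrary: f)
  case 0
  then show ?case by (auto intro: bounded_linear.continuous_on)
next
  case (Suc k)
  then obtain f' where "\<And>x. x \<in> S \<Longrightarrow> (f has_derivative f' x) (at x within S)" "\<And>v. Ck_on k (\<lambda>x. f' x v) S"
    by auto
  then show ?case
    using Suc.IH Suc.prems(1) by (auto intro!: exI[of _ "\<lambda>x v. h (f' x v)"] bounded_linear.has_derivative[of h])
qed

lemma Ck_on_zero: "Ck_on k (\<lambda>x. 0) S"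
  by (induction k) (auto intro!: exI[of _ "\<lambda>_ _. 0"])

lemma Ck_on_sum: "finite A \<Longrightarrow> (\<And>i. i \<in> A \<Longrightarrow> Ck_on k (f i) S) \<Longrightarrow> Ck_on k (\<lambda>x. \<Sum>i\<in>A. f i x) S"
  by (induction A rule: finite_induct) (auto intro: Ck_on_zero Ck_on_add)

text \<open>
  Every directional derivative of a synthesis is a combination of syntheses: of the time derivative of the amplitude, and of
  the amplitude times a coordinate. The class of smooth amplitudes contains both, so the induction closes. One order is
  spent because even continuity is read off from the derivative.
\<close>

lemma Ck_on_synth:
  fixes a :: "real \<Rightarrow> real^'n \<Rightarrow> real"
  shows "smooth_amp (Suc k) a \<Longrightarrow> Ck_on k (\<lambda>p. synth \<theta> (a (fst p)) (snd p)) (I01 \<times> UNIV)"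
proof (induction k arbitrary: a \<theta>)
  case 0
  then obtain a' where a': "smooth_amp 0 a'" "edom (I01 \<times> I01) (taylorq a a')" and a: "tame a" by auto
  show ?case unfolding Ck_on.simps
  proof (rule has_derivative_continuous_on)
    fix p assume "p \<in> I01 \<times> (UNIV :: (real^'n) set)"
    then show "((\<lambda>p. synth \<theta> (a (fst p)) (snd p)) has_derivative synth_deriv \<theta> a a' (fst p) (snd p)) (at p within I01 \<times> UNIV)"
      using synth_has_derivative[OF a smooth_amp_edom[OF a'(1)] a'(2), of "fst p" \<theta> "snd p"] by auto
  qed
next
  case (Suc k)
  then obtain a' where a': "smooth_amp (Suc k) a'" "edom (I01 \<times> I01) (taylorq a a')" and a: "tame a"
    unfolding smooth_amp.simps(2)[of "Suc k"] by blast
  note ak = smooth_amp_Suc_D[OF Suc.prems]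
  show ?case unfolding Ck_on.simps
  proof (intro exI conjI ballI allI)
    fix p assume "p \<in> I01 \<times> (UNIV :: (real^'n) set)"
    then show "((\<lambda>p. synth \<theta> (a (fst p)) (snd p)) has_derivative synth_deriv \<theta> a a' (fst p) (snd p)) (at p within I01 \<times> UNIV)"
      using synth_has_derivative[OF a smooth_amp_edom[OF a'(1)] a'(2), of "fst p" \<theta> "snd p"] by auto
  next
    fix v :: "real \<times> (real^'n)"
    show "Ck_on k (\<lambda>p. synth_deriv \<theta> a a' (fst p) (snd p) v) (I01 \<times> UNIV)"
      unfolding synth_deriv_def
      by (intro Ck_on_add Ck_on_sum Ck_on_linear[OF bounded_linear_mult_right] Suc.IH[OF a'(1)]
           Suc.IH[OF smooth_amp_mult[OF tempered_coord ak]]) auto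
  qed
qed

lemma Ck_on_slice:
  "Ck_on k f (I01 \<times> UNIV) \<Longrightarrow> t \<in> I01 \<Longrightarrow> Ck_on k (\<lambda>x. f (t, x)) UNIV"
proof (induction k arbitrary: f)
  case 0
  then show ?case by (auto intro!: continuous_on_compose2[of "I01 \<times> UNIV" f] continuous_intros)
next
  case (Suc k)
  then obtain f' where f': "\<And>p. p \<in> I01 \<times> UNIV \<Longrightarrow> (f has_derivative f' p) (at p within I01 \<times> UNIV)" "\<And>v. Ck_on k (\<lambda>x. f' x v) (I01 \<times> UNIV)"
    by auto
  have "((\<lambda>x. f (t, x)) has_derivative (\<lambda>h. f' (t, x) (0, h))) (at x)" for x
    by (rule has_derivative_in_compose2[OF f'(1)])
       (use Suc.prems in \<open>auto intro!: derivative_eq_intros\<close>)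
  then show ?case using Suc.IH[OF f'(2)] Suc.prems(2) by (auto intro!: exI[of _ "\<lambda>x h. f' (t, x) (0, h)"])
qed

text \<open>
  A fixed amplitude is a smooth amplitude that is constant in time, so this is a slice of the space-time derivative.
\<close>

lemma synth_has_derivative_space:
  assumes "edec f"
  shows "(synth \<theta> f has_derivative (\<lambda>h. \<Sum>i\<in>UNIV. h $ i * synth (\<theta> + pi/2) (\<lambda>\<xi>. \<xi> $ i * f \<xi>) x)) (at x)"
proof -
  have D: "((\<lambda>p. synth \<theta> f (snd p)) has_derivative synth_deriv \<theta> (\<lambda>_. f) (\<lambda>_ _. 0) (fst p) (snd p)) (at p within I01 \<times> UNIV)"
    if "p \<in> I01 \<times> UNIV" for p
    using synth_has_derivative[of "\<lambda>_. f" "\<lambda>_ _. 0" "fst p" \<theta> "snd p"] that smooth_amp_tame[OF smooth_amp_const[OF assms]]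
    by (auto simp: taylorq_def case_prod_unfold edom_zero)
  have "((\<lambda>x. synth \<theta> f (snd (0::real, x))) has_derivative (\<lambda>h. synth_deriv \<theta> (\<lambda>_. f) (\<lambda>_ _. 0) (fst (0::real, x)) (snd (0::real, x)) (0, h))) (at x)"
    by (rule has_derivative_in_compose2[OF D])
       (auto intro!: derivative_eq_intros)
  then show ?thesis by (simp add: synth_deriv_def)
qed

lemma pdiff_synth:
  assumes "edec f"
  shows "pdiff i (synth \<theta> f) x = synth (\<theta> + pi/2) (\<lambda>\<xi>. \<xi> $ i * f \<xi>) x"
proof -
  have "frechet_derivative (synth \<theta> f) (at x) = (\<lambda>h. \<Sum>i\<in>UNIV. h $ i * synth (\<theta> + pi/2) (\<lambda>\<xi>. \<xi> $ i * f \<xi>) x)"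
    using frechet_derivative_at[OF synth_has_derivative_space[OF assms]] by simp
  then show ?thesis by (simp add: pdiff_def axis_def if_distrib[of "\<lambda>z. z * _"] cong: if_cong)
qed

lemma synth_has_vector_derivative:
  assumes "tame a" "edom I01 a'" "edom (I01 \<times> I01) (taylorq a a')" "t \<in> I01"
  shows "((\<lambda>s. synth \<theta> (a s) x) has_vector_derivative synth \<theta> (a' t) x) (at t within I01)"
proof -
  have D: "((\<lambda>p. synth \<theta> (a (fst p)) (snd p)) has_derivative synth_deriv \<theta> a a' (fst p) (snd p)) (at p within I01 \<times> UNIV)"
    if "p \<in> I01 \<times> UNIV" for p
    using synth_has_derivative[OF assms(1,2,3), of "fst p" \<theta> "snd p"] that by auto
  have "((\<lambda>s. synth \<theta> (a (fst (s, x))) (snd (s, x))) has_derivative (\<lambda>h. synth_deriv \<theta> a a' (fst (t, x)) (snd (t, x)) (h, 0))) (at t within I01)"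
    by (rule has_derivative_in_compose2[OF D])
       (use assms(4) in \<open>auto intro!: derivative_eq_intros\<close>)
  then show ?thesis by (simp add: synth_deriv_def has_vector_derivative_def)
qed

section \<open>Reflections and translations of Lebesgue measure\<close>

lemma lborel_reflect: "distr lborel borel uminus = (lborel :: 'a::euclidean_space measure)"
proof -
  have "(lborel :: 'a measure) = density (distr lborel borel (\<lambda>x. 0 + (-1) *\<^sub>R x)) (\<lambda>_. \<bar>-1::real\<bar> ^ DIM('a))"
    by (rule lborel_affine) simp
  then show ?thesis by (simp add: density_1)
qed

lemma integral_reflect:
  fixes f :: "'a::euclidean_space \<Rightarrow> real"
  assumes [measurable]: "f \<in> borel_measurable borel"
  shows "(LBINT x. f (- x)) = (LBINT x. f x)"
  by (subst (2) lborel_reflect[symmetric]) (simp add: integral_distr)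

lemma integral_translate:
  fixes f :: "'a::euclidean_space \<Rightarrow> real"
  assumes [measurable]: "f \<in> borel_measurable borel"
  shows "(LBINT x. f (x - c)) = (LBINT x. f x)"
  by (subst (2) lborel_distr_plus[of "-c", symmetric]) (simp add: integral_distr)

lemma integral_refl_translate:
  fixes f :: "'a::euclidean_space \<Rightarrow> real"
  assumes [measurable]: "f \<in> borel_measurable borel"
  shows "(LBINT x. f (c - x)) = (LBINT x. f x)"
  using integral_reflect[of "\<lambda>x. f (c + x)"] integral_translate[of f "-c"] by (simp add: add.commute)

lemma integral_odd:
  fixes f :: "'a::euclidean_space \<Rightarrow> real"
  assumes "f \<in> borel_measurable borel" "\<And>x. f (- x) = - f x"
  shows "(LBINT x. f x) = 0"
  using integral_reflect[OF assms(1)] by (simp add: assms(2))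

lemma integrable_pair_mult:
  fixes f g :: "'a::euclidean_space \<Rightarrow> real"
  assumes f: "integrable lborel f" and g: "integrable lborel g"
  shows "integrable (lborel \<Otimes>\<^sub>M lborel) (\<lambda>(x, y). f x * g y)"
proof -
  have [measurable]: "f \<in> borel_measurable borel" "g \<in> borel_measurable borel"
    using f g by (auto dest: borel_measurable_integrable)
  show ?thesis
  proof (rule lborel_pair.Fubini_integrable)
    show "(\<lambda>(x, y). f x * g y) \<in> borel_measurable (lborel \<Otimes>\<^sub>M lborel)" by measurable
    show "integrable lborel (\<lambda>x. LBINT y. norm (case (x, y) of (x, y) \<Rightarrow> f x * g y))"
      using f by (simp add: abs_mult)
    show "AE x in lborel. integrable lborel (\<lambda>y. case (x, y) of (x, y) \<Rightarrow> f x * g y)"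
      using g by simp
  qed
qed

section \<open>Products become convolutions\<close>

text \<open>
  Expand \<open>cos (\<eta> \<bullet> x + \<theta> + \<xi> \<bullet> x)\<close> by the addition theorem. As \<open>c\<close> is even, the sine part of its synthesis
  vanishes, so \<open>cos (\<eta> \<bullet> x + \<theta>) synth 0 c x\<close> is the synthesis of \<open>c\<close> translated by \<open>\<eta>\<close>. Integrating against \<open>a \<eta>\<close>
  and exchanging the integrals gives the convolution.
\<close>

lemma synth_mult:
  fixes a c :: "real^'n \<Rightarrow> real"
  assumes a: "edec a" and c: "edec c" and even: "\<And>\<xi>. c (- \<xi>) = c \<xi>"
  shows "synth \<theta> a x * synth 0 c x = synth \<theta> (conv a c) x"
proof -
  have [measurable]: "a \<in> borel_measurable borel" "c \<in> borel_measurable borel"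
    using a c edec_measurable by auto
  obtain C D \<delta> where *: "C > 0" "D > 0" "\<delta> > 0" "\<And>\<xi>. \<bar>a \<xi>\<bar> \<le> C * E \<delta> \<xi>" "\<And>\<xi>. \<bar>c \<xi>\<bar> \<le> D * E \<delta> \<xi>"
    using edom_common[OF edec_edom[OF a, of UNIV] edec_edom[OF c, of UNIV]] by (metis UNIV_I)
  have sin0: "(LBINT \<xi>. sin (\<xi> \<bullet> x) * c \<xi>) = 0"
    by (rule integral_odd) (auto simp: even)
  have sini: "integrable lborel (\<lambda>\<xi>. sin (\<xi> \<bullet> x) * c \<xi>)"
    using synth_integrable[OF c, of x "-pi/2"] by (simp add: cos_diff)
  have cosi: "integrable lborel (\<lambda>\<xi>. cos (\<xi> \<bullet> x) * c \<xi>)"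
    using synth_integrable[OF c, of x 0] by simp
  have inner: "cos (\<eta> \<bullet> x + \<theta>) * synth 0 c x = (LBINT \<zeta>. cos (\<zeta> \<bullet> x + \<theta>) * c (\<zeta> - \<eta>))" for \<eta>
  proof -
    have "(LBINT \<zeta>. cos (\<zeta> \<bullet> x + \<theta>) * c (\<zeta> - \<eta>)) = (LBINT \<zeta>. cos (((\<zeta> - \<eta>) + \<eta>) \<bullet> x + \<theta>) * c (\<zeta> - \<eta>))"
      by simp
    also have "\<dots> = (LBINT \<xi>. cos ((\<xi> + \<eta>) \<bullet> x + \<theta>) * c \<xi>)"
      by (rule integral_translate) measurable
    also have "\<dots> = (LBINT \<xi>. cos (\<eta> \<bullet> x + \<theta>) * (cos (\<xi> \<bullet> x) * c \<xi>) - sin (\<eta> \<bullet> x + \<theta>) * (sin (\<xi> \<bullet> x) * c \<xi>))"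
    proof (intro Bochner_Integration.integral_cong refl)
      fix \<xi>
      have "cos ((\<xi> + \<eta>) \<bullet> x + \<theta>) = cos (\<xi> \<bullet> x + (\<eta> \<bullet> x + \<theta>))"
        by (simp add: inner_add_left add_ac)
      also have "\<dots> = cos (\<xi> \<bullet> x) * cos (\<eta> \<bullet> x + \<theta>) - sin (\<xi> \<bullet> x) * sin (\<eta> \<bullet> x + \<theta>)"
        by (rule cos_add)
      finally have e: "cos ((\<xi> + \<eta>) \<bullet> x + \<theta>) = \<dots>" .
      show "cos ((\<xi> + \<eta>) \<bullet> x + \<theta>) * c \<xi> = cos (\<eta> \<bullet> x + \<theta>) * (cos (\<xi> \<bullet> x) * c \<xi>) - sin (\<eta> \<bullet> x + \<theta>) * (sin (\<xi> \<bullet> x) * c \<xi>)"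
        unfolding e left_diff_distrib by (simp only: mult_ac)
    qed
    also have "\<dots> = cos (\<eta> \<bullet> x + \<theta>) * synth 0 c x"
      using sini cosi sin0 by (simp add: synth_def)
    finally show ?thesis by simp
  qed
  have int: "integrable (lborel \<Otimes>\<^sub>M lborel) (\<lambda>(\<eta>, \<zeta>). cos (\<zeta> \<bullet> x + \<theta>) * (a \<eta> * c (\<zeta> - \<eta>)))"
  proof (rule Bochner_Integration.integrable_bound)
    show "integrable (lborel \<Otimes>\<^sub>M lborel) (\<lambda>(\<eta>::real^'n, \<zeta>::real^'n). (C * D * E (\<delta>/2) \<eta>) * E (\<delta>/2) \<zeta>)"
      using * by (intro integrable_pair_mult integrable_mult_right integrable_E) auto
    show "(\<lambda>(\<eta>, \<zeta>). cos (\<zeta> \<bullet> x + \<theta>) * (a \<eta> * c (\<zeta> - \<eta>))) \<in> borel_measurable (lborel \<Otimes>\<^sub>M lborel)"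
      by measurable
    have "\<bar>cos (\<zeta> \<bullet> x + \<theta>) * (a \<eta> * c (\<zeta> - \<eta>))\<bar> \<le> \<bar>C * D * E (\<delta>/2) \<eta> * E (\<delta>/2) \<zeta>\<bar>" for \<eta> \<zeta>
    proof -
      have "\<bar>cos (\<zeta> \<bullet> x + \<theta>) * (a \<eta> * c (\<zeta> - \<eta>))\<bar> \<le> 1 * (C * D * E (\<delta>/2) \<zeta> * E (\<delta>/2) \<eta>)"
        unfolding abs_mult[of "cos _"] by (intro mult_mono conv_integrand_bound *) auto
      then show ?thesis by (simp add: mult_ac order_trans[OF _ abs_ge_self])
    qed
    then show "AE z in lborel \<Otimes>\<^sub>M lborel. norm (case z of (\<eta>, \<zeta>) \<Rightarrow> cos (\<zeta> \<bullet> x + \<theta>) * (a \<eta> * c (\<zeta> - \<eta>)))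
        \<le> norm (case z of (\<eta>, \<zeta>) \<Rightarrow> (C * D * E (\<delta>/2) \<eta>) * E (\<delta>/2) \<zeta>)"
      by auto
  qed
  have "synth \<theta> a x * synth 0 c x = (LBINT \<eta>. a \<eta> * (cos (\<eta> \<bullet> x + \<theta>) * synth 0 c x))"
    unfolding synth_def[of \<theta>] integral_mult_left_zero[symmetric] by (simp only: mult_ac)
  also have "\<dots> = (LBINT \<eta>. LBINT \<zeta>. cos (\<zeta> \<bullet> x + \<theta>) * (a \<eta> * c (\<zeta> - \<eta>)))"
    unfolding inner by (simp add: mult.left_commute)
  also have "\<dots> = (LBINT \<zeta>. LBINT \<eta>. cos (\<zeta> \<bullet> x + \<theta>) * (a \<eta> * c (\<zeta> - \<eta>)))"
    using lborel_pair.Fubini_integral[OF int] by simp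
  also have "\<dots> = synth \<theta> (conv a c) x"
    by (simp add: synth_def conv_def)
  finally show ?thesis .
qed

lemma integral_conv:
  assumes "edec a" "edec c" "\<And>\<xi>. c (- \<xi>) = c \<xi>"
  shows "(LBINT \<xi>. conv a c \<xi>) = (LBINT \<xi>. a \<xi>) * (LBINT \<xi>. c \<xi>)"
  using synth_mult[OF assms, of 0 0] by (simp add: synth_def)

section \<open>Square integrability\<close>

lemma continuous_synth: "edec a \<Longrightarrow> continuous_on UNIV (synth \<theta> a)"
  by (auto simp: continuous_on_eq_continuous_at intro: has_derivative_continuous synth_has_derivative_space)

lemma measurable_synth: "edec a \<Longrightarrow> synth \<theta> a \<in> borel_measurable borel"
  by (rule borel_measurable_continuous_onI[OF continuous_synth])

text \<open>
  Fubini: pairing a synthesis with an integrable function moves the cosine transform onto that function.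
\<close>

lemma synth_pairing:
  fixes a h :: "real^'n \<Rightarrow> real"
  assumes a: "edec a" and h: "integrable lborel h"
  shows "(LBINT x. synth \<theta> a x * h x) = (LBINT \<xi>. a \<xi> * (LBINT x. cos (\<xi> \<bullet> x + \<theta>) * h x))"
    and "integrable lborel (\<lambda>x. synth \<theta> a x * h x)"
    and "integrable lborel (\<lambda>\<xi>. a \<xi> * (LBINT x. cos (\<xi> \<bullet> x + \<theta>) * h x))"
proof -
  have [measurable]: "a \<in> borel_measurable borel" "h \<in> borel_measurable borel"
    using a h edec_measurable by auto
  have int: "integrable (lborel \<Otimes>\<^sub>M lborel) (\<lambda>(\<xi>, x). cos (\<xi> \<bullet> x + \<theta>) * (a \<xi> * h x))"
  proof (rule Bochner_Integration.integrable_bound)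
    show "integrable (lborel \<Otimes>\<^sub>M lborel) (\<lambda>(\<xi>, x). a \<xi> * h x)"
      by (intro integrable_pair_mult edec_integrable a h)
    show "(\<lambda>(\<xi>, x). cos (\<xi> \<bullet> x + \<theta>) * (a \<xi> * h x)) \<in> borel_measurable (lborel \<Otimes>\<^sub>M lborel)"
      by measurable
    show "AE z in lborel \<Otimes>\<^sub>M lborel. norm (case z of (\<xi>, x) \<Rightarrow> cos (\<xi> \<bullet> x + \<theta>) * (a \<xi> * h x))
        \<le> norm (case z of (\<xi>, x) \<Rightarrow> a \<xi> * h x)"
      by (auto simp: abs_mult[of "cos _"] mult_left_le_one_le)
  qed
  have "(LBINT x. synth \<theta> a x * h x) = (LBINT x. LBINT \<xi>. cos (\<xi> \<bullet> x + \<theta>) * (a \<xi> * h x))"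
    by (simp add: synth_def mult.assoc[symmetric])
  also have "\<dots> = (LBINT \<xi>. LBINT x. cos (\<xi> \<bullet> x + \<theta>) * (a \<xi> * h x))"
    using lborel_pair.Fubini_integral[OF int] by simp
  also have "\<dots> = (LBINT \<xi>. a \<xi> * (LBINT x. cos (\<xi> \<bullet> x + \<theta>) * h x))"
    by (simp add: mult.left_commute)
  finally show "(LBINT x. synth \<theta> a x * h x) = (LBINT \<xi>. a \<xi> * (LBINT x. cos (\<xi> \<bullet> x + \<theta>) * h x))" .
  show "integrable lborel (\<lambda>\<xi>. a \<xi> * (LBINT x. cos (\<xi> \<bullet> x + \<theta>) * h x))"
    using lborel_pair.integrable_fst[OF int] by (simp add: mult.left_commute)
  show "integrable lborel (\<lambda>x. synth \<theta> a x * h x)"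
    using lborel_pair.integrable_snd[OF int] by (simp add: synth_def mult.assoc[symmetric])
qed

lemma edec_gaussian:
  assumes r: "\<And>i. r i > 0" shows "edec (gaussian r)"
proof -
  have "\<bar>gaussian r \<xi>\<bar> \<le> exp (\<Sum>i\<in>UNIV. 1 / (2 * (r i)\<^sup>2)) * E 1 \<xi>" for \<xi>
  proof -
    have "- ((r i * \<xi> $ i)\<^sup>2 / 2) \<le> 1 / (2 * (r i)\<^sup>2) - \<bar>\<xi> $ i\<bar>" for i
    proof -
      have "0 \<le> (r i * \<bar>\<xi> $ i\<bar> - 1 / r i)\<^sup>2" by simp
      also have "\<dots> = (r i * \<xi> $ i)\<^sup>2 - 2 * \<bar>\<xi> $ i\<bar> + 1 / (r i)\<^sup>2"
        using r[of i] by (simp add: power2_eq_square field_simps)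
      finally show ?thesis by (simp add: field_simps)
    qed
    then have "(\<Sum>i\<in>UNIV. - ((r i * \<xi> $ i)\<^sup>2 / 2)) \<le> (\<Sum>i\<in>UNIV. 1 / (2 * (r i)\<^sup>2) - \<bar>\<xi> $ i\<bar>)"
      by (intro sum_mono)
    then show ?thesis
      by (simp add: gaussian_def E_def l1_def exp_add[symmetric] sum_negf sum_subtractf sum_divide_distrib)
  qed
  then show ?thesis unfolding edec_def by (intro conjI exI[of _ "exp (\<Sum>i\<in>UNIV. 1 / (2 * (r i)\<^sup>2))"] exI[of _ 1]) auto
qed

lemma edec_square: assumes "edec a" shows "edec (\<lambda>\<xi>. (a \<xi>)\<^sup>2)"
proof -
  obtain C \<delta> where *: "C > 0" "\<delta> > 0" "\<And>\<xi>. \<bar>a \<xi>\<bar> \<le> C * E \<delta> \<xi>" using edecE[OF assms] by metis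
  have [measurable]: "a \<in> borel_measurable borel" using edec_measurable[OF assms] .
  have "\<bar>a \<xi>\<bar> \<le> C" for \<xi>
  proof -
    have "C * E \<delta> \<xi> \<le> C * 1" using *(1,2) by (intro mult_left_mono E_le_1) auto
    with *(3)[of \<xi>] show ?thesis by simp
  qed
  then have "tempered a" by (intro tempered_bounded) auto
  then show ?thesis unfolding power2_eq_square by (rule edec_mult[OF _ assms])
qed

text \<open>
  With the Gaussian weight all integrals may be exchanged. Adding the synthesis with phase \<open>\<theta> + \<pi>/2\<close> only increases the
  left-hand side and turns the product of cosines into \<open>cos ((\<xi> - \<eta>) \<bullet> x)\<close>. The sum is then
  \<open>\<integral>\<integral> a(\<xi>) a(\<eta>) H(\<xi> - \<eta>)\<close> with \<open>H \<ge> 0\<close> the transform of the weight, and \<open>a(\<xi>) a(\<eta>) \<le> (a(\<xi>)\<^sup>2 + a(\<eta>)\<^sup>2)/2\<close>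
  bounds it by \<open>\<integral> H\<close> times \<open>\<integral> a\<^sup>2\<close>. The integral of \<open>H\<close> is \<open>(2\<pi>)\<^sup>d\<close> whatever the width of the weight.
\<close>

lemma synth_gaussian_L2:
  fixes a :: "real^'n \<Rightarrow> real"
  assumes a: "edec a" and d: "\<delta> > 0"
  shows "(LBINT x. (synth \<theta> a x)\<^sup>2 * gaussian (\<lambda>_. \<delta>) x) \<le> (2 * pi) ^ CARD('n) * (LBINT \<xi>. (a \<xi>)\<^sup>2)"
    and "integrable lborel (\<lambda>x. (synth \<theta> a x)\<^sup>2 * gaussian (\<lambda>_. \<delta>) x)"
proof -
  let ?g = "gaussian (\<lambda>_::'n. \<delta>)"
  have [measurable]: "a \<in> borel_measurable borel" using edec_measurable[OF a] .
  have gi: "integrable lborel ?g" by (rule integrable_gaussian) (rule d)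
  have cgi: "integrable lborel (\<lambda>x. cos (\<xi> \<bullet> x + \<phi>) * ?g x)" for \<xi> \<phi>
    by (rule Bochner_Integration.integrable_bound[OF gi]) (auto simp: abs_mult mult_left_le_one_le)
  note ms[measurable] = measurable_synth[OF a]
  have sgi: "integrable lborel (\<lambda>x. synth \<phi> a x * ?g x)" for \<phi>
    by (rule synth_pairing(2)[OF a gi])
  have split: "(synth \<phi> a x)\<^sup>2 * ?g x = synth \<phi> a x * (synth \<phi> a x * ?g x)" for \<phi> x
    by (simp add: power2_eq_square)
  show i2: "integrable lborel (\<lambda>x. (synth \<phi> a x)\<^sup>2 * ?g x)" for \<phi>
    unfolding split by (rule synth_pairing(2)[OF a sgi])
  define K where "K = (\<Prod>i\<in>(UNIV::'n set). sqrt (2 * pi) / \<delta>)"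
  define H where "H \<zeta> = K * gaussian (\<lambda>_::'n. 1 / \<delta>) \<zeta>" for \<zeta>
  have K0: "K \<ge> 0" unfolding K_def using d by (intro prod_nonneg) auto
  have eH: "edec H" unfolding H_def[abs_def]
    by (rule edec_mult[OF tempered_const]) (rule edec_gaussian, use d in auto)
  have Heven: "H (- \<zeta>) = H \<zeta>" for \<zeta> by (simp add: H_def gaussian_def)
  have H0: "H \<zeta> \<ge> 0" for \<zeta> unfolding H_def using K0 gaussian_pos[of _ \<zeta>] by (auto simp: less_imp_le)
  have Hint: "(LBINT \<zeta>. H \<zeta>) = (2 * pi) ^ CARD('n)"
  proof -
    have "(LBINT \<zeta>. H \<zeta>) = K * (\<Prod>i\<in>(UNIV::'n set). sqrt (2 * pi) / (1 / \<delta>))"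
      unfolding H_def by (simp add: integral_gaussian d)
    also have "\<dots> = (\<Prod>i\<in>(UNIV::'n set). (sqrt (2 * pi) / \<delta>) * (sqrt (2 * pi) / (1 / \<delta>)))"
      unfolding K_def prod.distrib ..
    also have "\<dots> = (2 * pi) ^ CARD('n)" using d by simp
    finally show ?thesis .
  qed
  \<comment> \<open>A function with nonzero Bochner integral is integrable.\<close>
  have Hi: "integrable lborel (\<lambda>\<eta>. H (\<xi> - \<eta>))" for \<xi>
  proof -
    have "(LBINT \<eta>. H (\<xi> - \<eta>)) \<noteq> 0"
      using Hint integral_refl_translate[of H \<xi>] edec_measurable[OF eH] by simp
    then show ?thesis using not_integrable_integral_eq by blast
  qed
  have pair: "(LBINT x. cos (\<xi> \<bullet> x + \<theta>) * (synth \<theta> a x * ?g x)) + (LBINT x. cos (\<xi> \<bullet> x + (\<theta> + pi/2)) * (synth (\<theta> + pi/2) a x * ?g x))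
     = conv a H \<xi>" for \<xi>
  proof -
    have 1: "(LBINT x. cos (\<xi> \<bullet> x + \<phi>) * (synth \<phi> a x * ?g x)) = (LBINT \<eta>. a \<eta> * (LBINT x. cos (\<eta> \<bullet> x + \<phi>) * (cos (\<xi> \<bullet> x + \<phi>) * ?g x)))" for \<phi>
      using synth_pairing(1)[OF a cgi[of \<xi> \<phi>], of \<phi>] by (simp add: mult_ac)
    have i: "integrable lborel (\<lambda>x. cos (\<eta> \<bullet> x + \<phi>) * (cos (\<xi> \<bullet> x + \<phi>) * ?g x))" for \<eta> \<phi>
      by (rule Bochner_Integration.integrable_bound[OF gi]) (auto simp: abs_mult mult.assoc[symmetric] intro!: mult_left_le_one_le mult_le_one)
    have 2: "(LBINT x. cos (\<eta> \<bullet> x + \<theta>) * (cos (\<xi> \<bullet> x + \<theta>) * ?g x)) + (LBINT x. cos (\<eta> \<bullet> x + (\<theta> + pi/2)) * (cos (\<xi> \<bullet> x + (\<theta> + pi/2)) * ?g x)) = H (\<xi> - \<eta>)" for \<eta>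
    proof -
      have "cos (\<eta> \<bullet> x + \<theta>) * (cos (\<xi> \<bullet> x + \<theta>) * ?g x) + cos (\<eta> \<bullet> x + (\<theta> + pi/2)) * (cos (\<xi> \<bullet> x + (\<theta> + pi/2)) * ?g x) = cos ((\<xi> - \<eta>) \<bullet> x) * ?g x" for x
      proof -
        have "cos ((\<xi> - \<eta>) \<bullet> x) = cos ((\<xi> \<bullet> x + \<theta>) - (\<eta> \<bullet> x + \<theta>))" by (simp add: inner_diff_left)
        also have "\<dots> = cos (\<xi> \<bullet> x + \<theta>) * cos (\<eta> \<bullet> x + \<theta>) + sin (\<xi> \<bullet> x + \<theta>) * sin (\<eta> \<bullet> x + \<theta>)" by (rule cos_diff)
        finally show ?thesis
          using cos_add[of "\<xi> \<bullet> x + \<theta>" "pi/2"] cos_add[of "\<eta> \<bullet> x + \<theta>" "pi/2"] by (simp add: algebra_simps)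
      qed
      then have "(LBINT x. cos ((\<xi> - \<eta>) \<bullet> x) * ?g x) = (LBINT x. cos (\<eta> \<bullet> x + \<theta>) * (cos (\<xi> \<bullet> x + \<theta>) * ?g x) + cos (\<eta> \<bullet> x + (\<theta> + pi/2)) * (cos (\<xi> \<bullet> x + (\<theta> + pi/2)) * ?g x))"
        by simp
      also have "\<dots> = (LBINT x. cos (\<eta> \<bullet> x + \<theta>) * (cos (\<xi> \<bullet> x + \<theta>) * ?g x)) + (LBINT x. cos (\<eta> \<bullet> x + (\<theta> + pi/2)) * (cos (\<xi> \<bullet> x + (\<theta> + pi/2)) * ?g x))"
        by (rule Bochner_Integration.integral_add[OF i i])
      finally show ?thesis
        using gaussian_fourier[of "\<lambda>_. \<delta>" "\<xi> - \<eta>"] d by (simp add: H_def K_def)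
    qed
    show ?thesis
      unfolding 1 conv_def 2[symmetric] distrib_left
      by (intro Bochner_Integration.integral_add[symmetric] synth_pairing(3)[OF a cgi])
  qed
  have "(LBINT x. (synth \<theta> a x)\<^sup>2 * ?g x) \<le> (LBINT x. (synth \<theta> a x)\<^sup>2 * ?g x) + (LBINT x. (synth (\<theta> + pi/2) a x)\<^sup>2 * ?g x)"
    using gaussian_pos[of "\<lambda>_::'n. \<delta>"] by (simp add: less_imp_le)
  also have "\<dots> = (LBINT \<xi>. a \<xi> * conv a H \<xi>)"
    unfolding split synth_pairing(1)[OF a sgi] pair[symmetric] distrib_left
    by (intro Bochner_Integration.integral_add[symmetric] synth_pairing(3)[OF a sgi])
  also have "\<dots> \<le> (LBINT \<xi>. 1/2 * ((2 * pi) ^ CARD('n) * (a \<xi>)\<^sup>2 + conv (\<lambda>\<xi>. (a \<xi>)\<^sup>2) H \<xi>))"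
  proof (rule Bochner_Integration.integral_mono)
    show "integrable lborel (\<lambda>\<xi>. a \<xi> * conv a H \<xi>)"
      unfolding pair[symmetric] distrib_left
      by (intro Bochner_Integration.integrable_add synth_pairing(3)[OF a sgi])
    show "integrable lborel (\<lambda>\<xi>. 1/2 * ((2 * pi) ^ CARD('n) * (a \<xi>)\<^sup>2 + conv (\<lambda>\<xi>. (a \<xi>)\<^sup>2) H \<xi>))"
      by (intro integrable_mult_right Bochner_Integration.integrable_add edec_integrable edec_conv edec_square a eH)
    fix \<xi>
    have "a \<xi> * conv a H \<xi> = (LBINT \<eta>. a \<xi> * (a \<eta> * H (\<xi> - \<eta>)))"
      unfolding conv_def by simp
    also have "\<dots> \<le> (LBINT \<eta>. 1/2 * ((a \<xi>)\<^sup>2 * H (\<xi> - \<eta>) + (a \<eta>)\<^sup>2 * H (\<xi> - \<eta>)))"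
    proof (rule Bochner_Integration.integral_mono)
      show "integrable lborel (\<lambda>\<eta>. a \<xi> * (a \<eta> * H (\<xi> - \<eta>)))"
        by (intro integrable_mult_right conv_integrable a eH)
      show "integrable lborel (\<lambda>\<eta>. 1/2 * ((a \<xi>)\<^sup>2 * H (\<xi> - \<eta>) + (a \<eta>)\<^sup>2 * H (\<xi> - \<eta>)))"
        by (intro integrable_mult_right Bochner_Integration.integrable_add conv_integrable edec_square a eH Hi)
      fix \<eta>
      have "a \<xi> * a \<eta> \<le> 1/2 * ((a \<xi>)\<^sup>2 + (a \<eta>)\<^sup>2)"
        using sum_squares_bound[of "a \<xi>" "a \<eta>"] by simp
      from mult_right_mono[OF this H0[of "\<xi> - \<eta>"]]
      show "a \<xi> * (a \<eta> * H (\<xi> - \<eta>)) \<le> 1/2 * ((a \<xi>)\<^sup>2 * H (\<xi> - \<eta>) + (a \<eta>)\<^sup>2 * H (\<xi> - \<eta>))"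
        by (simp add: algebra_simps)
    qed
    also have "\<dots> = 1/2 * ((2 * pi) ^ CARD('n) * (a \<xi>)\<^sup>2 + conv (\<lambda>\<xi>. (a \<xi>)\<^sup>2) H \<xi>)"
    proof -
      have "(LBINT \<eta>. H (\<xi> - \<eta>)) = (2 * pi) ^ CARD('n)"
        unfolding Hint[symmetric] by (rule integral_refl_translate) (rule edec_measurable[OF eH])
      then show ?thesis
        using conv_integrable[OF edec_square[OF a] eH, of \<xi>] Hi[of \<xi>]
        by (simp add: conv_def mult.commute)
    qed
    finally show "a \<xi> * conv a H \<xi> \<le> 1/2 * ((2 * pi) ^ CARD('n) * (a \<xi>)\<^sup>2 + conv (\<lambda>\<xi>. (a \<xi>)\<^sup>2) H \<xi>)" .
  qed
  also have "\<dots> = (2 * pi) ^ CARD('n) * (LBINT \<xi>. (a \<xi>)\<^sup>2)"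
  proof -
    have "(LBINT \<xi>. 1/2 * ((2 * pi) ^ CARD('n) * (a \<xi>)\<^sup>2 + conv (\<lambda>\<xi>. (a \<xi>)\<^sup>2) H \<xi>))
      = 1/2 * ((2 * pi) ^ CARD('n) * (LBINT \<xi>. (a \<xi>)\<^sup>2) + (LBINT \<xi>. conv (\<lambda>\<xi>. (a \<xi>)\<^sup>2) H \<xi>))"
      using edec_integrable[OF edec_square[OF a]] edec_integrable[OF edec_conv[OF edec_square[OF a] eH]]
      by simp
    also have "(LBINT \<xi>. conv (\<lambda>\<xi>. (a \<xi>)\<^sup>2) H \<xi>) = (LBINT \<xi>. (a \<xi>)\<^sup>2) * (2 * pi) ^ CARD('n)"
      unfolding Hint[symmetric] by (rule integral_conv[OF edec_square[OF a] eH Heven])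
    finally show ?thesis by (simp add: mult_ac)
  qed
  finally show "(LBINT x. (synth \<theta> a x)\<^sup>2 * ?g x) \<le> (2 * pi) ^ CARD('n) * (LBINT \<xi>. (a \<xi>)\<^sup>2)" .
qed

text \<open>
  Let the Gaussian weight increase to \<open>1\<close> in \<open>synth_gaussian_L2\<close>. This is the inequality half of Plancherel's theorem.
\<close>

lemma synth_L2:
  fixes a :: "real^'n \<Rightarrow> real"
  assumes a: "edec a"
  shows "integrable lborel (\<lambda>x. (synth \<theta> a x)\<^sup>2)"
    and "(LBINT x. (synth \<theta> a x)\<^sup>2) \<le> (2 * pi) ^ CARD('n) * (LBINT \<xi>. (a \<xi>)\<^sup>2)"
proof -
  let ?B = "(2 * pi) ^ CARD('n) * (LBINT \<xi>. (a \<xi>)\<^sup>2)"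
  let ?g = "\<lambda>m::nat. gaussian (\<lambda>_::'n. 1 / (real m + 1))"
  note ms[measurable] = measurable_synth[OF a]
  have B0: "?B \<ge> 0" by simp
  have lim: "(\<lambda>m. (synth \<theta> a x)\<^sup>2 * ?g m x) \<longlonglongrightarrow> (synth \<theta> a x)\<^sup>2" for x
  proof -
    have "(\<lambda>m. 1 / (real m + 1)) \<longlonglongrightarrow> 0" using LIMSEQ_inverse_real_of_nat by (simp add: inverse_eq_divide add.commute)
    then have "(\<lambda>m. (synth \<theta> a x)\<^sup>2 * ?g m x) \<longlonglongrightarrow> (synth \<theta> a x)\<^sup>2 * exp (- (\<Sum>i\<in>UNIV. (0 * x $ i)\<^sup>2) / 2)"
      unfolding gaussian_def by (intro tendsto_intros) auto
    then show ?thesis by simp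
  qed
  have inc: "incseq (\<lambda>m. ennreal ((synth \<theta> a x)\<^sup>2 * ?g m x))" for x
  proof (intro incseq_SucI ennreal_leI mult_left_mono)
    fix m
    have "(\<Sum>i\<in>UNIV. (1 / (real (Suc m) + 1) * x $ i)\<^sup>2) \<le> (\<Sum>i\<in>UNIV. (1 / (real m + 1) * x $ i)\<^sup>2)"
    proof (intro sum_mono)
      fix i
      have "(1 / (real (Suc m) + 1))\<^sup>2 \<le> (1 / (real m + 1))\<^sup>2" by (intro power_mono divide_left_mono) auto
      then show "(1 / (real (Suc m) + 1) * x $ i)\<^sup>2 \<le> (1 / (real m + 1) * x $ i)\<^sup>2"
        unfolding power_mult_distrib by (intro mult_right_mono) auto
    qed
    then show "?g m x \<le> ?g (Suc m) x" by (simp add: gaussian_def)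
  qed auto
  have "(\<integral>\<^sup>+x. ennreal ((synth \<theta> a x)\<^sup>2) \<partial>lborel) = (\<integral>\<^sup>+x. (SUP m. ennreal ((synth \<theta> a x)\<^sup>2 * ?g m x)) \<partial>lborel)"
  proof (intro nn_integral_cong)
    fix x
    show "ennreal ((synth \<theta> a x)\<^sup>2) = (SUP m. ennreal ((synth \<theta> a x)\<^sup>2 * ?g m x))"
      by (rule LIMSEQ_unique[OF _ LIMSEQ_SUP[OF inc]]) (intro tendsto_ennrealI lim)
  qed
  also have "\<dots> = (SUP m. \<integral>\<^sup>+x. ennreal ((synth \<theta> a x)\<^sup>2 * ?g m x) \<partial>lborel)"
    by (rule nn_integral_monotone_convergence_SUP) (use inc in \<open>auto simp: incseq_def le_fun_def\<close>)
  also have "\<dots> \<le> ennreal ?B"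
  proof (rule SUP_least)
    fix m :: nat
    have "(\<integral>\<^sup>+x. ennreal ((synth \<theta> a x)\<^sup>2 * ?g m x) \<partial>lborel) = ennreal (LBINT x. (synth \<theta> a x)\<^sup>2 * ?g m x)"
      by (intro nn_integral_eq_integral synth_gaussian_L2 a) (auto simp: gaussian_pos less_imp_le)
    also have "\<dots> \<le> ennreal ?B" by (intro ennreal_leI synth_gaussian_L2 a) auto
    finally show "(\<integral>\<^sup>+x. ennreal ((synth \<theta> a x)\<^sup>2 * ?g m x) \<partial>lborel) \<le> ennreal ?B" .
  qed
  finally have *: "(\<integral>\<^sup>+x. ennreal ((synth \<theta> a x)\<^sup>2) \<partial>lborel) \<le> ennreal ?B" .
  show i: "integrable lborel (\<lambda>x. (synth \<theta> a x)\<^sup>2)"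
    by (rule integrableI_bounded) (use * in \<open>auto simp: order_le_less_trans\<close>)
  have "ennreal (LBINT x. (synth \<theta> a x)\<^sup>2) \<le> ennreal ?B"
    using * nn_integral_eq_integral[OF i] by simp
  then show "(LBINT x. (synth \<theta> a x)\<^sup>2) \<le> ?B" using B0 by (simp add: ennreal_le_iff)
qed

section \<open>The projected nonlinearity\<close>

definition leray :: "'n::finite \<Rightarrow> 'n \<Rightarrow> real^'n \<Rightarrow> real" where
  "leray i k \<xi> = (if i = k then 1 else 0) - \<xi> $ i * \<xi> $ k / (\<xi> \<bullet> \<xi>)"

text \<open>
  For \<open>c = b\<close> this is the sine amplitude of the Leray projection of \<open>div (v \<otimes> v)\<close>, where \<open>v\<close> is the sine synthesis of the odd
  amplitude \<open>b\<close>.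
  At \<open>\<xi> = 0\<close> the quotient in \<^const>\<open>leray\<close> is \<open>0\<close>, which is harmless as the symbol carries the factor \<open>\<xi> $ j\<close>.
\<close>

definition leray_conv :: "(real^'n \<Rightarrow> real^'n) \<Rightarrow> (real^'n \<Rightarrow> real^'n) \<Rightarrow> real^'n \<Rightarrow> real^'n" where
  "leray_conv b c \<xi> = (\<chi> i. \<Sum>j\<in>UNIV. \<Sum>k\<in>UNIV. (leray i k \<xi> * \<xi> $ j) * conv (\<lambda>\<eta>. b \<eta> $ j) (\<lambda>\<eta>. c \<eta> $ k) \<xi>)"

lemma measurable_nth_vec[measurable (raw)]:
  fixes f :: "'a \<Rightarrow> real^'n"
  assumes "f \<in> borel_measurable M" shows "(\<lambda>x. f x $ i) \<in> borel_measurable M"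
  by (rule measurable_compose[OF assms borel_measurable_continuous_onI]) (intro continuous_intros)

lemma abs_leray_le: "\<bar>leray i k \<xi>\<bar> \<le> 2"
proof -
  have "\<bar>\<xi> $ i * \<xi> $ k\<bar> \<le> norm \<xi> * norm \<xi>"
    unfolding abs_mult by (intro mult_mono component_le_norm_cart) auto
  then have "\<bar>\<xi> $ i * \<xi> $ k / (\<xi> \<bullet> \<xi>)\<bar> \<le> 1"
    by (simp add: divide_le_eq dot_square_norm power2_eq_square)
  then have "\<bar>leray i k \<xi>\<bar> \<le> 1 + 1"
    unfolding leray_def by (intro order_trans[OF abs_triangle_ineq4 add_mono]) auto
  then show ?thesis by simp
qed

lemma abs_symbol_le: "\<bar>leray i k \<xi> * \<xi> $ j\<bar> \<le> 2 * norm \<xi>"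
  unfolding abs_mult by (intro mult_mono abs_leray_le component_le_norm_cart) auto

lemma measurable_leray[measurable]: "leray i k \<in> borel_measurable borel"
  unfolding leray_def by measurable

text \<open>
  The projection jumps at the origin, but the factor \<open>\<xi> $ j\<close> forces the limit \<open>0\<close> there.
\<close>

lemma continuous_symbol: "continuous_on UNIV (\<lambda>\<xi>::real^'n. leray i k \<xi> * \<xi> $ j)"
  unfolding continuous_on_eq_continuous_at[OF open_UNIV]
proof
  fix \<xi> :: "real^'n"
  show "isCont (\<lambda>\<xi>. leray i k \<xi> * \<xi> $ j) \<xi>"
  proof (cases "\<xi> = 0")
    case True
    have "((\<lambda>\<xi>::real^'n. 2 * norm \<xi>) \<longlongrightarrow> 2 * norm (0::real^'n)) (at 0)"
      by (intro tendsto_intros)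
    then have "((\<lambda>\<xi>::real^'n. 2 * norm \<xi>) \<longlongrightarrow> 0) (at 0)" by simp
    then have "((\<lambda>\<xi>::real^'n. leray i k \<xi> * \<xi> $ j) \<longlongrightarrow> 0) (at 0)"
      by (rule Lim_null_comparison[rotated]) (simp only: real_norm_def abs_symbol_le eventually_True)
    then show ?thesis using True by (simp add: isCont_def)
  next
    case False
    then show ?thesis unfolding leray_def by (intro continuous_intros) auto
  qed
qed

lemma edec_bound:
  fixes W :: "real^'n \<Rightarrow> real" and f :: "real^'n \<Rightarrow> real^'n"
  assumes W: "edec W" and f: "f \<in> borel_measurable borel" "\<And>\<eta>. norm (f \<eta>) \<le> B * W \<eta>"
  shows "edec (\<lambda>\<eta>. f \<eta> $ j)"
proof -
  obtain C \<delta> where C: "C > 0" "\<delta> > 0" "\<And>\<xi>. \<bar>W \<xi>\<bar> \<le> C * E \<delta> \<xi>" using edecE[OF W] by metis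
  have "\<bar>f \<eta> $ j\<bar> \<le> (\<bar>B\<bar> * C) * E \<delta> \<eta>" for \<eta>
  proof -
    have "\<bar>f \<eta> $ j\<bar> \<le> norm (f \<eta>)" by (rule component_le_norm_cart)
    also have "\<dots> \<le> \<bar>B\<bar> * \<bar>W \<eta>\<bar>" using f(2)[of \<eta>] abs_ge_self[of "B * W \<eta>"] by (simp add: abs_mult)
    also have "\<dots> \<le> \<bar>B\<bar> * (C * E \<delta> \<eta>)" by (intro mult_left_mono C) auto
    finally show ?thesis by simp
  qed
  moreover have "(\<lambda>\<eta>. f \<eta> $ j) \<in> borel_measurable borel" using f(1) by measurable
  ultimately show ?thesis using C(2) unfolding edec_def by blast
qed

text \<open>
  The condition on \<open>conv W W\<close> makes weighted supremum bounds reproduce themselves under the quadratic nonlinearity, up to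
  the one derivative \<open>norm \<xi>\<close>. The factor \<open>CARD('n) ^ 3\<close> crudely counts components.
\<close>

lemma leray_conv_bound:
  fixes W :: "real^'n \<Rightarrow> real"
  assumes W: "edec W" "\<And>\<xi>. W \<xi> \<ge> 0" "\<And>\<xi>. conv W W \<xi> \<le> \<kappa> * W \<xi>"
    and f: "f \<in> borel_measurable borel" "\<And>\<eta>. norm (f \<eta>) \<le> B * W \<eta>"
    and g: "g \<in> borel_measurable borel" "\<And>\<eta>. norm (g \<eta>) \<le> C * W \<eta>"
    and BC: "B \<ge> 0" "C \<ge> 0"
  shows "norm (leray_conv f g \<xi>) \<le> 2 * real CARD('n) ^ 3 * \<kappa> * norm \<xi> * (B * C) * W \<xi>"
proof -
  have c: "\<bar>conv (\<lambda>\<eta>. f \<eta> $ j) (\<lambda>\<eta>. g \<eta> $ k) \<xi>\<bar> \<le> (B * C) * (\<kappa> * W \<xi>)" for j k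
  proof -
    have "\<bar>conv (\<lambda>\<eta>. f \<eta> $ j) (\<lambda>\<eta>. g \<eta> $ k) \<xi>\<bar> \<le> (LBINT \<eta>. \<bar>f \<eta> $ j * g (\<xi> - \<eta>) $ k\<bar>)"
      unfolding conv_def by (rule integral_abs_bound)
    also have "\<dots> \<le> (LBINT \<eta>. (B * C) * (W \<eta> * W (\<xi> - \<eta>)))"
    proof (rule Bochner_Integration.integral_mono)
      show "integrable lborel (\<lambda>\<eta>. \<bar>f \<eta> $ j * g (\<xi> - \<eta>) $ k\<bar>)"
        using conv_integrable[OF edec_bound[OF W(1) f, of j] edec_bound[OF W(1) g, of k]]
        by (rule Bochner_Integration.integrable_abs)
      show "integrable lborel (\<lambda>\<eta>. (B * C) * (W \<eta> * W (\<xi> - \<eta>)))"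
        by (intro integrable_mult_right conv_integrable W)
      fix \<eta>
      have "\<bar>f \<eta> $ j * g (\<xi> - \<eta>) $ k\<bar> \<le> (B * W \<eta>) * (C * W (\<xi> - \<eta>))"
        unfolding abs_mult using BC W(2)
        by (intro mult_mono order_trans[OF component_le_norm_cart f(2)] order_trans[OF component_le_norm_cart g(2)]) auto
      then show "\<bar>f \<eta> $ j * g (\<xi> - \<eta>) $ k\<bar> \<le> (B * C) * (W \<eta> * W (\<xi> - \<eta>))" by (simp add: mult_ac)
    qed
    also have "\<dots> = (B * C) * conv W W \<xi>" by (simp add: conv_def)
    also have "\<dots> \<le> (B * C) * (\<kappa> * W \<xi>)" using BC W(3) by (intro mult_left_mono) auto
    finally show ?thesis .
  qed
  define D where "D = 2 * norm \<xi> * ((B * C) * (\<kappa> * W \<xi>))"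
  have "norm (leray_conv f g \<xi>) \<le> (\<Sum>i\<in>UNIV. \<bar>leray_conv f g \<xi> $ i\<bar>)" by (rule norm_le_l1_cart)
  also have "\<dots> \<le> (\<Sum>i\<in>(UNIV::'n set). \<Sum>j\<in>(UNIV::'n set). \<Sum>k\<in>(UNIV::'n set). D)"
  proof (intro sum_mono)
    fix i
    have "\<bar>leray_conv f g \<xi> $ i\<bar> \<le> (\<Sum>j\<in>UNIV. \<Sum>k\<in>UNIV. \<bar>(leray i k \<xi> * \<xi> $ j) * conv (\<lambda>\<eta>. f \<eta> $ j) (\<lambda>\<eta>. g \<eta> $ k) \<xi>\<bar>)"
      unfolding leray_conv_def vec_lambda_beta by (intro order_trans[OF sum_abs] sum_mono order_refl)
    also have "\<dots> \<le> (\<Sum>j\<in>(UNIV::'n set). \<Sum>k\<in>(UNIV::'n set). D)"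
      unfolding D_def abs_mult[of "_ * _" "conv _ _ _"]
      by (intro sum_mono mult_mono abs_symbol_le c) auto
    finally show "\<bar>leray_conv f g \<xi> $ i\<bar> \<le> (\<Sum>j\<in>(UNIV::'n set). \<Sum>k\<in>(UNIV::'n set). D)" .
  qed
  also have "\<dots> = 2 * real CARD('n) ^ 3 * \<kappa> * norm \<xi> * (B * C) * W \<xi>"
    by (simp add: D_def power3_eq_cube)
  finally show ?thesis .
qed

lemma leray_conv_diff:
  fixes W :: "real^'n \<Rightarrow> real"
  assumes W: "edec W"
    and b: "b \<in> borel_measurable borel" "\<And>\<eta>. norm (b \<eta>) \<le> B * W \<eta>"
    and c: "c \<in> borel_measurable borel" "\<And>\<eta>. norm (c \<eta>) \<le> C * W \<eta>"
  shows "leray_conv b b \<xi> - leray_conv c c \<xi> = leray_conv (\<lambda>\<eta>. b \<eta> - c \<eta>) b \<xi> + leray_conv c (\<lambda>\<eta>. b \<eta> - c \<eta>) \<xi>"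
proof -
  have "conv (\<lambda>\<eta>. b \<eta> $ j) (\<lambda>\<eta>. b \<eta> $ k) \<xi> - conv (\<lambda>\<eta>. c \<eta> $ j) (\<lambda>\<eta>. c \<eta> $ k) \<xi>
    = conv (\<lambda>\<eta>. b \<eta> $ j - c \<eta> $ j) (\<lambda>\<eta>. b \<eta> $ k) \<xi> + conv (\<lambda>\<eta>. c \<eta> $ j) (\<lambda>\<eta>. b \<eta> $ k - c \<eta> $ k) \<xi>" for j k
    by (intro conv_combine edec_bound[OF W b] edec_bound[OF W c])
  note e = this
  have "(leray_conv b b \<xi> - leray_conv c c \<xi>) $ i = (leray_conv (\<lambda>\<eta>. b \<eta> - c \<eta>) b \<xi> + leray_conv c (\<lambda>\<eta>. b \<eta> - c \<eta>) \<xi>) $ i" for i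
  proof -
    have "(leray_conv b b \<xi> - leray_conv c c \<xi>) $ i = (\<Sum>j\<in>UNIV. \<Sum>k\<in>UNIV. (leray i k \<xi> * \<xi> $ j) *
        (conv (\<lambda>\<eta>. b \<eta> $ j) (\<lambda>\<eta>. b \<eta> $ k) \<xi> - conv (\<lambda>\<eta>. c \<eta> $ j) (\<lambda>\<eta>. c \<eta> $ k) \<xi>))"
      by (simp only: leray_conv_def vector_minus_component vec_lambda_beta sum_subtractf right_diff_distrib)
    also have "\<dots> = (leray_conv (\<lambda>\<eta>. b \<eta> - c \<eta>) b \<xi> + leray_conv c (\<lambda>\<eta>. b \<eta> - c \<eta>) \<xi>) $ i"
      unfolding e by (simp only: leray_conv_def vector_minus_component vector_add_component vec_lambda_beta sum.distrib distrib_left)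
    finally show ?thesis .
  qed
  then show ?thesis by (simp add: vec_eq_iff)
qed

lemma conv_reflect:
  assumes "f \<in> borel_measurable borel" "g \<in> borel_measurable borel"
  shows "conv (\<lambda>\<eta>. f (- \<eta>)) (\<lambda>\<eta>. g (- \<eta>)) \<xi> = conv f g (- \<xi>)"
  unfolding conv_def
proof -
  have "- (\<xi> - \<eta>) = - \<xi> - - \<eta>" for \<eta> by simp
  then show "(LBINT \<eta>. f (- \<eta>) * g (- (\<xi> - \<eta>))) = (LBINT \<eta>. f \<eta> * g (- \<xi> - \<eta>))"
    using integral_reflect[of "\<lambda>\<eta>. f \<eta> * g (- \<xi> - \<eta>)"] assms by simp
qed

text \<open>
  Reflection of amplitudes, \<open>b(\<xi>) \<mapsto> -b(-\<xi>)\<close>, commutes with the nonlinearity. Together with uniqueness of the fixed point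
  it yields the oddness of the solution.
\<close>

lemma leray_conv_reflect:
  assumes [measurable]: "b \<in> borel_measurable borel" "c \<in> borel_measurable borel"
  shows "leray_conv (\<lambda>\<eta>. - b (- \<eta>)) (\<lambda>\<eta>. - c (- \<eta>)) \<xi> = - leray_conv b c (- \<xi>)"
proof -
  have "conv (\<lambda>\<eta>. - b (- \<eta>) $ j) (\<lambda>\<eta>. - c (- \<eta>) $ k) \<xi> = conv (\<lambda>\<eta>. b \<eta> $ j) (\<lambda>\<eta>. c \<eta> $ k) (- \<xi>)" for j k
    using conv_reflect[of "\<lambda>\<eta>. b \<eta> $ j" "\<lambda>\<eta>. c \<eta> $ k" \<xi>] by (simp add: conv_def)
  moreover have "leray i k (- \<xi>) = leray i k \<xi>" for i k by (simp add: leray_def)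
  ultimately show ?thesis
    unfolding vec_eq_iff by (simp add: leray_conv_def sum_negf)
qed

lemma leray_orthogonal: "(\<Sum>i\<in>UNIV. \<xi> $ i * leray i k \<xi>) = 0"
proof (cases "\<xi> = 0")
  case False
  then have "(\<Sum>i\<in>UNIV. \<xi> $ i * (\<xi> $ i * \<xi> $ k / (\<xi> \<bullet> \<xi>))) = \<xi> $ k"
    by (simp add: inner_vec_def[of \<xi> \<xi>] sum_divide_distrib[symmetric] sum_distrib_right[symmetric] mult.assoc[symmetric])
       (simp flip: inner_vec_def[of \<xi> \<xi>, simplified inner_real_def])
  then show ?thesis
    by (simp add: leray_def right_diff_distrib sum_subtractf if_distrib[of "\<lambda>z. _ * z"] cong: if_cong)
qed simp

lemma inner_leray_conv: "\<xi> \<bullet> leray_conv b c \<xi> = 0"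
proof -
  have "\<xi> \<bullet> leray_conv b c \<xi> = (\<Sum>i\<in>UNIV. \<Sum>j\<in>UNIV. \<Sum>k\<in>UNIV. (\<xi> $ i * leray i k \<xi>) * (\<xi> $ j * conv (\<lambda>\<eta>. b \<eta> $ j) (\<lambda>\<eta>. c \<eta> $ k) \<xi>))"
    by (simp add: inner_vec_def leray_conv_def sum_distrib_left mult_ac)
  also have "\<dots> = (\<Sum>j\<in>UNIV. \<Sum>k\<in>UNIV. (\<Sum>i\<in>UNIV. \<xi> $ i * leray i k \<xi>) * (\<xi> $ j * conv (\<lambda>\<eta>. b \<eta> $ j) (\<lambda>\<eta>. c \<eta> $ k) \<xi>))"
    by (subst sum.swap, rule sum.cong, rule refl, subst sum.swap) (simp add: sum_distrib_right)
  finally show ?thesis by (simp add: leray_orthogonal)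
qed

lemma continuous_conv:
  fixes f g :: "real \<times> (real^'n) \<Rightarrow> real"
  assumes W: "edec W" and f: "continuous_on UNIV f" "\<And>t \<eta>. \<bar>f (t, \<eta>)\<bar> \<le> W \<eta>"
    and g: "continuous_on UNIV g" "\<And>t \<eta>. \<bar>g (t, \<eta>)\<bar> \<le> W \<eta>"
  shows "continuous_on UNIV (\<lambda>p. conv (\<lambda>\<eta>. f (fst p, \<eta>)) (\<lambda>\<eta>. g (fst p, \<eta>)) (snd p))"
proof -
  obtain C \<delta> where C: "C > 0" "\<delta> > 0" "\<And>\<xi>. \<bar>W \<xi>\<bar> \<le> C * E \<delta> \<xi>" using edecE[OF W] by metis
  have WC: "\<bar>W \<eta>\<bar> \<le> C" for \<eta>
  proof -
    have "C * E \<delta> \<eta> \<le> C * 1" using C by (intro mult_left_mono E_le_1) auto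
    with C(3)[of \<eta>] show ?thesis by simp
  qed
  have [measurable]: "f \<in> borel_measurable borel" "g \<in> borel_measurable borel" "W \<in> borel_measurable borel"
    using f g W by (auto intro: borel_measurable_continuous_onI edec_measurable)
  show ?thesis
    unfolding continuous_on_sequentially conv_def
  proof (intro allI ballI impI, elim conjE)
    fix x :: "nat \<Rightarrow> real \<times> (real^'n)" and p assume lim: "x \<longlonglongrightarrow> p"
    show "((\<lambda>p. LBINT \<eta>. f (fst p, \<eta>) * g (fst p, snd p - \<eta>)) \<circ> x) \<longlonglongrightarrow> (LBINT \<eta>. f (fst p, \<eta>) * g (fst p, snd p - \<eta>))"
      unfolding comp_def
    proof (rule integral_dominated_convergence[where w="\<lambda>\<eta>. C * \<bar>W \<eta>\<bar>"])
      show "integrable lborel (\<lambda>\<eta>. C * \<bar>W \<eta>\<bar>)"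
        by (intro integrable_mult_right Bochner_Integration.integrable_abs edec_integrable W)
      show "AE \<eta> in lborel. (\<lambda>i. f (fst (x i), \<eta>) * g (fst (x i), snd (x i) - \<eta>)) \<longlonglongrightarrow> f (fst p, \<eta>) * g (fst p, snd p - \<eta>)"
        by (intro always_eventually allI tendsto_mult continuous_on_tendsto_compose[OF f(1)] continuous_on_tendsto_compose[OF g(1)] tendsto_intros lim)
           auto
      show "AE \<eta> in lborel. norm (f (fst (x i), \<eta>) * g (fst (x i), snd (x i) - \<eta>)) \<le> C * \<bar>W \<eta>\<bar>" for i
      proof (intro always_eventually allI)
        fix \<eta>
        have "\<bar>f (fst (x i), \<eta>)\<bar> \<le> \<bar>W \<eta>\<bar>" "\<bar>g (fst (x i), snd (x i) - \<eta>)\<bar> \<le> C"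
          using f(2) g(2) WC by (meson abs_ge_self order_trans)+
        then have "\<bar>f (fst (x i), \<eta>)\<bar> * \<bar>g (fst (x i), snd (x i) - \<eta>)\<bar> \<le> \<bar>W \<eta>\<bar> * C"
          by (intro mult_mono) auto
        then show "norm (f (fst (x i), \<eta>) * g (fst (x i), snd (x i) - \<eta>)) \<le> C * \<bar>W \<eta>\<bar>"
          by (simp add: abs_mult mult.commute)
      qed
    qed measurable
  qed
qed

lemma continuous_leray_conv:
  fixes b :: "real \<times> (real^'n) \<Rightarrow> real^'n"
  assumes W: "edec W" and b: "continuous_on UNIV b" "\<And>t \<eta>. norm (b (t, \<eta>)) \<le> W \<eta>"
  shows "continuous_on UNIV (\<lambda>p. leray_conv (\<lambda>\<eta>. b (fst p, \<eta>)) (\<lambda>\<eta>. b (fst p, \<eta>)) (snd p))"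
proof -
  have 1: "continuous_on UNIV (\<lambda>p::real \<times> (real^'n). leray i k (snd p) * snd p $ j)" for i j k
    by (rule continuous_on_compose2[OF continuous_symbol continuous_on_snd[OF continuous_on_id]]) auto
  have 2: "continuous_on UNIV (\<lambda>p. conv (\<lambda>\<eta>. b (fst p, \<eta>) $ j) (\<lambda>\<eta>. b (fst p, \<eta>) $ k) (snd p))" for j k
    by (rule continuous_conv[OF W, of "\<lambda>p. b p $ j" "\<lambda>p. b p $ k"])
       (intro continuous_on_component b(1) order_trans[OF component_le_norm_cart b(2)])+
  show ?thesis unfolding leray_conv_def
    by (intro continuous_on_vec_lambda continuous_on_sum continuous_on_mult[OF 1 2])
qed

section \<open>Duhamel integrals\<close>

text \<open>
  The integral of the heat kernel \<open>exp (- a (\<tau> - s))\<close> over \<open>0 \<le> s \<le> \<tau>\<close>.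
\<close>

definition duhamel_factor :: "real \<Rightarrow> real \<Rightarrow> real" where
  "duhamel_factor a \<tau> = exp (- (a * \<tau>)) * integral {0..\<tau>} (\<lambda>s. exp (a * s))"

lemma duhamel_factor_bounds:
  assumes "a \<ge> 0" "0 \<le> \<tau>" "\<tau> \<le> 1"
  shows "0 \<le> duhamel_factor a \<tau>" "duhamel_factor a \<tau> \<le> 1" "a * duhamel_factor a \<tau> \<le> 1"
proof -
  have i: "(\<lambda>s. exp (a * s)) integrable_on {0..\<tau>}"
    by (intro integrable_continuous_real continuous_intros)
  show "0 \<le> duhamel_factor a \<tau>"
    unfolding duhamel_factor_def by (intro mult_nonneg_nonneg integral_nonneg i) auto
  have "integral {0..\<tau>} (\<lambda>s. exp (a * s)) \<le> integral {0..\<tau>} (\<lambda>s. exp (a * \<tau>))"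
    using assms by (intro integral_le i integrable_const_ivl) (auto intro: mult_left_mono)
  also have "\<dots> = \<tau> * exp (a * \<tau>)" using assms by simp
  also have "\<dots> \<le> 1 * exp (a * \<tau>)" using assms by (intro mult_right_mono) auto
  finally show "duhamel_factor a \<tau> \<le> 1"
    unfolding duhamel_factor_def by (simp add: exp_minus field_simps)
  have "((\<lambda>s. a * exp (a * s)) has_integral (exp (a * \<tau>) - exp (a * 0))) {0..\<tau>}"
    using assms by (intro fundamental_theorem_of_calculus)
      (auto intro!: derivative_eq_intros simp: has_real_derivative_iff_has_vector_derivative[symmetric])
  then have "integral {0..\<tau>} (\<lambda>s. a * exp (a * s)) = exp (a * \<tau>) - exp (a * 0)"
    by (rule integral_unique)
  then have "a * integral {0..\<tau>} (\<lambda>s. exp (a * s)) = exp (a * \<tau>) - 1"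
    by simp
  then have "a * duhamel_factor a \<tau> = exp (- (a * \<tau>)) * (exp (a * \<tau>) - 1)"
    unfolding duhamel_factor_def by (simp add: mult.left_commute)
  then show "a * duhamel_factor a \<tau> \<le> 1" by (simp add: right_diff_distrib exp_minus)
qed

text \<open>
  The time integral of the heat kernel gains two derivatives at the cost \<open>1/\<nu>\<close>, and, by the arithmetic-geometric
  mean inequality, one derivative at the cost \<open>1/\<surd>\<nu>\<close> on the unit time interval. The bound for one derivative compensates
  the derivative in the nonlinearity in the fixed-point argument; the bound for two controls the gradient of the nonlinear part.
\<close>

lemma norm_duhamel_factor:
  assumes nu: "\<nu> > 0" and t: "0 \<le> \<tau>" "\<tau> \<le> 1" and x: "x \<ge> 0"
  shows "x * duhamel_factor (\<nu> * x\<^sup>2) \<tau> \<le> 1 / sqrt \<nu>" "x * (x * duhamel_factor (\<nu> * x\<^sup>2) \<tau>) \<le> 1 / \<nu>"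
proof -
  let ?J = "duhamel_factor (\<nu> * x\<^sup>2) \<tau>"
  have J: "0 \<le> ?J" "?J \<le> 1" "\<nu> * x\<^sup>2 * ?J \<le> 1"
    using duhamel_factor_bounds[of "\<nu> * x\<^sup>2" \<tau>] nu t by auto
  have "2 * (sqrt \<nu> * x) * ?J \<le> (\<nu> * x\<^sup>2 + 1) * ?J"
  proof (rule mult_right_mono[OF _ J(1)])
    have "0 \<le> (sqrt \<nu> * x - 1)\<^sup>2" by simp
    also have "\<dots> = \<nu> * x\<^sup>2 + 1 - 2 * (sqrt \<nu> * x)"
      using nu by (simp add: power2_diff power_mult_distrib)
    finally show "2 * (sqrt \<nu> * x) \<le> \<nu> * x\<^sup>2 + 1" by simp
  qed
  also have "\<dots> \<le> 2" using J by (simp add: distrib_right)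
  finally show "x * ?J \<le> 1 / sqrt \<nu>" using nu by (simp add: field_simps)
  show "x * (x * ?J) \<le> 1 / \<nu>"
    using J(3) nu by (simp add: field_simps power2_eq_square)
qed

lemma duhamel_bound:
  fixes g :: "real \<Rightarrow> 'a::euclidean_space"
  assumes g: "continuous_on {0..\<tau>} g" "\<And>s. s \<in> {0..\<tau>} \<Longrightarrow> norm (g s) \<le> G"
  shows "norm (exp (- (a * \<tau>)) *\<^sub>R integral {0..\<tau>} (\<lambda>s. exp (a * s) *\<^sub>R g s)) \<le> duhamel_factor a \<tau> * G"
proof -
  have "norm (integral {0..\<tau>} (\<lambda>s. exp (a * s) *\<^sub>R g s)) \<le> integral {0..\<tau>} (\<lambda>s. exp (a * s) * G)"
    by (rule integral_norm_bound_integral)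
       (auto intro!: integrable_continuous_real continuous_intros g mult_left_mono)
  then show ?thesis unfolding duhamel_factor_def by (simp add: mult.assoc)
qed

section \<open>The fixed point\<close>

definition clamp01 :: "real \<Rightarrow> real" where "clamp01 t = max 0 (min 1 t)"

lemma clamp01: "0 \<le> clamp01 t" "clamp01 t \<le> 1" "t \<in> I01 \<Longrightarrow> clamp01 t = t" "continuous_on UNIV clamp01"
  unfolding clamp01_def by (auto intro!: continuous_intros)

text \<open>
  The smallness condition is the only relation between the weight and the viscosity. The data take up half of the weight, so the
  other half is available to the nonlinear part.
\<close>

locale mild =
  fixes W :: "real^'n \<Rightarrow> real" and \<kappa> \<nu> :: real and b0 :: "real^'n \<Rightarrow> real^'n"
  assumes W_cont: "continuous_on UNIV W" and W_pos: "\<And>\<xi>. W \<xi> > 0" and W_edec: "edec W"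
    and W_even: "\<And>\<xi>. W (- \<xi>) = W \<xi>" and W_conv: "\<And>\<xi>. conv W W \<xi> \<le> \<kappa> * W \<xi>"
    and nu_pos: "\<nu> > 0" and small: "2 * real CARD('n) ^ 3 * \<kappa> \<le> sqrt \<nu> / 4"
    and b0_cont: "continuous_on UNIV b0" and b0_bound: "\<And>\<xi>. norm (b0 \<xi>) \<le> W \<xi> / 2"
    and b0_odd: "\<And>\<xi>. b0 (- \<xi>) = - b0 \<xi>" and b0_div: "\<And>\<xi>. \<xi> \<bullet> b0 \<xi> = 0"
begin

lemma W_nz: "W \<xi> \<noteq> 0" using W_pos[of \<xi>] by simp

definition \<Lambda> :: real where "\<Lambda> = 2 * real CARD('n) ^ 3 * \<kappa>"

lemma Lambda_nonneg: "\<Lambda> \<ge> 0"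
proof -
  have "0 \<le> conv W W 0" unfolding conv_def
    by (intro Bochner_Integration.integral_nonneg mult_nonneg_nonneg) (auto simp: W_pos less_imp_le)
  also have "\<dots> \<le> \<kappa> * W 0" by (rule W_conv)
  finally have "\<kappa> \<ge> 0" using W_pos[of 0] by (simp add: zero_le_mult_iff)
  then show ?thesis by (simp add: \<Lambda>_def)
qed

text \<open>
  Unknowns are normalised by the weight, so that the fixed point is sought in the unit ball of the bounded continuous functions
  of time and frequency.
\<close>

definition weighted :: "(real \<times> (real^'n) \<Rightarrow> real^'n) \<Rightarrow> real \<Rightarrow> real^'n \<Rightarrow> real^'n" where
  "weighted w t \<xi> = W \<xi> *\<^sub>R w (t, \<xi>)"

text \<open>
  Time is clamped to \<open>[0,1]\<close> in order to have functions on all of \<open>\<real> \<times> \<real>\<^sup>d\<close>.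
\<close>

definition mild_map :: "(real \<times> (real^'n) \<Rightarrow> real^'n) \<Rightarrow> real \<Rightarrow> real^'n \<Rightarrow> real^'n" where
  "mild_map w t \<xi> = exp (- (\<nu> * (norm \<xi>)\<^sup>2 * clamp01 t)) *\<^sub>R
     (b0 \<xi> - integral {0..clamp01 t} (\<lambda>s. exp (\<nu> * (norm \<xi>)\<^sup>2 * s) *\<^sub>R leray_conv (weighted w s) (weighted w s) \<xi>))"

definition unit_bounded :: "(real \<times> (real^'n) \<Rightarrow> real^'n) \<Rightarrow> bool" where
  "unit_bounded w \<longleftrightarrow> continuous_on UNIV w \<and> (\<forall>p. norm (w p) \<le> 1)"

lemma weighted_cont: "unit_bounded w \<Longrightarrow> continuous_on UNIV (\<lambda>p. weighted w (fst p) (snd p))"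
  unfolding weighted_def unit_bounded_def
  by (auto intro!: continuous_on_scaleR continuous_on_compose2[OF W_cont] continuous_intros)

lemma weighted_bound: "unit_bounded w \<Longrightarrow> norm (weighted w t \<xi>) \<le> 1 * W \<xi>"
  unfolding weighted_def unit_bounded_def using W_pos[of \<xi>] by simp

lemma weighted_measurable: "unit_bounded w \<Longrightarrow> weighted w t \<in> borel_measurable borel"
  using borel_measurable_continuous_onI[OF continuous_on_compose2[OF weighted_cont[of w] continuous_on_Pair[OF continuous_on_const[of UNIV t] continuous_on_id]]]
  by simp

lemma Q_cont: assumes "unit_bounded w" shows "continuous_on UNIV (\<lambda>p. leray_conv (weighted w (fst p)) (weighted w (fst p)) (snd p))"
  using continuous_leray_conv[OF W_edec weighted_cont[OF assms]] weighted_bound[OF assms] by simp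

lemma Q_cont_time: assumes "unit_bounded w" shows "continuous_on S (\<lambda>s. leray_conv (weighted w s) (weighted w s) \<xi>)"
  using continuous_on_compose2[OF Q_cont[OF assms] continuous_on_Pair[OF continuous_on_id[of S] continuous_on_const[of S \<xi>]]] by simp

lemma Q_bound: assumes "unit_bounded w" shows "norm (leray_conv (weighted w s) (weighted w s) \<xi>) \<le> \<Lambda> * norm \<xi> * W \<xi>"
  using leray_conv_bound[OF W_edec less_imp_le[OF W_pos] W_conv weighted_measurable[OF assms] weighted_bound[OF assms] weighted_measurable[OF assms] weighted_bound[OF assms], of s s]
  by (simp add: \<Lambda>_def)

lemma Q_diff_bound:
  assumes w: "unit_bounded w" and v: "unit_bounded v" and d: "\<And>p. norm (w p - v p) \<le> d"
  shows "norm (leray_conv (weighted w s) (weighted w s) \<xi> - leray_conv (weighted v s) (weighted v s) \<xi>) \<le> \<Lambda> * norm \<xi> * (2 * d) * W \<xi>"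
proof -
  have d0: "d \<ge> 0" using d norm_ge_zero order_trans by blast
  have m: "(\<lambda>\<eta>. weighted w s \<eta> - weighted v s \<eta>) \<in> borel_measurable borel"
    using weighted_measurable[OF w, of s] weighted_measurable[OF v, of s] by measurable
  have b: "norm (weighted w s \<eta> - weighted v s \<eta>) \<le> d * W \<eta>" for \<eta>
  proof -
    have "norm (weighted w s \<eta> - weighted v s \<eta>) = W \<eta> * norm (w (s, \<eta>) - v (s, \<eta>))"
      using W_pos[of \<eta>] by (simp add: weighted_def scaleR_diff_right[symmetric])
    then show ?thesis using d[of "(s, \<eta>)"] W_pos[of \<eta>] by (simp add: mult.commute)
  qed
  note nn = less_imp_le[OF W_pos]
  have "norm (leray_conv (\<lambda>\<eta>. weighted w s \<eta> - weighted v s \<eta>) (weighted w s) \<xi>) \<le> \<Lambda> * norm \<xi> * (d * 1) * W \<xi>"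
    unfolding \<Lambda>_def by (rule leray_conv_bound[OF W_edec nn W_conv m b weighted_measurable[OF w] weighted_bound[OF w] d0]) simp
  moreover have "norm (leray_conv (weighted v s) (\<lambda>\<eta>. weighted w s \<eta> - weighted v s \<eta>) \<xi>) \<le> \<Lambda> * norm \<xi> * (1 * d) * W \<xi>"
    unfolding \<Lambda>_def by (rule leray_conv_bound[OF W_edec nn W_conv weighted_measurable[OF v] weighted_bound[OF v] m b _ d0]) simp
  ultimately have "norm (leray_conv (\<lambda>\<eta>. weighted w s \<eta> - weighted v s \<eta>) (weighted w s) \<xi> + leray_conv (weighted v s) (\<lambda>\<eta>. weighted w s \<eta> - weighted v s \<eta>) \<xi>) \<le> \<Lambda> * norm \<xi> * (d * 1) * W \<xi> + \<Lambda> * norm \<xi> * (1 * d) * W \<xi>"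
    by (rule norm_triangle_mono)
  then show ?thesis
    unfolding leray_conv_diff[OF W_edec weighted_measurable[OF w] weighted_bound[OF w] weighted_measurable[OF v] weighted_bound[OF v]]
    by (simp add: algebra_simps)
qed

text \<open>
  Rescaling the time integral to \<open>[0,1]\<close> reduces joint continuity to that of an integral with continuous parameters.
\<close>

lemma mild_map_cont: assumes "unit_bounded w" shows "continuous_on UNIV (\<lambda>p. mild_map w (fst p) (snd p))"
proof -
  let ?g = "\<lambda>s \<xi>. exp (\<nu> * (norm \<xi>)\<^sup>2 * s) *\<^sub>R leray_conv (weighted w s) (weighted w s) \<xi>"
  have stretch: "integral {0..\<tau>} (\<lambda>s. ?g s \<xi>) = \<tau> *\<^sub>R integral {0..1} (\<lambda>\<theta>. ?g (\<tau> * \<theta>) \<xi>)" if "\<tau> \<ge> 0" for \<tau> \<xi>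
  proof (cases "\<tau> = 0")
    case False
    with that have "\<tau> > 0" by simp
    then have *: "(\<lambda>x. x / \<tau>) ` {0..\<tau>} = {0..1}"
      by (auto simp: image_def field_simps zero_le_mult_iff intro!: bexI[of _ "_ * _"])
    have "((\<lambda>s. ?g s \<xi>) has_integral integral {0..\<tau>} (\<lambda>s. ?g s \<xi>)) {0..\<tau>}"
      by (intro integrable_integral integrable_continuous_real continuous_intros Q_cont_time assms)
    from has_integral_stretch_real[OF this, of \<tau>] \<open>\<tau> > 0\<close>
    have "((\<lambda>\<theta>. ?g (\<tau> * \<theta>) \<xi>) has_integral (1 / \<bar>\<tau>\<bar>) *\<^sub>R integral {0..\<tau>} (\<lambda>s. ?g s \<xi>)) {0..1}"
      unfolding * by simp
    then show ?thesis using \<open>\<tau> > 0\<close> by (simp add: integral_unique)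
  qed simp
  have c: "continuous_on UNIV (\<lambda>p. integral {0..1} (\<lambda>\<theta>. ?g (clamp01 (fst p) * \<theta>) (snd p)))"
  proof -
    have "continuous_on (UNIV \<times> cbox 0 1) (\<lambda>(p::real \<times> (real^'n), \<theta>). ?g (clamp01 (fst p) * \<theta>) (snd p))"
      unfolding case_prod_unfold
      by (intro continuous_intros continuous_on_compose2[OF clamp01(4)]
            continuous_on_compose2[OF Q_cont[OF assms], where f="\<lambda>q. (clamp01 (fst (fst q)) * snd q, snd (fst q))", simplified]) auto
    from integral_continuous_on_param[OF this] show ?thesis by simp
  qed
  have "continuous_on UNIV (\<lambda>p. exp (- (\<nu> * (norm (snd p))\<^sup>2 * clamp01 (fst p))) *\<^sub>R
     (b0 (snd p) - clamp01 (fst p) *\<^sub>R integral {0..1} (\<lambda>\<theta>. ?g (clamp01 (fst p) * \<theta>) (snd p))))"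
    by (intro continuous_intros c continuous_on_compose2[OF clamp01(4)] continuous_on_compose2[OF b0_cont]) auto
  then show ?thesis
    unfolding mild_map_def stretch[OF clamp01(1)] .
qed

text \<open>
  The derivative in the nonlinearity, the heat kernel and the smallness condition meet here.
\<close>

lemma kernel_bound: "norm \<xi> * duhamel_factor (\<nu> * (norm \<xi>)\<^sup>2) (clamp01 t) * \<Lambda> \<le> 1 / 4"
proof -
  have "norm \<xi> * duhamel_factor (\<nu> * (norm \<xi>)\<^sup>2) (clamp01 t) * \<Lambda> \<le> 1 / sqrt \<nu> * (sqrt \<nu> / 4)"
    using norm_duhamel_factor(1)[OF nu_pos clamp01(1,2) norm_ge_zero] small Lambda_nonneg nu_pos
    by (intro mult_mono) (auto simp: \<Lambda>_def)
  also have "\<dots> = 1 / 4" using nu_pos by simp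
  finally show ?thesis .
qed

lemma mild_map_deviation:
  assumes "unit_bounded w"
  shows "norm (mild_map w t \<xi> - exp (- (\<nu> * (norm \<xi>)\<^sup>2 * clamp01 t)) *\<^sub>R b0 \<xi>) \<le> duhamel_factor (\<nu> * (norm \<xi>)\<^sup>2) (clamp01 t) * (\<Lambda> * norm \<xi> * W \<xi>)"
  using duhamel_bound[OF Q_cont_time[OF assms, of _ \<xi>] Q_bound[OF assms, of _ \<xi>], of "\<nu> * (norm \<xi>)\<^sup>2" "clamp01 t"]
  by (simp add: mild_map_def scaleR_diff_right)

lemma mild_map_bound: assumes "unit_bounded w" shows "norm (mild_map w t \<xi>) \<le> W \<xi>"
proof -
  have "norm (exp (- (\<nu> * (norm \<xi>)\<^sup>2 * clamp01 t)) *\<^sub>R b0 \<xi>) \<le> 1 * (W \<xi> / 2)"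
    unfolding norm_scaleR using nu_pos clamp01(1) by (intro mult_mono b0_bound) auto
  moreover have "duhamel_factor (\<nu> * (norm \<xi>)\<^sup>2) (clamp01 t) * (\<Lambda> * norm \<xi> * W \<xi>) \<le> 1/4 * W \<xi>"
    using mult_right_mono[OF kernel_bound[of \<xi> t] less_imp_le[OF W_pos[of \<xi>]]] by (simp add: mult_ac)
  moreover note mild_map_deviation[OF assms, of t \<xi>]
    norm_triangle_sub[of "mild_map w t \<xi>" "exp (- (\<nu> * (norm \<xi>)\<^sup>2 * clamp01 t)) *\<^sub>R b0 \<xi>"]
  ultimately show ?thesis using W_pos[of \<xi>] by linarith
qed

lemma mild_map_contract:
  assumes w: "unit_bounded w" and v: "unit_bounded v" and d: "\<And>p. norm (w p - v p) \<le> d"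
  shows "norm (mild_map w t \<xi> - mild_map v t \<xi>) \<le> 1 / 2 * d * W \<xi>"
proof -
  let ?a = "\<nu> * (norm \<xi>)\<^sup>2" and ?\<tau> = "clamp01 t"
  let ?q = "\<lambda>w s. leray_conv (weighted w s) (weighted w s) \<xi>"
  have d0: "d \<ge> 0" using d norm_ge_zero order_trans by blast
  have i: "(\<lambda>s. exp (?a * s) *\<^sub>R ?q w s) integrable_on {0..?\<tau>}" if "unit_bounded w" for w
    by (intro integrable_continuous_real continuous_intros Q_cont_time that)
  have "mild_map w t \<xi> - mild_map v t \<xi> = - (exp (- (?a * ?\<tau>)) *\<^sub>R integral {0..?\<tau>} (\<lambda>s. exp (?a * s) *\<^sub>R (?q w s - ?q v s)))"
    unfolding scaleR_diff_right Henstock_Kurzweil_Integration.integral_diff[OF i[OF w] i[OF v]] mild_map_def by (simp add: algebra_simps)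
  also have "norm \<dots> \<le> duhamel_factor ?a ?\<tau> * (\<Lambda> * norm \<xi> * (2 * d) * W \<xi>)"
    unfolding norm_minus_cancel
    by (intro duhamel_bound continuous_on_diff Q_cont_time Q_diff_bound w v d)
  also have "\<dots> = (norm \<xi> * duhamel_factor ?a ?\<tau> * \<Lambda>) * (2 * d * W \<xi>)" by simp
  also have "\<dots> \<le> 1 / 4 * (2 * d * W \<xi>)"
    using d0 W_pos[of \<xi>] by (intro mult_right_mono kernel_bound) auto
  finally show ?thesis by simp
qed

definition picard :: "((real \<times> (real^'n)) \<Rightarrow>\<^sub>C (real^'n)) \<Rightarrow> ((real \<times> (real^'n)) \<Rightarrow>\<^sub>C (real^'n))" where
  "picard w = Bcontfun (\<lambda>p. (1 / W (snd p)) *\<^sub>R mild_map (apply_bcontfun w) (fst p) (snd p))"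

lemma unit_bounded_cball: "w \<in> cball 0 1 \<Longrightarrow> unit_bounded (apply_bcontfun w)"
  unfolding unit_bounded_def using norm_bounded[of w] order_trans by fastforce

lemma picard_apply:
  assumes "w \<in> cball 0 1"
  shows "apply_bcontfun (picard w) (t, \<xi>) = (1 / W \<xi>) *\<^sub>R mild_map (apply_bcontfun w) t \<xi>"
    and "norm (apply_bcontfun (picard w) (t, \<xi>)) \<le> 1"
proof -
  have n: "norm ((1 / W \<xi>) *\<^sub>R mild_map (apply_bcontfun w) t \<xi>) \<le> 1" for t \<xi>
    using mild_map_bound[OF unit_bounded_cball[OF assms], of t \<xi>] W_pos[of \<xi>] by (simp add: divide_le_eq)
  have "(\<lambda>p. (1 / W (snd p)) *\<^sub>R mild_map (apply_bcontfun w) (fst p) (snd p)) \<in> bcontfun"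
    unfolding bcontfun_def
  proof (intro CollectI conjI)
    show "continuous_on UNIV (\<lambda>p. (1 / W (snd p)) *\<^sub>R mild_map (apply_bcontfun w) (fst p) (snd p))"
      by (intro continuous_on_scaleR continuous_on_divide continuous_on_const continuous_on_compose2[OF W_cont] continuous_on_snd continuous_on_id
          mild_map_cont unit_bounded_cball assms) (auto simp: W_nz)
    show "bounded (range (\<lambda>p. (1 / W (snd p)) *\<^sub>R mild_map (apply_bcontfun w) (fst p) (snd p)))"
      using n by (intro boundedI[of _ 1]) auto
  qed
  then have "apply_bcontfun (picard w) = (\<lambda>p. (1 / W (snd p)) *\<^sub>R mild_map (apply_bcontfun w) (fst p) (snd p))"
    unfolding picard_def by (rule Bcontfun_inverse)
  then show "apply_bcontfun (picard w) (t, \<xi>) = (1 / W \<xi>) *\<^sub>R mild_map (apply_bcontfun w) t \<xi>"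
    "norm (apply_bcontfun (picard w) (t, \<xi>)) \<le> 1" using n by auto
qed

lemma fixed_point: "\<exists>!w. w \<in> cball 0 1 \<and> picard w = w"
proof (rule Banach_fix[OF iffD2[OF complete_eq_closed closed_cball]])
  show "(cball 0 1 :: ((real \<times> (real^'n)) \<Rightarrow>\<^sub>C (real^'n)) set) \<noteq> {}" by simp
  show "0 \<le> (1/2::real)" "1/2 < (1::real)" by auto
  show "picard ` cball 0 1 \<subseteq> cball 0 1"
  proof
    fix v assume "v \<in> picard ` cball 0 1"
    then obtain w where w: "w \<in> cball 0 1" "v = picard w" by auto
    have "norm (picard w) \<le> 1" by (rule norm_bound) (metis picard_apply(2)[OF w(1)] prod.collapse)
    then show "v \<in> cball 0 1" using w by simp
  qed
  show "dist (picard w) (picard v) \<le> 1/2 * dist w v" if "w \<in> cball 0 1" "v \<in> cball 0 1" for w v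
  proof (rule dist_bound)
    fix p :: "real \<times> (real^'n)"
    obtain t \<xi> where p: "p = (t, \<xi>)" by (cases p)
    have "norm (mild_map (apply_bcontfun w) t \<xi> - mild_map (apply_bcontfun v) t \<xi>) \<le> 1 / 2 * dist w v * W \<xi>"
      using that by (intro mild_map_contract unit_bounded_cball) (auto simp: dist_norm[symmetric] intro: dist_bounded)
    then show "dist (apply_bcontfun (picard w) p) (apply_bcontfun (picard v) p) \<le> 1/2 * dist w v"
      unfolding p picard_apply(1)[OF that(1)] picard_apply(1)[OF that(2)] dist_norm scaleR_diff_right[symmetric] norm_scaleR
      using W_pos[of \<xi>] by (simp add: field_simps)
  qed
qed

text \<open>
  The last property measures the distance to the heat flow; it is what remains of the nonlinearity in the estimate of the dissipation.
  Oddness holds because \<open>(t, \<xi>) \<mapsto> -w(t, -\<xi>)\<close> is another fixed point in the unit ball.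
\<close>

theorem mild_solution:
  obtains b where "continuous_on UNIV (\<lambda>p. b (fst p) (snd p))" "\<And>t \<xi>. norm (b t \<xi>) \<le> W \<xi>"
    "\<And>t \<xi>. b t (- \<xi>) = - b t \<xi>"
    "\<And>t \<xi>. t \<in> I01 \<Longrightarrow> b t \<xi> = exp (- (\<nu> * (norm \<xi>)\<^sup>2 * t)) *\<^sub>R
     (b0 \<xi> - integral {0..t} (\<lambda>s. exp (\<nu> * (norm \<xi>)\<^sup>2 * s) *\<^sub>R leray_conv (b s) (b s) \<xi>))"
    "\<And>t \<xi>. t \<in> I01 \<Longrightarrow> norm (b t \<xi> - exp (- (\<nu> * (norm \<xi>)\<^sup>2 * t)) *\<^sub>R b0 \<xi>) \<le> duhamel_factor (\<nu> * (norm \<xi>)\<^sup>2) t * (\<Lambda> * norm \<xi> * W \<xi>)"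
proof -
  obtain w where w: "w \<in> cball 0 1" "picard w = w" and uniq: "\<And>v. v \<in> cball 0 1 \<Longrightarrow> picard v = v \<Longrightarrow> v = w"
    using fixed_point by blast
  note a = unit_bounded_cball[OF w(1)]
  let ?b = "weighted (apply_bcontfun w)"
  have b: "?b t \<xi> = mild_map (apply_bcontfun w) t \<xi>" for t \<xi>
    using picard_apply(1)[OF w(1), of t \<xi>] W_pos[of \<xi>] by (simp add: w(2) weighted_def)
  define v where "v = Bcontfun (\<lambda>p. - apply_bcontfun w (fst p, - snd p))"
  have v: "apply_bcontfun v = (\<lambda>p. - apply_bcontfun w (fst p, - snd p))"
    unfolding v_def
  proof (rule Bcontfun_inverse)
    have "continuous_on UNIV (\<lambda>p. - apply_bcontfun w (fst p, - snd p))"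
      by (intro continuous_intros continuous_on_compose2[OF continuous_on_apply_bcontfun[of UNIV w]]) auto
    moreover have "bounded (range (\<lambda>p. - apply_bcontfun w (fst p, - snd p)))"
      using a unfolding unit_bounded_def by (intro boundedI[of _ 1]) auto
    ultimately show "(\<lambda>p. - apply_bcontfun w (fst p, - snd p)) \<in> bcontfun" by (simp add: bcontfun_def)
  qed
  have v1: "v \<in> cball 0 1"
    using a norm_bound[of v 1] by (simp add: v unit_bounded_def)
  have Av: "weighted (apply_bcontfun v) s = (\<lambda>\<xi>. - ?b s (- \<xi>))" for s
    by (simp add: weighted_def v W_even fun_eq_iff)
  have "leray_conv (weighted (apply_bcontfun v) s) (weighted (apply_bcontfun v) s) \<xi> = - leray_conv (?b s) (?b s) (- \<xi>)" for s \<xi>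
    unfolding Av by (rule leray_conv_reflect) (rule weighted_measurable[OF a])+
  then have "mild_map (apply_bcontfun v) t \<xi> = - mild_map (apply_bcontfun w) t (- \<xi>)" for t \<xi>
    by (simp add: mild_map_def b0_odd algebra_simps)
  then have "picard v = v"
    by (intro bcontfun_eqI) (auto simp: picard_apply(1)[OF v1] v b[symmetric] weighted_def W_even W_nz)
  then have "v = w" by (rule uniq[OF v1])
  then have odd: "apply_bcontfun w (t, - \<xi>) = - apply_bcontfun w (t, \<xi>)" for t \<xi>
    using fun_cong[OF v, of "(t, \<xi>)"] by simp
  show ?thesis
  proof
    show "continuous_on UNIV (\<lambda>p. ?b (fst p) (snd p))" by (rule weighted_cont[OF a])
    show "norm (?b t \<xi>) \<le> W \<xi>" for t \<xi> using weighted_bound[OF a, of t \<xi>] by simp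
    show "?b t (- \<xi>) = - ?b t \<xi>" for t \<xi> by (simp add: weighted_def W_even odd)
    show "?b t \<xi> = exp (- (\<nu> * (norm \<xi>)\<^sup>2 * t)) *\<^sub>R
     (b0 \<xi> - integral {0..t} (\<lambda>s. exp (\<nu> * (norm \<xi>)\<^sup>2 * s) *\<^sub>R leray_conv (?b s) (?b s) \<xi>))" if "t \<in> I01" for t \<xi>
      unfolding b[of t] mild_map_def clamp01(3)[OF that] ..
    show "norm (?b t \<xi> - exp (- (\<nu> * (norm \<xi>)\<^sup>2 * t)) *\<^sub>R b0 \<xi>) \<le> duhamel_factor (\<nu> * (norm \<xi>)\<^sup>2) t * (\<Lambda> * norm \<xi> * W \<xi>)" if "t \<in> I01" for t \<xi>
      using mild_map_deviation[OF a, of t \<xi>] unfolding b clamp01(3)[OF that] .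
  qed
qed

end

section \<open>Time regularity from the differential equation\<close>

lemma segment_I01: "s \<in> I01 \<Longrightarrow> t \<in> I01 \<Longrightarrow> closed_segment t s \<subseteq> I01"
  by (simp add: closed_segment_subset)

lemma edom_diffq_from_derivative:
  fixes a a' :: "real \<Rightarrow> real^'n \<Rightarrow> real"
  assumes m: "\<And>t. t \<in> I01 \<Longrightarrow> a t \<in> borel_measurable borel"
    and D: "\<And>t \<xi>. t \<in> I01 \<Longrightarrow> ((\<lambda>s. a s \<xi>) has_real_derivative a' t \<xi>) (at t within I01)"
    and b: "edom I01 a'"
  shows "edom (I01 \<times> I01) (diffq a)"
proof -
  obtain C \<delta> where C: "C > 0" "\<delta> > 0" "\<And>t \<xi>. t \<in> I01 \<Longrightarrow> \<bar>a' t \<xi>\<bar> \<le> C * E \<delta> \<xi>" using edomE[OF b] by metis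
  show ?thesis
  proof (rule edomI)
    fix p assume "p \<in> I01 \<times> I01"
    then obtain s t where p: "p = (s, t)" "s \<in> I01" "t \<in> I01" by auto
    have [measurable]: "a s \<in> borel_measurable borel" "a t \<in> borel_measurable borel" using m p by auto
    show "diffq a p \<in> borel_measurable borel" unfolding p diffq_def prod.case by measurable
    show "\<bar>diffq a p \<xi>\<bar> \<le> C * E \<delta> \<xi>" for \<xi>
    proof -
      have "norm (a s \<xi> - a t \<xi>) \<le> C * E \<delta> \<xi> * norm (s - t)"
        by (rule field_differentiable_bound[OF convex_real_interval(5)]) (use D C(3) p in auto)
      moreover have "0 \<le> C * E \<delta> \<xi>" using C E_pos[of \<delta> \<xi>] by simp
      ultimately show ?thesis unfolding p diffq_def by (cases "s = t") (auto simp: divide_le_eq)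
    qed
  qed fact
qed

text \<open>
  Mean value inequality for \<open>r \<mapsto> a r \<xi> - r a' t \<xi>\<close>, whose derivative is at most a multiple of \<open>\<bar>s - t\<bar>\<close> as \<open>a'\<close> is Lipschitz.
\<close>

lemma edom_taylorq_from_derivative:
  fixes a a' :: "real \<Rightarrow> real^'n \<Rightarrow> real"
  assumes m: "\<And>t. t \<in> I01 \<Longrightarrow> a t \<in> borel_measurable borel"
    and D: "\<And>t \<xi>. t \<in> I01 \<Longrightarrow> ((\<lambda>s. a s \<xi>) has_real_derivative a' t \<xi>) (at t within I01)"
    and b: "tame a'"
  shows "edom (I01 \<times> I01) (taylorq a a')"
proof -
  obtain C \<delta> where C: "C > 0" "\<delta> > 0" "\<And>p \<xi>. p \<in> I01 \<times> I01 \<Longrightarrow> \<bar>diffq a' p \<xi>\<bar> \<le> C * E \<delta> \<xi>"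
    using edomE[of "I01 \<times> I01" "diffq a'"] b unfolding tame_def by metis
  show ?thesis
  proof (rule edomI)
    fix p assume "p \<in> I01 \<times> I01"
    then obtain s t where p: "p = (s, t)" "s \<in> I01" "t \<in> I01" by auto
    have [measurable]: "a s \<in> borel_measurable borel" "a t \<in> borel_measurable borel" "a' t \<in> borel_measurable borel"
      using m p edec_measurable[OF tame_edec[OF b p(3)]] by auto
    show "taylorq a a' p \<in> borel_measurable borel" unfolding p taylorq_def prod.case by measurable
    show "\<bar>taylorq a a' p \<xi>\<bar> \<le> C * E \<delta> \<xi>" for \<xi>
    proof -
      have K: "0 \<le> C * E \<delta> \<xi>" using C E_pos[of \<delta> \<xi>] by simp
      have "norm ((a s \<xi> - s * a' t \<xi>) - (a t \<xi> - t * a' t \<xi>)) \<le> (C * E \<delta> \<xi> * \<bar>s - t\<bar>) * norm (s - t)"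
      proof (rule field_differentiable_bound[OF convex_closed_segment[of t s]])
        fix r assume r: "r \<in> closed_segment t s"
        then have rI: "r \<in> I01" using segment_I01[OF p(2,3)] by auto
        show "((\<lambda>r. a r \<xi> - r * a' t \<xi>) has_real_derivative (a' r \<xi> - a' t \<xi>)) (at r within closed_segment t s)"
          by (rule DERIV_subset[OF _ segment_I01[OF p(2,3)]]) (auto intro!: derivative_eq_intros D[OF rI])
        have "\<bar>r - t\<bar> \<le> \<bar>s - t\<bar>" using r by (auto simp: closed_segment_eq_real_ivl split: if_splits)
        moreover have "\<bar>a' r \<xi> - a' t \<xi>\<bar> \<le> C * E \<delta> \<xi> * \<bar>r - t\<bar>"
          using C(3)[of "(r, t)" \<xi>] rI p by (cases "r = t") (auto simp: diffq_def divide_le_eq)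
        ultimately show "norm (a' r \<xi> - a' t \<xi>) \<le> C * E \<delta> \<xi> * \<bar>s - t\<bar>"
          using mult_left_mono[OF _ K, of "\<bar>r - t\<bar>" "\<bar>s - t\<bar>"] by simp
      qed auto
      moreover have "(a s \<xi> - s * a' t \<xi>) - (a t \<xi> - t * a' t \<xi>) = a s \<xi> - a t \<xi> - (s - t) * a' t \<xi>"
        by (simp add: algebra_simps)
      ultimately have "\<bar>a s \<xi> - a t \<xi> - (s - t) * a' t \<xi>\<bar> \<le> C * E \<delta> \<xi> * (s - t)\<^sup>2"
        by (simp add: power2_eq_square mult.assoc abs_mult[symmetric])
      then show ?thesis unfolding p taylorq_def prod.case abs_divide
        using K by (cases "s = t") (auto simp: divide_le_eq)
    qed
  qed fact
qed

lemma tempered_uminus: "tempered (\<lambda>\<xi>. - m \<xi>)" if "tempered m" for m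
  using tempered_mult[OF tempered_const[of "-1"] that] by simp

lemma tempered_normsq: "tempered (\<lambda>\<xi>. (norm \<xi>)\<^sup>2)"
  unfolding power2_norm_eq_inner inner_vec_def inner_real_def
  by (intro tempered_sum tempered_mult tempered_coord) auto

lemma tempered_symbol: "tempered (\<lambda>\<xi>. leray i k \<xi> * \<xi> $ j)"
  by (intro tempered_mult tempered_coord tempered_bounded[of _ 2] abs_leray_le) auto

lemma tempered_riesz: "tempered (\<lambda>\<xi>. \<xi> $ j * \<xi> $ k / (\<xi> \<bullet> \<xi>))"
proof (rule tempered_bounded)
  show "\<bar>\<xi> $ j * \<xi> $ k / (\<xi> \<bullet> \<xi>)\<bar> \<le> 3" for \<xi>
    using abs_leray_le[of j k \<xi>] by (auto simp: leray_def split: if_splits)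
qed auto

section \<open>Vector fields given by their amplitude\<close>

definition vsynth :: "real \<Rightarrow> (real^'n \<Rightarrow> real^'n) \<Rightarrow> real^'n \<Rightarrow> real^'n" where
  "vsynth \<theta> b x = (\<chi> i. synth \<theta> (\<lambda>\<xi>. b \<xi> $ i) x)"

lemma has_derivative_vec:
  fixes f :: "'a::real_normed_vector \<Rightarrow> real^'n"
  assumes "\<And>i. ((\<lambda>x. f x $ i) has_derivative (\<lambda>h. f' h $ i)) (at x within S)"
  shows "(f has_derivative f') (at x within S)"
  unfolding has_derivative_componentwise_within[of f]
  using assms by (auto simp: Basis_vec_def inner_axis)

lemma pdiff_vsynth:
  assumes "\<And>i. edec (\<lambda>\<xi>. b \<xi> $ i)"
  shows "pdiff j (vsynth \<theta> b) x = vsynth (\<theta> + pi/2) (\<lambda>\<xi>. \<xi> $ j *\<^sub>R b \<xi>) x"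
proof -
  let ?f' = "\<lambda>h. \<chi> i. \<Sum>k\<in>UNIV. h $ k * synth (\<theta> + pi/2) (\<lambda>\<xi>. \<xi> $ k * b \<xi> $ i) x"
  have "(vsynth \<theta> b has_derivative ?f') (at x)"
    by (rule has_derivative_vec) (simp add: vsynth_def synth_has_derivative_space[OF assms, unfolded eta_contract_eq])
  then have "frechet_derivative (vsynth \<theta> b) (at x) = ?f'"
    by (rule frechet_derivative_at[symmetric])
  then show ?thesis
    by (simp add: pdiff_def axis_def vsynth_def if_distrib[of "\<lambda>z. z * _"] cong: if_cong)
qed

lemma Ck_on_vec:
  fixes f :: "'a::euclidean_space \<Rightarrow> real^'n"
  assumes "\<And>i. Ck_on k (\<lambda>x. f x $ i) S"
  shows "Ck_on k f S"
proof -
  have c: "Ck_on k (\<lambda>x. \<Sum>i\<in>UNIV. f x $ i *\<^sub>R axis i 1) S"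
    by (intro Ck_on_sum Ck_on_linear[OF bounded_linear_scaleR_left] assms) auto
  have e: "(\<lambda>x. \<Sum>i\<in>UNIV. f x $ i *\<^sub>R axis i 1) = f"
    by (rule ext, subst basis_expansion[symmetric]) (simp add: scalar_mult_eq_scaleR)
  show ?thesis by (rule subst[OF e, of "\<lambda>g. Ck_on k g S"], rule c)
qed

lemma synth_shift_pi:
  fixes x :: "real^'n" shows "synth (pi/2) f x = - synth (- (pi/2)) f x"
proof -
  have "cos (\<xi> \<bullet> x + pi/2) = - cos (\<xi> \<bullet> x + - (pi/2))" for \<xi> :: "real^'n"
    using cos_add[of "\<xi> \<bullet> x" "pi/2"] cos_add[of "\<xi> \<bullet> x" "- (pi/2)"] by simp
  then show ?thesis by (simp add: synth_def)
qed

lemma sum_uniformly_bounded: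
  fixes f :: "'a \<Rightarrow> 'b \<Rightarrow> real"
  assumes "\<And>i. \<exists>K. \<forall>t. f i t \<le> K"
  shows "\<exists>K. \<forall>t. (\<Sum>i\<in>X. f i t) \<le> K"
proof -
  obtain K where "\<And>i t. f i t \<le> K i" using assms by metis
  then have "\<forall>t. (\<Sum>i\<in>X. f i t) \<le> (\<Sum>i\<in>X. K i)" by (auto intro: sum_mono)
  then show ?thesis ..
qed

lemma norm_matrix_sq: "(norm (M :: real^'n^'m))\<^sup>2 = (\<Sum>i\<in>UNIV. \<Sum>j\<in>UNIV. (M $ i $ j)\<^sup>2)"
  unfolding power2_norm_eq_inner by (simp add: inner_vec_def power2_eq_square)

context mild begin

context
  fixes b :: "real \<Rightarrow> real^'n \<Rightarrow> real^'n"
  assumes b_cont: "continuous_on UNIV (\<lambda>p. b (fst p) (snd p))"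
    and b_bound: "\<And>t \<xi>. norm (b t \<xi>) \<le> W \<xi>"
    and b_odd: "\<And>t \<xi>. b t (- \<xi>) = - b t \<xi>"
    and b_eq: "\<And>t \<xi>. t \<in> I01 \<Longrightarrow> b t \<xi> = exp (- (\<nu> * (norm \<xi>)\<^sup>2 * t)) *\<^sub>R
     (b0 \<xi> - integral {0..t} (\<lambda>s. exp (\<nu> * (norm \<xi>)\<^sup>2 * s) *\<^sub>R leray_conv (b s) (b s) \<xi>))"
begin

lemma b_measurable[measurable]: "b t \<in> borel_measurable borel"
  using borel_measurable_continuous_onI[OF continuous_on_compose2[OF b_cont continuous_on_Pair[OF continuous_on_const[of UNIV t] continuous_on_id]]]
  by simp

lemma b_measurable_pair[measurable]: "(\<lambda>p. b (fst p) (snd p)) \<in> borel_measurable borel"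
  by (rule borel_measurable_continuous_onI[OF b_cont])

lemma b_edec: "edec (\<lambda>\<xi>. b t \<xi> $ i)"
  by (rule edec_bound[OF W_edec b_measurable, of t 1]) (simp add: b_bound)

lemma b_edom: "edom T (\<lambda>t \<xi>. b t \<xi> $ i)"
proof -
  obtain C \<delta> where C: "C > 0" "\<delta> > 0" "\<And>\<xi>. \<bar>W \<xi>\<bar> \<le> C * E \<delta> \<xi>" using edecE[OF W_edec] by metis
  show ?thesis
  proof (rule edomI[OF _ C(2)])
    show "\<bar>b t \<xi> $ i\<bar> \<le> C * E \<delta> \<xi>" for t \<xi>
      using component_le_norm_cart[of "b t \<xi>" i] b_bound[of t \<xi>] C(3)[of \<xi>] by linarith
  qed measurable
qed

lemma b_init: "b 0 \<xi> = b0 \<xi>"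
  using b_eq[of 0 \<xi>] by simp

text \<open>
  The right-hand side of the differential equation that the amplitude satisfies at each frequency.
\<close>

definition b_rate :: "real \<Rightarrow> real^'n \<Rightarrow> real^'n" where
  "b_rate t \<xi> = - (\<nu> * (norm \<xi>)\<^sup>2) *\<^sub>R b t \<xi> - leray_conv (b t) (b t) \<xi>"

lemma leray_conv_b_cont_time: "continuous_on S (\<lambda>s. leray_conv (b s) (b s) \<xi>)"
proof -
  have "continuous_on UNIV (\<lambda>p. leray_conv (b (fst p)) (b (fst p)) (snd p))"
    using continuous_leray_conv[OF W_edec b_cont] b_bound by simp
  from continuous_on_compose2[OF this continuous_on_Pair[OF continuous_on_id[of S] continuous_on_const[of S \<xi>]]]
  show ?thesis by simp
qed

lemma b_derivative: "t \<in> I01 \<Longrightarrow> ((\<lambda>s. b s \<xi>) has_vector_derivative b_rate t \<xi>) (at t within I01)"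
proof -
  assume t: "t \<in> I01"
  let ?a = "\<nu> * (norm \<xi>)\<^sup>2"
  let ?g = "\<lambda>s. exp (?a * s) *\<^sub>R leray_conv (b s) (b s) \<xi>"
  let ?f = "\<lambda>t. exp (- (?a * t)) *\<^sub>R (b0 \<xi> - integral {0..t} ?g)"
  have g: "((\<lambda>u. integral {0..u} ?g) has_vector_derivative ?g t) (at t within I01)"
    by (intro integral_has_vector_derivative t continuous_intros leray_conv_b_cont_time)
  have "((\<lambda>u. b0 \<xi> - integral {0..u} ?g) has_vector_derivative (0 - ?g t)) (at t within I01)"
    by (intro has_vector_derivative_diff has_vector_derivative_const g)
  moreover have "((\<lambda>u. exp (- (?a * u))) has_real_derivative (exp (- (?a * t)) * (- ?a))) (at t within I01)"
    by (auto intro!: derivative_eq_intros)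
  ultimately have "(?f has_vector_derivative (exp (- (?a * t)) *\<^sub>R (0 - ?g t) + (exp (- (?a * t)) * (- ?a)) *\<^sub>R (b0 \<xi> - integral {0..t} ?g))) (at t within I01)"
    by (rule has_vector_derivative_scaleR[rotated])
  moreover have "exp (- (?a * t)) *\<^sub>R (0 - ?g t) + (exp (- (?a * t)) * (- ?a)) *\<^sub>R (b0 \<xi> - integral {0..t} ?g) = b_rate t \<xi>"
  proof -
    have "exp (- (?a * t)) *\<^sub>R (0 - ?g t) = - leray_conv (b t) (b t) \<xi>"
      by (simp add: exp_minus)
    moreover have "(exp (- (?a * t)) * (- ?a)) *\<^sub>R (b0 \<xi> - integral {0..t} ?g) = - ?a *\<^sub>R b t \<xi>"
      unfolding b_eq[OF t, of \<xi>] scaleR_scaleR by (simp only: mult.commute)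
    ultimately show ?thesis unfolding b_rate_def by (simp only: uminus_add_conv_diff)
  qed
  ultimately have "(?f has_vector_derivative b_rate t \<xi>) (at t within I01)" by simp
  then show ?thesis
    by (rule has_vector_derivative_transform[OF t, rotated]) (rule b_eq)
qed

lemma b_derivative_component:
  "t \<in> I01 \<Longrightarrow> ((\<lambda>s. b s \<xi> $ i) has_real_derivative b_rate t \<xi> $ i) (at t within I01)"
  using bounded_linear.has_vector_derivative[OF bounded_linear_vec_nth b_derivative]
  by (simp add: has_real_derivative_iff_has_vector_derivative)

lemma b_rate_component:
  "b_rate t \<xi> $ i = - (\<nu> * (norm \<xi>)\<^sup>2) * b t \<xi> $ i + (-1) * (\<Sum>j\<in>UNIV. \<Sum>k\<in>UNIV. (leray i k \<xi> * \<xi> $ j) * conv (\<lambda>\<eta>. b t \<eta> $ j) (\<lambda>\<eta>. b t \<eta> $ k) \<xi>)"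
  by (simp add: b_rate_def leray_conv_def)

lemma tempered_heat: "tempered (\<lambda>\<xi>. - (\<nu> * (norm \<xi>)\<^sup>2))"
  by (intro tempered_uminus tempered_mult tempered_const tempered_normsq)

lemma b_rate_edom: "edom I01 (\<lambda>t \<xi>. b_rate t \<xi> $ i)"
proof -
  have s: "edom I01 (\<lambda>t \<xi>. \<Sum>i\<in>X. f i t \<xi>)" if "finite X" "\<And>i. i \<in> X \<Longrightarrow> edom I01 (f i)" for X :: "'n set" and f :: "'n \<Rightarrow> real \<Rightarrow> real^'n \<Rightarrow> real"
    using that by (induction X rule: finite_induct) (auto intro: edom_zero edom_add)
  show ?thesis unfolding b_rate_component
    by (intro edom_add edom_tempered[OF tempered_heat] edom_tempered[OF tempered_const] b_edom s
        edom_tempered[OF tempered_symbol] edom_conv) auto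
qed

lemma b_tame: "tame (\<lambda>t \<xi>. b t \<xi> $ i)"
  unfolding tame_def
  by (intro conjI b_edom edom_diffq_from_derivative[OF _ b_derivative_component b_rate_edom]) measurable

lemma smooth_amp_rate: "(\<And>j. smooth_amp k (\<lambda>t \<xi>. b t \<xi> $ j)) \<Longrightarrow> smooth_amp k (\<lambda>t \<xi>. b_rate t \<xi> $ i)"
  unfolding b_rate_component
  by (intro smooth_amp_add smooth_amp_mult[OF tempered_heat] smooth_amp_mult[OF tempered_const] smooth_amp_sum smooth_amp_mult[OF tempered_symbol] smooth_amp_conv) auto

lemma b_taylorq: "edom (I01 \<times> I01) (taylorq (\<lambda>t \<xi>. b t \<xi> $ i) (\<lambda>t \<xi>. b_rate t \<xi> $ i))"
  using smooth_amp_rate[of 0 i] b_tame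
  by (intro edom_taylorq_from_derivative b_derivative_component) auto

text \<open>
  If \<open>b\<close> has \<open>k\<close> time derivatives, then so has the right-hand side of its equation, since symbols and convolutions preserve
  smooth amplitudes; hence \<open>b\<close> has \<open>k + 1\<close>.
\<close>

lemma smooth_amp_b: "smooth_amp k (\<lambda>t \<xi>. b t \<xi> $ i)"
proof (induction k arbitrary: i)
  case (Suc k)
  then show ?case using smooth_amp_rate[OF Suc] b_taylorq[of i] b_tame[of i] by auto
qed (simp add: b_tame)

text \<open>
  The part of \<open>div (u \<otimes> u)\<close> that the Leray projection removes is \<open>-\<nabla>p\<close>; this is the cosine amplitude of \<open>p\<close>.
\<close>

definition pressure_amp :: "real \<Rightarrow> real^'n \<Rightarrow> real" where
  "pressure_amp t \<xi> = (\<Sum>j\<in>UNIV. \<Sum>k\<in>UNIV. (\<xi> $ j * \<xi> $ k / (\<xi> \<bullet> \<xi>)) * conv (\<lambda>\<eta>. b t \<eta> $ j) (\<lambda>\<eta>. b t \<eta> $ k) \<xi>)"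

lemma smooth_amp_pressure: "smooth_amp k pressure_amp"
  unfolding pressure_amp_def[abs_def]
  by (intro smooth_amp_sum smooth_amp_mult[OF tempered_riesz] smooth_amp_conv smooth_amp_b) auto

lemma pressure_edec: "t \<in> I01 \<Longrightarrow> edec (pressure_amp t)"
  by (rule tame_edec[OF smooth_amp_tame[OF smooth_amp_pressure[of 0]]])

abbreviation u :: "real \<Rightarrow> real^'n \<Rightarrow> real^'n" where "u t \<equiv> vsynth (- (pi/2)) (b t)"
abbreviation p :: "real \<Rightarrow> real^'n \<Rightarrow> real" where "p t \<equiv> synth 0 (pressure_amp t)"

lemma u_smooth: "Cinf_on (\<lambda>(t, x). u t x) (I01 \<times> UNIV)"
  unfolding Cinf_on_def case_prod_unfold
  by (intro allI Ck_on_vec) (simp add: vsynth_def Ck_on_synth[OF smooth_amp_b])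

lemma p_smooth: "Cinf_on (\<lambda>(t, x). p t x) (I01 \<times> UNIV)"
  unfolding Cinf_on_def case_prod_unfold
  by (intro allI Ck_on_synth smooth_amp_pressure)

lemma u0_smooth: "Cinf_on (u 0) UNIV"
  using u_smooth Ck_on_slice[of _ "\<lambda>(t, x). u t x" 0] by (simp add: Cinf_on_def)

lemma b_divfree: "t \<in> I01 \<Longrightarrow> \<xi> \<bullet> b t \<xi> = 0"
proof -
  assume t: "t \<in> I01"
  let ?g = "\<lambda>s. exp (\<nu> * (norm \<xi>)\<^sup>2 * s) *\<^sub>R leray_conv (b s) (b s) \<xi>"
  have "?g integrable_on {0..t}"
    by (intro integrable_continuous_real continuous_intros leray_conv_b_cont_time)
  then have "\<xi> \<bullet> integral {0..t} ?g = integral {0..t} (\<lambda>s. \<xi> \<bullet> ?g s)"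
    using integral_linear[of ?g "{0..t}" "\<lambda>x. \<xi> \<bullet> x"] by (simp add: comp_def bounded_linear_inner_right)
  also have "\<dots> = 0" by (simp add: inner_leray_conv)
  finally show ?thesis unfolding b_eq[OF t] by (simp add: inner_diff_right b0_div)
qed

lemma pdiff_u: "pdiff j (u t) = vsynth 0 (\<lambda>\<xi>. \<xi> $ j *\<^sub>R b t \<xi>)"
  using pdiff_vsynth[of "b t" j "- (pi/2)"] b_edec by (simp add: fun_eq_iff)

lemma xb_edec: "edec (\<lambda>\<xi>. \<xi> $ j * b t \<xi> $ i)"
  by (intro edec_mult tempered_coord b_edec)

lemma divergence_u: "t \<in> I01 \<Longrightarrow> divergence (u t) x = 0"
proof -
  assume t: "t \<in> I01"
  have "divergence (u t) x = synth 0 (\<lambda>\<xi>. \<Sum>i\<in>UNIV. \<xi> $ i * b t \<xi> $ i) x"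
    unfolding divergence_def pdiff_u vsynth_def
    by (subst synth_sum) (auto intro: xb_edec)
  also have "\<dots> = 0"
    using b_divfree[OF t] by (simp add: inner_vec_def synth_zero)
  finally show ?thesis .
qed

lemma laplacian_u: "laplacian (u t) x $ i = - synth (- (pi/2)) (\<lambda>\<xi>. (norm \<xi>)\<^sup>2 * b t \<xi> $ i) x"
proof -
  have "pdiff j (pdiff j (u t)) x = vsynth (pi/2) (\<lambda>\<xi>. \<xi> $ j *\<^sub>R (\<xi> $ j *\<^sub>R b t \<xi>)) x" for j
    unfolding pdiff_u using pdiff_vsynth[of "\<lambda>\<xi>. \<xi> $ j *\<^sub>R b t \<xi>" j 0] xb_edec by simp
  then have "laplacian (u t) x $ i = (\<Sum>j\<in>UNIV. synth (pi/2) (\<lambda>\<xi>. \<xi> $ j * (\<xi> $ j * b t \<xi> $ i)) x)"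
    unfolding laplacian_def by (simp add: vsynth_def mult.assoc)
  also have "\<dots> = synth (pi/2) (\<lambda>\<xi>. \<Sum>j\<in>UNIV. \<xi> $ j * (\<xi> $ j * b t \<xi> $ i)) x"
    by (rule synth_sum[symmetric]) (auto intro!: edec_mult[OF tempered_coord] xb_edec)
  also have "(\<lambda>\<xi>. \<Sum>j\<in>UNIV. \<xi> $ j * (\<xi> $ j * b t \<xi> $ i)) = (\<lambda>\<xi>. (norm \<xi>)\<^sup>2 * b t \<xi> $ i)"
    unfolding power2_norm_eq_inner by (simp add: inner_vec_def sum_distrib_right mult.assoc)
  finally show ?thesis by (simp add: synth_shift_pi)
qed

lemma gradient_p: "t \<in> I01 \<Longrightarrow> gradient (p t) x $ i = - synth (- (pi/2)) (\<lambda>\<xi>. \<xi> $ i * pressure_amp t \<xi>) x"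
  using pdiff_synth[OF pressure_edec, of t i 0 x] by (simp add: gradient_def synth_shift_pi)

text \<open>
  \<open>u \<bullet> \<nabla>u = div (u \<otimes> u)\<close> on the Fourier side: replacing \<open>\<xi> - \<eta>\<close> by \<open>\<xi>\<close> in the coordinate factor costs \<open>\<eta> \<bullet> b t \<eta> = 0\<close>.
\<close>

lemma conv_transport:
  assumes t: "t \<in> I01"
  shows "(\<Sum>j\<in>UNIV. conv (\<lambda>\<eta>. b t \<eta> $ j) (\<lambda>\<eta>. \<eta> $ j * b t \<eta> $ i) \<xi>) = (\<Sum>j\<in>UNIV. \<xi> $ j * conv (\<lambda>\<eta>. b t \<eta> $ j) (\<lambda>\<eta>. b t \<eta> $ i) \<xi>)"
proof -
  have "(\<Sum>j\<in>UNIV. conv (\<lambda>\<eta>. b t \<eta> $ j) (\<lambda>\<eta>. \<eta> $ j * b t \<eta> $ i) \<xi>)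
    = (LBINT \<eta>. (\<Sum>j\<in>UNIV. b t \<eta> $ j * ((\<xi> - \<eta>) $ j * b t (\<xi> - \<eta>) $ i)))"
    unfolding conv_def
    by (rule Bochner_Integration.integral_sum[symmetric]) (rule conv_integrable[OF b_edec xb_edec])
  also have "\<dots> = (LBINT \<eta>. (\<Sum>j\<in>UNIV. \<xi> $ j * (b t \<eta> $ j * b t (\<xi> - \<eta>) $ i)))"
  proof (intro Bochner_Integration.integral_cong refl)
    fix \<eta>
    have "(\<Sum>j\<in>UNIV. b t \<eta> $ j * ((\<xi> - \<eta>) $ j * b t (\<xi> - \<eta>) $ i))
      = (\<Sum>j\<in>UNIV. \<xi> $ j * (b t \<eta> $ j * b t (\<xi> - \<eta>) $ i)) - (\<eta> \<bullet> b t \<eta>) * b t (\<xi> - \<eta>) $ i"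
      unfolding inner_vec_def inner_real_def sum_distrib_right sum_subtractf[symmetric]
      by (intro sum.cong refl) (simp add: algebra_simps)
    then show "(\<Sum>j\<in>UNIV. b t \<eta> $ j * ((\<xi> - \<eta>) $ j * b t (\<xi> - \<eta>) $ i)) = (\<Sum>j\<in>UNIV. \<xi> $ j * (b t \<eta> $ j * b t (\<xi> - \<eta>) $ i))"
      by (simp add: b_divfree[OF t])
  qed
  also have "\<dots> = (\<Sum>j\<in>UNIV. LBINT \<eta>. \<xi> $ j * (b t \<eta> $ j * b t (\<xi> - \<eta>) $ i))"
    by (intro Bochner_Integration.integral_sum integrable_mult_right conv_integrable b_edec)
  finally show ?thesis by (simp add: conv_def)
qed

lemma convection_u:
  assumes t: "t \<in> I01"
  shows "convection (u t) (u t) x $ i = synth (- (pi/2)) (\<lambda>\<xi>. \<Sum>j\<in>UNIV. \<xi> $ j * conv (\<lambda>\<eta>. b t \<eta> $ j) (\<lambda>\<eta>. b t \<eta> $ i) \<xi>) x"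
proof -
  have "convection (u t) (u t) x $ i = (\<Sum>j\<in>UNIV. synth (- (pi/2)) (\<lambda>\<xi>. b t \<xi> $ j) x * synth 0 (\<lambda>\<xi>. \<xi> $ j * b t \<xi> $ i) x)"
    unfolding convection_def pdiff_u by (simp add: vsynth_def)
  also have "\<dots> = (\<Sum>j\<in>UNIV. synth (- (pi/2)) (conv (\<lambda>\<xi>. b t \<xi> $ j) (\<lambda>\<xi>. \<xi> $ j * b t \<xi> $ i)) x)"
    by (intro sum.cong refl synth_mult b_edec xb_edec) (simp add: b_odd)
  also have "\<dots> = synth (- (pi/2)) (\<lambda>\<xi>. \<Sum>j\<in>UNIV. conv (\<lambda>\<eta>. b t \<eta> $ j) (\<lambda>\<eta>. \<eta> $ j * b t \<eta> $ i) \<xi>) x"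
    by (subst synth_sum) (auto intro: edec_conv b_edec xb_edec)
  finally show ?thesis unfolding conv_transport[OF t] .
qed

lemma time_derivative_u:
  assumes t: "t \<in> I01"
  shows "vector_derivative (\<lambda>s. u s x) (at t within I01) = vsynth (- (pi/2)) (b_rate t) x"
proof -
  have "((\<lambda>s. u s x) has_derivative (\<lambda>h. h *\<^sub>R vsynth (- (pi/2)) (b_rate t) x)) (at t within I01)"
    by (rule has_derivative_vec)
       (use synth_has_vector_derivative[OF b_tame b_rate_edom b_taylorq t] in \<open>simp add: vsynth_def has_vector_derivative_def\<close>)
  then have "((\<lambda>s. u s x) has_vector_derivative vsynth (- (pi/2)) (b_rate t) x) (at t within I01)"
    by (simp add: has_vector_derivative_def)
  then show ?thesis
    using t by (intro vector_derivative_within_cbox[of 0 1 t, simplified]) auto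
qed

text \<open>
  All four terms are sine syntheses, and their amplitudes cancel at each frequency by the definitions of
  \<^const>\<open>leray_conv\<close> and \<open>pressure_amp\<close>.
\<close>

lemma momentum:
  assumes t: "t \<in> I01"
  shows "vector_derivative (\<lambda>s. u s x) (at t within I01) + convection (u t) (u t) x
          - \<nu> *\<^sub>R laplacian (u t) x + gradient (p t) x = 0"
proof -
  let ?S = "\<lambda>f. synth (- (pi/2)) f x"
  have eG: "edec (\<lambda>\<xi>. b_rate t \<xi> $ i)" for i by (rule edom_edec[OF b_rate_edom t])
  have ec: "edec (\<lambda>\<xi>. \<Sum>j\<in>UNIV. \<xi> $ j * conv (\<lambda>\<eta>. b t \<eta> $ j) (\<lambda>\<eta>. b t \<eta> $ i) \<xi>)" for i
    by (intro edec_sum edec_mult tempered_coord edec_conv b_edec) auto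
  have eb: "edec (\<lambda>\<xi>. \<nu> * ((norm \<xi>)\<^sup>2 * b t \<xi> $ i))" for i
    by (intro edec_mult tempered_const tempered_normsq b_edec)
  have ep: "edec (\<lambda>\<xi>. \<xi> $ i * pressure_amp t \<xi>)" for i
    by (intro edec_mult tempered_coord pressure_edec t)
  have "(vector_derivative (\<lambda>s. u s x) (at t within I01) + convection (u t) (u t) x
          - \<nu> *\<^sub>R laplacian (u t) x + gradient (p t) x) $ i = 0" for i
  proof -
    have z: "((b_rate t \<xi> $ i + (\<Sum>j\<in>UNIV. \<xi> $ j * conv (\<lambda>\<eta>. b t \<eta> $ j) (\<lambda>\<eta>. b t \<eta> $ i) \<xi>)) + \<nu> * ((norm \<xi>)\<^sup>2 * b t \<xi> $ i)) - \<xi> $ i * pressure_amp t \<xi> = 0" for \<xi>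
    proof -
      let ?c = "\<lambda>j k. conv (\<lambda>\<eta>. b t \<eta> $ j) (\<lambda>\<eta>. b t \<eta> $ k) \<xi>"
      have "(\<Sum>j\<in>UNIV. \<Sum>k\<in>UNIV. (leray i k \<xi> * \<xi> $ j) * ?c j k)
        = (\<Sum>j\<in>UNIV. \<Sum>k\<in>UNIV. (if i = k then \<xi> $ j * ?c j k else 0) - \<xi> $ i * ((\<xi> $ j * \<xi> $ k / (\<xi> \<bullet> \<xi>)) * ?c j k))"
        by (intro sum.cong refl) (simp add: leray_def left_diff_distrib)
      also have "\<dots> = (\<Sum>j\<in>UNIV. \<xi> $ j * ?c j i) - \<xi> $ i * pressure_amp t \<xi>"
        by (simp add: sum_subtractf pressure_amp_def sum_distrib_left)
      finally show ?thesis unfolding b_rate_component by simp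
    qed
    have "(vector_derivative (\<lambda>s. u s x) (at t within I01) + convection (u t) (u t) x
          - \<nu> *\<^sub>R laplacian (u t) x + gradient (p t) x) $ i
      = ?S (\<lambda>\<xi>. b_rate t \<xi> $ i) + ?S (\<lambda>\<xi>. \<Sum>j\<in>UNIV. \<xi> $ j * conv (\<lambda>\<eta>. b t \<eta> $ j) (\<lambda>\<eta>. b t \<eta> $ i) \<xi>)
        + ?S (\<lambda>\<xi>. \<nu> * ((norm \<xi>)\<^sup>2 * b t \<xi> $ i)) - ?S (\<lambda>\<xi>. \<xi> $ i * pressure_amp t \<xi>)"
      unfolding vector_add_component vector_minus_component vector_scaleR_component
        time_derivative_u[OF t] convection_u[OF t] laplacian_u gradient_p[OF t] by (simp add: vsynth_def synth_cmult)
    also have "\<dots> = ?S (\<lambda>\<xi>. ((b_rate t \<xi> $ i + (\<Sum>j\<in>UNIV. \<xi> $ j * conv (\<lambda>\<eta>. b t \<eta> $ j) (\<lambda>\<eta>. b t \<eta> $ i) \<xi>)) + \<nu> * ((norm \<xi>)\<^sup>2 * b t \<xi> $ i)) - \<xi> $ i * pressure_amp t \<xi>)"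
      by (simp only: synth_diff synth_add edec_add eG ec eb ep)
    also have "\<dots> = 0" unfolding z by (rule synth_zero)
    finally show ?thesis .
  qed
  then show ?thesis by (simp add: vec_eq_iff)
qed

lemma NS_solution: "smooth_NS_solution \<nu> (u 0) u p"
  unfolding smooth_NS_solution_def using u_smooth p_smooth momentum divergence_u by auto

section \<open>Energy and dissipation\<close>

lemma vgradient_u: "vgradient (u t) x $ i $ j = synth 0 (\<lambda>\<xi>. \<xi> $ j * b t \<xi> $ i) x"
  by (simp add: vgradient_def pdiff_u vsynth_def)

lemma in_L2_u: "in_L2 (u t)" and L2_norm_u: "(L2_norm (u t))\<^sup>2 \<le> (2 * pi) ^ CARD('n) * (\<Sum>i\<in>UNIV. LBINT \<xi>. (b t \<xi> $ i)\<^sup>2)"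
proof -
  have n: "(norm (u t x))\<^sup>2 = (\<Sum>i\<in>UNIV. (synth (- (pi/2)) (\<lambda>\<xi>. b t \<xi> $ i) x)\<^sup>2)" for x
    unfolding power2_norm_eq_inner by (simp add: inner_vec_def vsynth_def power2_eq_square)
  have "continuous_on UNIV (u t)"
    unfolding vsynth_def by (intro continuous_on_vec_lambda continuous_synth b_edec)
  then have m: "u t \<in> borel_measurable lborel" using borel_measurable_continuous_onI by auto
  show "in_L2 (u t)"
    unfolding in_L2_def n
    by (intro conjI m Bochner_Integration.integrable_sum synth_L2 b_edec)
  have "(L2_norm (u t))\<^sup>2 = (LBINT x. (norm (u t x))\<^sup>2)"
    unfolding L2_norm_def by (rule real_sqrt_pow2) (rule Bochner_Integration.integral_nonneg, simp)
  also have "\<dots> = (\<Sum>i\<in>UNIV. LBINT x. (synth (- (pi/2)) (\<lambda>\<xi>. b t \<xi> $ i) x)\<^sup>2)"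
    unfolding n by (intro Bochner_Integration.integral_sum synth_L2 b_edec)
  also have "\<dots> \<le> (\<Sum>i\<in>UNIV. (2 * pi) ^ CARD('n) * (LBINT \<xi>. (b t \<xi> $ i)\<^sup>2))"
    by (intro sum_mono synth_L2 b_edec)
  finally show "(L2_norm (u t))\<^sup>2 \<le> (2 * pi) ^ CARD('n) * (\<Sum>i\<in>UNIV. LBINT \<xi>. (b t \<xi> $ i)\<^sup>2)"
    by (simp add: sum_distrib_left)
qed

lemma in_L2_grad: "in_L2 (vgradient (u t))"
  and L2_norm_grad: "(L2_norm (vgradient (u t)))\<^sup>2 = (\<Sum>i\<in>UNIV. \<Sum>j\<in>UNIV. LBINT x. (synth 0 (\<lambda>\<xi>. \<xi> $ j * b t \<xi> $ i) x)\<^sup>2)"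
proof -
  have e: "vgradient (u t) = (\<lambda>x. \<chi> i j. synth 0 (\<lambda>\<xi>. \<xi> $ j * b t \<xi> $ i) x)"
    by (simp add: fun_eq_iff vec_eq_iff vgradient_u)
  have "continuous_on UNIV (vgradient (u t))"
    unfolding e by (intro continuous_on_vec_lambda continuous_synth xb_edec)
  then have m: "vgradient (u t) \<in> borel_measurable lborel" using borel_measurable_continuous_onI by auto
  show "in_L2 (vgradient (u t))"
    unfolding in_L2_def norm_matrix_sq vgradient_u
    by (intro conjI m Bochner_Integration.integrable_sum synth_L2 xb_edec)
  have "(L2_norm (vgradient (u t)))\<^sup>2 = (LBINT x. (norm (vgradient (u t) x))\<^sup>2)"
    unfolding L2_norm_def by (rule real_sqrt_pow2) (rule Bochner_Integration.integral_nonneg, simp)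
  also have "\<dots> = (\<Sum>i\<in>UNIV. \<Sum>j\<in>UNIV. LBINT x. (synth 0 (\<lambda>\<xi>. \<xi> $ j * b t \<xi> $ i) x)\<^sup>2)"
    unfolding norm_matrix_sq vgradient_u
    by (subst Bochner_Integration.integral_sum | intro Bochner_Integration.integrable_sum synth_L2 xb_edec sum.cong refl Bochner_Integration.integral_sum)+
  finally show "(L2_norm (vgradient (u t)))\<^sup>2 = (\<Sum>i\<in>UNIV. \<Sum>j\<in>UNIV. LBINT x. (synth 0 (\<lambda>\<xi>. \<xi> $ j * b t \<xi> $ i) x)\<^sup>2)" .
qed

text \<open>
  For the lower bound on the dissipation one entry of the gradient is enough.
\<close>

lemma grad_component_le: "(LBINT x. (synth 0 (\<lambda>\<xi>. \<xi> $ j * b t \<xi> $ i) x)\<^sup>2) \<le> (L2_norm (vgradient (u t)))\<^sup>2"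
proof -
  let ?f = "\<lambda>i j. LBINT x. (synth 0 (\<lambda>\<xi>. \<xi> $ j * b t \<xi> $ i) x)\<^sup>2"
  have nn: "0 \<le> ?f i j" for i j by (rule Bochner_Integration.integral_nonneg) simp
  have "?f i j \<le> (\<Sum>j\<in>UNIV. ?f i j)" by (rule member_le_sum) (auto simp: nn)
  also have "\<dots> \<le> (\<Sum>i\<in>UNIV. \<Sum>j\<in>UNIV. ?f i j)" by (rule member_le_sum) (auto simp: nn sum_nonneg)
  finally show ?thesis unfolding L2_norm_grad .
qed

lemma grad_measurable: "(\<lambda>t. (L2_norm (vgradient (u t)))\<^sup>2) \<in> borel_measurable borel"
proof -
  have [measurable]: "(\<lambda>p. b (fst (fst p)) (snd p) $ i) \<in> borel_measurable ((borel \<Otimes>\<^sub>M lborel) \<Otimes>\<^sub>M lborel)" for i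
    using measurable_compose[OF _ b_measurable_pair, of "\<lambda>p. (fst (fst p), snd p)" "(borel \<Otimes>\<^sub>M lborel) \<Otimes>\<^sub>M lborel"]
    by (intro measurable_nth_vec) (simp add: borel_prod[symmetric])
  have "(\<lambda>t. LBINT x. (synth 0 (\<lambda>\<xi>. \<xi> $ j * b t \<xi> $ i) x)\<^sup>2) \<in> borel_measurable borel" for i j
    unfolding synth_def by measurable
  then show ?thesis unfolding L2_norm_grad by measurable
qed

lemma grad_bounded: "\<exists>K. \<forall>t. (L2_norm (vgradient (u t)))\<^sup>2 \<le> K"
proof -
  have "\<exists>K\<ge>0. \<forall>t\<in>UNIV. (LBINT \<xi>. \<bar>(\<xi> $ j * b t \<xi> $ i)\<^sup>2\<bar>) \<le> K" for i j
  proof (rule edom_integral_bound)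
    obtain C \<delta> where C: "C > 0" "\<delta> > 0" "\<And>t \<xi>. t \<in> (UNIV::real set) \<Longrightarrow> \<bar>\<xi> $ j * b t \<xi> $ i\<bar> \<le> C * E \<delta> \<xi>"
      using edomE[OF edom_tempered[OF tempered_coord b_edom]] by metis
    show "edom (UNIV::real set) (\<lambda>t \<xi>. (\<xi> $ j * b t \<xi> $ i)\<^sup>2)"
    proof (rule edomI[OF _ C(2)])
      fix t \<xi>
      have "\<bar>(\<xi> $ j * b t \<xi> $ i)\<^sup>2\<bar> \<le> (C * 1) * (C * E \<delta> \<xi>)"
        unfolding power2_eq_square abs_mult[of "_ * _" "_ * _"]
        using C by (intro mult_mono C(3) order_trans[OF C(3) mult_left_mono[OF E_le_1]]) auto
      then show "\<bar>(\<xi> $ j * b t \<xi> $ i)\<^sup>2\<bar> \<le> (C * C) * E \<delta> \<xi>" by (simp add: mult_ac)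
    qed measurable
  qed
  then have 1: "\<exists>K. \<forall>t. (LBINT \<xi>. (\<xi> $ j * b t \<xi> $ i)\<^sup>2) \<le> K" for i j
    by simp blast
  have 2: "\<exists>K. \<forall>t. (LBINT x. (synth 0 (\<lambda>\<xi>. \<xi> $ j * b t \<xi> $ i) x)\<^sup>2) \<le> K" for i j
  proof -
    obtain K where K: "\<forall>t. (LBINT \<xi>. (\<xi> $ j * b t \<xi> $ i)\<^sup>2) \<le> K" using 1 by blast
    have "(LBINT x. (synth 0 (\<lambda>\<xi>. \<xi> $ j * b t \<xi> $ i) x)\<^sup>2) \<le> (2 * pi) ^ CARD('n) * K" for t
      by (rule order_trans[OF synth_L2(2)[OF xb_edec] mult_left_mono]) (use K in auto)
    then show ?thesis by blast
  qed
  show ?thesis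
    unfolding L2_norm_grad by (intro sum_uniformly_bounded 2)
qed

lemma grad_integrable: "set_integrable lborel I01 (\<lambda>t. (L2_norm (vgradient (u t)))\<^sup>2)"
proof -
  obtain K where K: "\<And>t. (L2_norm (vgradient (u t)))\<^sup>2 \<le> K" using grad_bounded by blast
  show ?thesis
    unfolding set_integrable_def
  proof (rule integrableI_bounded_set_indicator[where B=K])
    show "(\<lambda>t. (L2_norm (vgradient (u t)))\<^sup>2) \<in> borel_measurable lborel" using grad_measurable by simp
  qed (use K in auto)
qed

lemma finite_dissipation_u: "finite_dissipation u"
  unfolding finite_dissipation_def using grad_integrable in_L2_grad by auto

end

end

section \<open>The weight\<close>

text \<open>
  The exponential gives decay; the rational factor is what makes the convolution estimate \<open>weight_conv\<close> hold,
  since a pure exponential fails it. The weight is anisotropic with half sides \<open>r i\<close>, and the constant in that estimate scales with the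
  volume \<open>\<Prod> r i\<close>.
\<close>

definition weight :: "('n::finite \<Rightarrow> real) \<Rightarrow> real^'n \<Rightarrow> real" where
  "weight r \<xi> = (\<Prod>i\<in>UNIV. exp (- (\<bar>\<xi> $ i\<bar> / r i)) * (1 / (1 + (\<xi> $ i / r i)\<^sup>2)))"

lemma one_plus_square_pos: "0 < 1 + (x::real)\<^sup>2"
  by (simp add: add_pos_nonneg)

lemma weight_factor: "0 < exp (- (a::real)) * (1 / (1 + x\<^sup>2))"
  using one_plus_square_pos[of x] by simp

lemma weight_pos: "weight r \<xi> > 0"
  unfolding weight_def by (intro prod_pos) (auto simp: one_plus_square_pos)

lemma weight_even: "weight r (- \<xi>) = weight r \<xi>"
  by (simp add: weight_def)

lemma weight_cont: "(\<And>i. r i > 0) \<Longrightarrow> continuous_on UNIV (weight r)"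
  unfolding weight_def by (intro continuous_intros ballI less_imp_neq[THEN not_sym] one_plus_square_pos) auto

lemma weight_le_cauchy: assumes "\<And>i. r i > 0" shows "weight r \<xi> \<le> (\<Prod>i\<in>UNIV. 1 / (1 + (\<xi> $ i / r i)\<^sup>2))"
  unfolding weight_def
proof (intro prod_mono conjI)
  fix i :: 'a
  show "0 \<le> exp (- (\<bar>\<xi> $ i\<bar> / r i)) * (1 / (1 + (\<xi> $ i / r i)\<^sup>2))" using weight_factor less_imp_le by blast
  have "exp (- (\<bar>\<xi> $ i\<bar> / r i)) \<le> 1" using assms[of i] by simp
  then show "exp (- (\<bar>\<xi> $ i\<bar> / r i)) * (1 / (1 + (\<xi> $ i / r i)\<^sup>2)) \<le> 1 / (1 + (\<xi> $ i / r i)\<^sup>2)"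
    using one_plus_square_pos[of "\<xi> $ i / r i"] by (intro mult_left_le_one_le) auto
qed

lemma weight_le_1: assumes "\<And>i. r i > 0" shows "weight r \<xi> \<le> 1"
proof (rule order_trans[OF weight_le_cauchy[OF assms]])
  show "(\<Prod>i\<in>UNIV. 1 / (1 + (\<xi> $ i / r i)\<^sup>2)) \<le> 1"
    using one_plus_square_pos by (intro prod_le_1) (auto simp: divide_le_eq less_imp_le)
qed

lemma weight_edec:
  fixes r :: "'n::finite \<Rightarrow> real"
  assumes r: "\<And>i. r i > 0" shows "edec (weight r)"
proof -
  define R where "R = (\<Sum>i\<in>UNIV. r i)"
  have R: "r i \<le> R" for i
    unfolding R_def using r by (intro member_le_sum) (auto simp: less_imp_le)
  have R0: "R > 0" using R r less_le_trans by blast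
  have "weight r \<xi> \<le> E (1 / R) \<xi>" for \<xi>
  proof -
    have "weight r \<xi> \<le> (\<Prod>i\<in>UNIV. exp (- (1 / R) * \<bar>\<xi> $ i\<bar>))"
      unfolding weight_def
    proof (intro prod_mono conjI)
      fix i
      show "0 \<le> exp (- (\<bar>\<xi> $ i\<bar> / r i)) * (1 / (1 + (\<xi> $ i / r i)\<^sup>2))" using weight_factor less_imp_le by blast
      have "exp (- (\<bar>\<xi> $ i\<bar> / r i)) * (1 / (1 + (\<xi> $ i / r i)\<^sup>2)) \<le> exp (- (\<bar>\<xi> $ i\<bar> / r i)) * 1"
        using one_plus_square_pos[of "\<xi> $ i / r i"] by (intro mult_left_mono) (auto simp: divide_le_eq)
      also have "\<dots> \<le> exp (- (1 / R) * \<bar>\<xi> $ i\<bar>)"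
        using R[of i] r[of i] R0 by (simp add: frac_le)
      finally show "exp (- (\<bar>\<xi> $ i\<bar> / r i)) * (1 / (1 + (\<xi> $ i / r i)\<^sup>2)) \<le> exp (- (1 / R) * \<bar>\<xi> $ i\<bar>)" .
    qed
    also have "\<dots> = E (1 / R) \<xi>"
      by (simp add: E_def l1_def exp_sum[symmetric] sum_distrib_left sum_negf)
    finally show ?thesis .
  qed
  then have "\<bar>weight r \<xi>\<bar> \<le> 1 * E (1 / R) \<xi>" for \<xi> using weight_pos[of r \<xi>] by simp
  moreover have "weight r \<in> borel_measurable borel" by (rule borel_measurable_continuous_onI[OF weight_cont[OF r]])
  moreover have "0 < 1 / R" using R0 by simp
  ultimately show ?thesis unfolding edec_def by blast
qed

lemma cauchy_scaled:
  assumes "r > 0"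
  shows "integrable lborel (\<lambda>s::real. 1 / (1 + (s / r)\<^sup>2))" "(LBINT s. 1 / (1 + ((s::real) / r)\<^sup>2)) = r * pi"
  using lborel_integral_scale[OF assms integrable_cauchy] by (simp_all add: integral_cauchy[simplified])

lemma weight_integral:
  fixes r :: "'n::finite \<Rightarrow> real"
  assumes r: "\<And>i. r i > 0" shows "(LBINT \<xi>. weight r \<xi>) \<le> pi ^ CARD('n) * (\<Prod>i\<in>UNIV. r i)"
proof -
  have "(LBINT \<xi>. weight r \<xi>) \<le> (LBINT \<xi>. (\<Prod>i\<in>UNIV. 1 / (1 + (\<xi> $ i / r i)\<^sup>2)))"
    by (intro Bochner_Integration.integral_mono edec_integrable weight_edec r integrable_prod_vec cauchy_scaled weight_le_cauchy)
  also have "\<dots> = (\<Prod>i\<in>UNIV. r i * pi)"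
    by (subst integral_prod_vec) (auto simp: cauchy_scaled r)
  also have "\<dots> = pi ^ CARD('n) * (\<Prod>i\<in>UNIV. r i)"
    by (simp add: prod.distrib mult.commute)
  finally show ?thesis .
qed

text \<open>
  Convexity of the square, \<open>(a + b)\<^sup>2 \<le> 2 a\<^sup>2 + 2 b\<^sup>2\<close>: so the larger of \<open>1 + a\<^sup>2\<close> and \<open>1 + b\<^sup>2\<close> controls
  \<open>1 + (a + b)\<^sup>2\<close>.
\<close>

lemma cauchy_product_bound:
  "1 / (1 + a\<^sup>2) * (1 / (1 + b\<^sup>2)) \<le> 1 / (1 + (a + b)\<^sup>2) * (2 / (1 + a\<^sup>2) + 2 / (1 + b\<^sup>2))" for a b :: real
proof -
  have p: "0 < 1 + a\<^sup>2" "0 < 1 + b\<^sup>2" "0 < 1 + (a + b)\<^sup>2" by (rule one_plus_square_pos)+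
  have "(a + b)\<^sup>2 \<le> 2 * a\<^sup>2 + 2 * b\<^sup>2"
    using sum_squares_bound[of a b] by (simp add: power2_sum)
  then have "1 + (a + b)\<^sup>2 \<le> 2 * (1 + b\<^sup>2) + 2 * (1 + a\<^sup>2)" by simp
  moreover have "2 / (1 + a\<^sup>2) + 2 / (1 + b\<^sup>2) = (2 * (1 + b\<^sup>2) + 2 * (1 + a\<^sup>2)) / ((1 + a\<^sup>2) * (1 + b\<^sup>2))"
    using p by (subst add_frac_eq) auto
  ultimately show ?thesis
    using p by (simp add: divide_simps del: distrib_left_numeral)
qed

text \<open>
  Coordinatewise, the exponentials combine by the triangle inequality and the rational factors by
  \<open>cauchy_product_bound\<close>. What is left factors over the coordinates and integrates to \<open>4 \<pi> r i\<close> in each.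
\<close>

lemma weight_conv:
  fixes r :: "'n::finite \<Rightarrow> real"
  assumes r: "\<And>i. r i > 0" shows "conv (weight r) (weight r) \<xi> \<le> ((4 * pi) ^ CARD('n) * (\<Prod>i\<in>UNIV. r i)) * weight r \<xi>"
proof -
  let ?g = "\<lambda>i s. 2 * (1 / (1 + (s / r i)\<^sup>2)) + 2 * (1 / (1 + ((\<xi> $ i - s) / r i)\<^sup>2))"
  have shift: "integrable lborel (\<lambda>s. 1 / (1 + ((\<xi> $ i - s) / r i)\<^sup>2))"
    "(LBINT s. 1 / (1 + ((\<xi> $ i - s) / r i)\<^sup>2)) = r i * pi" for i
  proof -
    show e: "(LBINT s. 1 / (1 + ((\<xi> $ i - s) / r i)\<^sup>2)) = r i * pi"
      using integral_refl_translate[of "\<lambda>s::real. 1 / (1 + (s / r i)\<^sup>2)" "\<xi> $ i"] cauchy_scaled(2)[OF r[of i]] by simp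
    then have "(LBINT s. 1 / (1 + ((\<xi> $ i - s) / r i)\<^sup>2)) \<noteq> 0" using r[of i] by simp
    then show "integrable lborel (\<lambda>s. 1 / (1 + ((\<xi> $ i - s) / r i)\<^sup>2))" using not_integrable_integral_eq by blast
  qed
  have gi: "integrable lborel (?g i)" for i
    by (intro Bochner_Integration.integrable_add integrable_mult_right cauchy_scaled r shift)
  have gI: "(LBINT s. ?g i s) = 4 * pi * r i" for i
    unfolding Bochner_Integration.integral_add[OF integrable_mult_right[OF cauchy_scaled(1)[OF r[of i]]] integrable_mult_right[OF shift(1)[of i]]]
      integral_mult_right_zero cauchy_scaled(2)[OF r[of i]] shift(2) by simp
  have "conv (weight r) (weight r) \<xi> \<le> (LBINT \<eta>. weight r \<xi> * (\<Prod>i\<in>UNIV. ?g i (\<eta> $ i)))"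
    unfolding conv_def
  proof (rule Bochner_Integration.integral_mono)
    show "integrable lborel (\<lambda>\<eta>. weight r \<eta> * weight r (\<xi> - \<eta>))" by (intro conv_integrable weight_edec r)
    show "integrable lborel (\<lambda>\<eta>::real^'n. weight r \<xi> * (\<Prod>i\<in>UNIV. ?g i (\<eta> $ i)))"
      by (intro integrable_mult_right integrable_prod_vec gi)
    fix \<eta> :: "real^'n"
    show "weight r \<eta> * weight r (\<xi> - \<eta>) \<le> weight r \<xi> * (\<Prod>i\<in>UNIV. ?g i (\<eta> $ i))"
      unfolding weight_def prod.distrib[symmetric]
    proof (intro prod_mono conjI)
      fix i
      let ?a = "\<eta> $ i / r i" and ?b = "(\<xi> $ i - \<eta> $ i) / r i"
      let ?E = "exp (- (\<bar>\<eta> $ i\<bar> / r i)) * exp (- (\<bar>(\<xi> - \<eta>) $ i\<bar> / r i))"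
      show "0 \<le> exp (- (\<bar>\<eta> $ i\<bar> / r i)) * (1 / (1 + (\<eta> $ i / r i)\<^sup>2)) * (exp (- (\<bar>(\<xi> - \<eta>) $ i\<bar> / r i)) * (1 / (1 + ((\<xi> - \<eta>) $ i / r i)\<^sup>2)))"
        using weight_factor by (intro mult_nonneg_nonneg) (auto simp: less_imp_le)
      have "\<bar>\<xi> $ i\<bar> / r i \<le> \<bar>\<eta> $ i\<bar> / r i + \<bar>(\<xi> - \<eta>) $ i\<bar> / r i"
        unfolding add_divide_distrib[symmetric] using r[of i] by (intro divide_right_mono) auto
      then have E: "?E \<le> exp (- (\<bar>\<xi> $ i\<bar> / r i))" by (simp add: exp_add[symmetric])
      have ab: "?a + ?b = \<xi> $ i / r i" by (simp add: add_divide_distrib[symmetric])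
      have "exp (- (\<bar>\<eta> $ i\<bar> / r i)) * (1 / (1 + ?a\<^sup>2)) * (exp (- (\<bar>(\<xi> - \<eta>) $ i\<bar> / r i)) * (1 / (1 + ((\<xi> - \<eta>) $ i / r i)\<^sup>2)))
        = ?E * (1 / (1 + ?a\<^sup>2) * (1 / (1 + ?b\<^sup>2)))" by simp
      also have "\<dots> \<le> exp (- (\<bar>\<xi> $ i\<bar> / r i)) * (1 / (1 + (?a + ?b)\<^sup>2) * (2 / (1 + ?a\<^sup>2) + 2 / (1 + ?b\<^sup>2)))"
        using one_plus_square_pos by (intro mult_mono E cauchy_product_bound mult_nonneg_nonneg) (auto simp: less_imp_le)
      finally show "exp (- (\<bar>\<eta> $ i\<bar> / r i)) * (1 / (1 + (\<eta> $ i / r i)\<^sup>2)) * (exp (- (\<bar>(\<xi> - \<eta>) $ i\<bar> / r i)) * (1 / (1 + ((\<xi> - \<eta>) $ i / r i)\<^sup>2)))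
        \<le> exp (- (\<bar>\<xi> $ i\<bar> / r i)) * (1 / (1 + (\<xi> $ i / r i)\<^sup>2)) * ?g i (\<eta> $ i)"
        unfolding ab by (simp add: mult.assoc)
    qed
  qed
  also have "\<dots> = weight r \<xi> * (\<Prod>i\<in>UNIV. 4 * pi * r i)"
    by (subst integral_mult_right_zero, subst integral_prod_vec[OF gi]) (simp only: gI)
  finally show ?thesis by (simp add: prod.distrib mult_ac)
qed

section \<open>The initial data\<close>

text \<open>
  Constants depending on the dimension alone: for the domination of the data by the weight, for the contraction, for the initial energy,
  for the relative size of the nonlinear error, for the Gaussian moment that represents the linear part, and for the dissipation.
\<close>

definition data_const :: "nat \<Rightarrow> real" where "data_const d = (2 * exp (9 / 2)) ^ d"
definition contraction_const :: "nat \<Rightarrow> real" where "contraction_const d = 4 * real d ^ 3 * data_const d * (4 * pi) ^ d"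
definition energy_const :: "nat \<Rightarrow> real" where "energy_const d = (2 * pi) ^ d * (real d * (4 * (data_const d)\<^sup>2 * pi ^ d))"
definition error_const :: "nat \<Rightarrow> real" where "error_const d = contraction_const d * (2 * data_const d * pi ^ d)"
definition moment_const :: "nat \<Rightarrow> real" where "moment_const d = (sqrt (2 * pi) / 2) ^ d / 4"
definition dissipation_const :: "nat \<Rightarrow> real" where "dissipation_const d = (2 * pi) ^ d * (moment_const d)\<^sup>2 / (4 * sqrt pi ^ d)"

lemma const_pos: "data_const d > 0" "moment_const d > 0" "dissipation_const d > 0" "d > 0 \<Longrightarrow> contraction_const d > 0" "d > 0 \<Longrightarrow> error_const d > 0"
  by (auto simp: data_const_def moment_const_def dissipation_const_def contraction_const_def error_const_def)

text \<open>
  \<open>9/2\<close> is the maximum of \<open>3 x - x\<^sup>2/2\<close>; two of the three exponentials absorb the polynomials, the third is the one in the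
  weight.
\<close>

lemma gauss_poly_bound: "exp (- x\<^sup>2 / 2) * (1 + \<bar>x\<bar>) \<le> 2 * exp (9 / 2) * (exp (- \<bar>x\<bar>) * (1 / (1 + x\<^sup>2)))" for x :: real
proof -
  have 1: "1 + \<bar>x\<bar> \<le> exp \<bar>x\<bar>" by (rule exp_ge_add_one_self)
  have 2: "1 + x\<^sup>2 \<le> 2 * exp \<bar>x\<bar>"
    using exp_lower_Taylor_quadratic[of "\<bar>x\<bar>"] by simp
  have "(1 + \<bar>x\<bar>) * (1 + x\<^sup>2) \<le> exp \<bar>x\<bar> * (2 * exp \<bar>x\<bar>)"
    using 1 2 by (intro mult_mono) auto
  then have "exp (\<bar>x\<bar> - x\<^sup>2 / 2) * ((1 + \<bar>x\<bar>) * (1 + x\<^sup>2)) \<le> exp (\<bar>x\<bar> - x\<^sup>2 / 2) * (exp \<bar>x\<bar> * (2 * exp \<bar>x\<bar>))"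
    by (intro mult_left_mono) auto
  also have "\<dots> = 2 * exp (3 * \<bar>x\<bar> - x\<^sup>2 / 2)" by (simp add: exp_add[symmetric] exp_diff)
  also have "\<dots> \<le> 2 * exp (9 / 2)"
  proof -
    have "0 \<le> (\<bar>x\<bar> - 3)\<^sup>2" by simp
    then show ?thesis by (simp add: power2_diff)
  qed
  finally have "exp (\<bar>x\<bar> - x\<^sup>2 / 2) * (1 + \<bar>x\<bar>) \<le> 2 * exp (9 / 2) * (1 / (1 + x\<^sup>2))"
    using one_plus_square_pos[of x] by (simp add: field_simps)
  then have "exp (- \<bar>x\<bar>) * (exp (\<bar>x\<bar> - x\<^sup>2 / 2) * (1 + \<bar>x\<bar>)) \<le> exp (- \<bar>x\<bar>) * (2 * exp (9 / 2) * (1 / (1 + x\<^sup>2)))"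
    by (rule mult_left_mono) simp
  moreover have "exp (- x\<^sup>2 / 2) = exp (- \<bar>x\<bar>) * exp (\<bar>x\<bar> - x\<^sup>2 / 2)"
    by (simp add: exp_add[symmetric])
  ultimately show ?thesis by (simp only: mult_ac)
qed

text \<open>
  The viscosity will be \<open>1 / N\<^sup>2\<close>. The first smallness condition makes the fixed-point map a contraction, the second makes the
  nonlinear error at most half of the linear contribution to the dissipation.
\<close>

locale packet =
  fixes r :: "'n::finite \<Rightarrow> real" and i1 i2 :: 'n and N :: real
  assumes rpos: "\<And>i. r i > 0" and r_i1: "r i1 = N" and r_le: "\<And>i. r i \<le> N" and ne: "i1 \<noteq> i2"
    and sm1: "contraction_const (CARD('n)) * (N * sqrt (\<Prod>i\<in>UNIV. r i)) \<le> 1 / 4"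
    and sm2: "error_const (CARD('n)) * (N * sqrt (\<Prod>i\<in>UNIV. r i)) \<le> moment_const (CARD('n)) / 2"
begin

definition \<rho> :: real where "\<rho> = (\<Prod>i\<in>UNIV. r i)"
text \<open>
  Height of the amplitude, chosen to normalise the energy: the square of the height times the volume \<open>\<rho>\<close> is \<open>1\<close>.
\<close>

definition amp :: real where "amp = 1 / sqrt \<rho>"
definition h :: "real^'n \<Rightarrow> real" where "h = gaussian (\<lambda>i. 1 / r i)"
definition M :: real where "M = 2 * amp * data_const (CARD('n))"
definition W :: "real^'n \<Rightarrow> real" where "W \<xi> = M * weight r \<xi>"
text \<open>
  The sine amplitude of the rotated gradient \<open>(\<partial>\<^sub>i\<^sub>2 \<psi>, -\<partial>\<^sub>i\<^sub>1 \<psi>)\<close> of a Gaussian stream function \<open>\<psi>\<close>, up to a constant factor. It is therefore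
  odd and orthogonal to \<open>\<xi>\<close>.
\<close>

definition b0 :: "real^'n \<Rightarrow> real^'n" where
  "b0 \<xi> = (\<chi> i. if i = i1 then - (amp * h \<xi> * (\<xi> $ i2 / N)) else if i = i2 then amp * h \<xi> * (\<xi> $ i1 / N) else 0)"

lemma N_pos: "N > 0" using rpos[of i1] r_i1 by simp
lemma rho_pos: "\<rho> > 0" unfolding \<rho>_def using rpos by (intro prod_pos) auto
lemma amp_pos: "amp > 0" unfolding amp_def using rho_pos by simp
lemma amp_rho: "amp * \<rho> = sqrt \<rho>" unfolding amp_def using rho_pos by (simp add: real_div_sqrt)
lemma amp2_rho: "amp\<^sup>2 * \<rho> = 1" unfolding amp_def using rho_pos by (simp add: power_divide)
lemma M_pos: "M > 0" unfolding M_def using amp_pos const_pos by simp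
lemma h_pos: "h \<xi> > 0" unfolding h_def by (rule gaussian_pos)
lemma h_le1: "h \<xi> \<le> 1" unfolding h_def by (rule gaussian_le1)

lemma h_le_weight: "h \<xi> * (\<bar>\<xi> $ i1\<bar> / r i1 + \<bar>\<xi> $ i2\<bar> / r i2) \<le> data_const (CARD('n)) * weight r \<xi>"
proof -
  let ?s = "\<lambda>i. \<xi> $ i / r i"
  have "h \<xi> * (\<bar>\<xi> $ i1\<bar> / r i1 + \<bar>\<xi> $ i2\<bar> / r i2) \<le> h \<xi> * (\<Prod>i\<in>UNIV. 1 + \<bar>?s i\<bar>)"
  proof (rule mult_left_mono[OF _ less_imp_le[OF h_pos]])
    have a: "\<bar>\<xi> $ i\<bar> / r i = \<bar>?s i\<bar>" for i using rpos[of i] by simp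
    have "\<bar>?s i1\<bar> + \<bar>?s i2\<bar> \<le> (1 + \<bar>?s i1\<bar>) * (1 + \<bar>?s i2\<bar>)"
      by (simp add: algebra_simps)
    also have "\<dots> = (\<Prod>i\<in>{i1, i2}. 1 + \<bar>?s i\<bar>)" using ne by simp
    also have "\<dots> \<le> (\<Prod>i\<in>UNIV. 1 + \<bar>?s i\<bar>)"
      by (rule prod_mono2) auto
    finally show "\<bar>\<xi> $ i1\<bar> / r i1 + \<bar>\<xi> $ i2\<bar> / r i2 \<le> (\<Prod>i\<in>UNIV. 1 + \<bar>?s i\<bar>)" unfolding a .
  qed
  also have "\<dots> = (\<Prod>i\<in>UNIV. exp (- (?s i)\<^sup>2 / 2) * (1 + \<bar>?s i\<bar>))"
    unfolding h_def gaussian_prod prod.distrib by simp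
  also have "\<dots> \<le> (\<Prod>i\<in>UNIV. 2 * exp (9 / 2) * (exp (- \<bar>?s i\<bar>) * (1 / (1 + (?s i)\<^sup>2))))"
    by (intro prod_mono conjI gauss_poly_bound mult_nonneg_nonneg) auto
  also have "\<dots> = data_const (CARD('n)) * weight r \<xi>"
    unfolding prod.distrib weight_def data_const_def using rpos by (simp add: less_imp_le)
  finally show ?thesis .
qed

lemma data_norm: "norm (b0 \<xi>) \<le> W \<xi> / 2"
proof -
  have "norm (b0 \<xi>) \<le> (\<Sum>i\<in>UNIV. \<bar>b0 \<xi> $ i\<bar>)" by (rule norm_le_l1_cart)
  also have "\<dots> = (\<Sum>i\<in>{i1, i2}. \<bar>b0 \<xi> $ i\<bar>)"
    by (rule sum.mono_neutral_right) (auto simp: b0_def)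
  also have "\<dots> = amp * (h \<xi> * (\<bar>\<xi> $ i2\<bar> / N + \<bar>\<xi> $ i1\<bar> / N))"
    using ne amp_pos h_pos[of \<xi>] N_pos by (simp add: b0_def abs_mult algebra_simps)
  also have "\<dots> \<le> amp * (h \<xi> * (\<bar>\<xi> $ i2\<bar> / r i2 + \<bar>\<xi> $ i1\<bar> / r i1))"
    using amp_pos h_pos[of \<xi>] r_le[of i2] rpos[of i2] r_i1 N_pos
    by (intro mult_left_mono add_mono) (auto intro: frac_le divide_left_mono)
  also have "\<dots> \<le> amp * (data_const (CARD('n)) * weight r \<xi>)"
    using h_le_weight[of \<xi>] amp_pos by (intro mult_left_mono) (auto simp: add.commute)
  finally show ?thesis by (simp add: W_def M_def)
qed

lemma h_cont: "continuous_on UNIV h"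
  unfolding h_def gaussian_def by (intro continuous_intros) auto

lemma data_cont: "continuous_on UNIV b0"
  unfolding b0_def
proof (intro continuous_on_vec_lambda)
  fix i
  show "continuous_on UNIV (\<lambda>\<xi>. if i = i1 then - (amp * h \<xi> * (\<xi> $ i2 / N)) else if i = i2 then amp * h \<xi> * (\<xi> $ i1 / N) else 0)"
    using N_pos by (cases "i = i1"; cases "i = i2") (auto intro!: continuous_intros h_cont)
qed

lemma majorant_edec: "edec W"
  unfolding W_def[abs_def] by (intro edec_mult tempered_const weight_edec rpos)

lemma Lambda_eq: "2 * real CARD('n) ^ 3 * (M * ((4 * pi) ^ CARD('n) * \<rho>)) = contraction_const (CARD('n)) * sqrt \<rho>"
  unfolding amp_rho[symmetric] by (simp add: contraction_const_def M_def)

sublocale mild W "M * ((4 * pi) ^ CARD('n) * \<rho>)" "1 / N\<^sup>2" b0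
proof
  show "continuous_on UNIV W" unfolding W_def by (intro continuous_intros weight_cont rpos)
  show "0 < W \<xi>" for \<xi> unfolding W_def by (rule mult_pos_pos[OF M_pos weight_pos])
  show "edec W" by (rule majorant_edec)
  show "W (- \<xi>) = W \<xi>" for \<xi> by (simp add: W_def weight_even)
  show "conv W W \<xi> \<le> M * ((4 * pi) ^ CARD('n) * \<rho>) * W \<xi>" for \<xi>
  proof -
    have "conv W W \<xi> = (M * M) * conv (weight r) (weight r) \<xi>"
      unfolding conv_def W_def[abs_def] integral_mult_right_zero[symmetric] by (simp only: mult_ac)
    also have "\<dots> \<le> (M * M) * (((4 * pi) ^ CARD('n) * \<rho>) * weight r \<xi>)"
      using M_pos unfolding \<rho>_def by (intro mult_left_mono weight_conv rpos) auto
    finally show ?thesis by (simp add: W_def mult_ac)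
  qed
  show "0 < 1 / N\<^sup>2" using N_pos by simp
  show "2 * real CARD('n) ^ 3 * (M * ((4 * pi) ^ CARD('n) * \<rho>)) \<le> sqrt (1 / N\<^sup>2) / 4"
  proof -
    have "sqrt (1 / N\<^sup>2) = 1 / N" using N_pos by (simp add: real_sqrt_divide)
    moreover have "contraction_const (CARD('n)) * sqrt \<rho> \<le> 1 / N / 4"
      using sm1 N_pos by (simp add: \<rho>_def field_simps)
    ultimately show ?thesis unfolding Lambda_eq by simp
  qed
  show "continuous_on UNIV b0" by (rule data_cont)
  show "norm (b0 \<xi>) \<le> W \<xi> / 2" for \<xi> by (rule data_norm)
  show "b0 (- \<xi>) = - b0 \<xi>" for \<xi> by (simp add: b0_def vec_eq_iff h_def gaussian_def)
  show "\<xi> \<bullet> b0 \<xi> = 0" for \<xi>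
  proof -
    have "\<xi> \<bullet> b0 \<xi> = (\<Sum>i\<in>{i1, i2}. \<xi> $ i * b0 \<xi> $ i)"
      unfolding inner_vec_def inner_real_def by (rule sum.mono_neutral_right) (auto simp: b0_def)
    also have "\<dots> = 0" using ne by (simp add: b0_def)
    finally show ?thesis .
  qed
qed

lemma energy_bound: "(2 * pi) ^ CARD('n) * (\<Sum>i\<in>UNIV. LBINT \<xi>. (b0 \<xi> $ i)\<^sup>2) \<le> energy_const (CARD('n))"
proof -
  have "(LBINT \<xi>. (b0 \<xi> $ i)\<^sup>2) \<le> 4 * (data_const (CARD('n)))\<^sup>2 * pi ^ CARD('n)" for i
  proof -
    have "(LBINT \<xi>. (b0 \<xi> $ i)\<^sup>2) \<le> (LBINT \<xi>. M\<^sup>2 * weight r \<xi>)"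
    proof (rule Bochner_Integration.integral_mono)
      have m: "b0 \<in> borel_measurable borel" by (rule borel_measurable_continuous_onI[OF data_cont])
      show "integrable lborel (\<lambda>\<xi>. (b0 \<xi> $ i)\<^sup>2)"
        using data_norm by (intro edec_integrable edec_square edec_bound[OF majorant_edec m, of "1/2"]) auto
      show "integrable lborel (\<lambda>\<xi>. M\<^sup>2 * weight r \<xi>)" by (intro integrable_mult_right edec_integrable weight_edec rpos)
      fix \<xi> :: "real^'n"
      have "\<bar>b0 \<xi> $ i\<bar> \<le> W \<xi>"
        using component_le_norm_cart[of "b0 \<xi>" i] data_norm[of \<xi>] W_pos[of \<xi>] by linarith
      then have "(b0 \<xi> $ i)\<^sup>2 \<le> (W \<xi>)\<^sup>2" using W_pos[of \<xi>] by (simp add: abs_le_square_iff[symmetric])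
      also have "\<dots> = M\<^sup>2 * (weight r \<xi> * weight r \<xi>)" by (simp add: W_def power2_eq_square)
      also have "\<dots> \<le> M\<^sup>2 * (weight r \<xi> * 1)"
        using weight_le_1[OF rpos] weight_pos[of r \<xi>] by (intro mult_left_mono) auto
      finally show "(b0 \<xi> $ i)\<^sup>2 \<le> M\<^sup>2 * weight r \<xi>" by simp
    qed
    also have "\<dots> \<le> M\<^sup>2 * (pi ^ CARD('n) * \<rho>)"
      unfolding integral_mult_right_zero \<rho>_def by (intro mult_left_mono weight_integral rpos) auto
    also have "\<dots> = 4 * (data_const (CARD('n)))\<^sup>2 * pi ^ CARD('n) * (amp\<^sup>2 * \<rho>)"
      by (simp add: M_def power_mult_distrib)
    finally show ?thesis unfolding amp2_rho by simp
  qed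
  then have "(\<Sum>i\<in>UNIV. LBINT \<xi>. (b0 \<xi> $ i)\<^sup>2) \<le> (\<Sum>i\<in>(UNIV::'n set). 4 * (data_const (CARD('n)))\<^sup>2 * pi ^ CARD('n))"
    by (intro sum_mono)
  then show ?thesis unfolding energy_const_def by (intro mult_left_mono) auto
qed

lemma gaussian_moment:
  shows "integrable lborel (\<lambda>\<xi>::real^'n. (\<xi> $ i1 / r i1)\<^sup>2 * (h \<xi>) ^ 4)"
    and "(LBINT \<xi>. (\<xi> $ i1 / r i1)\<^sup>2 * (h \<xi>) ^ 4) = \<rho> * moment_const (CARD('n))"
proof -
  let ?f = "\<lambda>i x::real. (if i = i1 then x\<^sup>2 / 4 else 1) * exp (- x\<^sup>2 / 2)"
  have mom: "integrable lborel (\<lambda>x::real. x\<^sup>2 * exp (- x\<^sup>2 / 2))" "(LBINT x. (x::real)\<^sup>2 * exp (- x\<^sup>2 / 2)) = sqrt (2 * pi)"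
  proof -
    have eq: "x\<^sup>2 * exp (- x\<^sup>2 / 2) = sqrt (2 * pi) * (std_normal_density x * x ^ (2 * 1))" for x :: real
      by (simp add: std_normal_density_def)
    have hb: "has_bochner_integral lborel (\<lambda>x::real. sqrt (2 * pi) * (std_normal_density x * x ^ (2 * 1))) (sqrt (2 * pi) * (fact (2 * 1) / (2 ^ 1 * fact 1)))"
      by (intro has_bochner_integral_mult_right std_normal_moment_even)
    show "integrable lborel (\<lambda>x::real. x\<^sup>2 * exp (- x\<^sup>2 / 2))" "(LBINT x. (x::real)\<^sup>2 * exp (- x\<^sup>2 / 2)) = sqrt (2 * pi)"
      unfolding eq using hb by (auto simp: has_bochner_integral_iff)
  qed
  have f: "integrable lborel (?f i)" "(LBINT x. ?f i x) = (if i = i1 then sqrt (2 * pi) / 4 else sqrt (2 * pi))" for i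
  proof -
    show "integrable lborel (?f i)"
    proof (cases "i = i1")
      case True
      then have "?f i = (\<lambda>x. 1/4 * (x\<^sup>2 * exp (- x\<^sup>2 / 2)))" by simp
      then show ?thesis using integrable_mult_right[OF mom(1), of "1/4"] by (simp only:)
    qed (simp add: integrable_gauss[simplified])
    show "(LBINT x. ?f i x) = (if i = i1 then sqrt (2 * pi) / 4 else sqrt (2 * pi))"
    proof (cases "i = i1")
      case True
      then have e: "?f i = (\<lambda>x. 1/4 * (x\<^sup>2 * exp (- x\<^sup>2 / 2)))" by simp
      show ?thesis unfolding e integral_mult_right_zero mom(2) using True by simp
    qed (simp add: integral_gauss[simplified])
  qed
  have r2: "r i / 2 > 0" for i using rpos[of i] by simp
  note fs = lborel_integral_scale[OF r2 f(1)]
  have e: "(\<xi> $ i1 / r i1)\<^sup>2 * (h \<xi>) ^ 4 = (\<Prod>i\<in>UNIV. ?f i (\<xi> $ i / (r i / 2)))" for \<xi> :: "real^'n"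
  proof -
    have "(\<Prod>i\<in>UNIV. if i = i1 then (\<xi> $ i / (r i / 2))\<^sup>2 / 4 else 1) = (\<xi> $ i1 / r i1)\<^sup>2"
      by (simp add: power_divide)
    moreover have "(\<Prod>i\<in>UNIV. exp (- (\<xi> $ i / (r i / 2))\<^sup>2 / 2)) = (h \<xi>) ^ 4"
      unfolding h_def gaussian_prod prod_power_distrib exp_of_nat_mult[symmetric]
      by (intro prod.cong refl) (simp add: power_divide)
    ultimately show ?thesis unfolding prod.distrib by simp
  qed
  show "integrable lborel (\<lambda>\<xi>::real^'n. (\<xi> $ i1 / r i1)\<^sup>2 * (h \<xi>) ^ 4)"
    unfolding e by (rule integrable_prod_vec) (rule fs)
  have "(LBINT \<xi>. (\<xi> $ i1 / r i1)\<^sup>2 * (h \<xi>) ^ 4) = (\<Prod>i\<in>UNIV. (r i / 2) *\<^sub>R (if i = i1 then sqrt (2 * pi) / 4 else sqrt (2 * pi)))"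
    unfolding e by (subst integral_prod_vec[OF fs(1)]) (simp only: fs(2) f(2))
  also have "\<dots> = (\<Prod>i\<in>UNIV. r i * ((sqrt (2 * pi) / 2) * (if i = i1 then 1/4 else 1)))"
    by (intro prod.cong refl) auto
  also have "\<dots> = \<rho> * moment_const (CARD('n))"
    unfolding prod.distrib \<rho>_def moment_const_def by simp
  finally show "(LBINT \<xi>. (\<xi> $ i1 / r i1)\<^sup>2 * (h \<xi>) ^ 4) = \<rho> * moment_const (CARD('n))" .
qed

text \<open>
  The half sides are at most \<open>N\<close>, so up to time \<open>1\<close> the heat flow damps the packet by no more than a further
  Gaussian of the same shape.
\<close>

lemma heat_factor:
  assumes "t \<in> I01" shows "(h \<xi>)\<^sup>2 \<le> exp (- (1 / N\<^sup>2 * (norm \<xi>)\<^sup>2 * t))"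
proof -
  have "1 / N\<^sup>2 * (norm \<xi>)\<^sup>2 = (\<Sum>i\<in>UNIV. (1 / N * \<xi> $ i)\<^sup>2)"
    unfolding power2_norm_eq_inner by (simp add: inner_vec_def sum_divide_distrib power_divide power2_eq_square[of "_ $ _"])
  also have "\<dots> \<le> (\<Sum>i\<in>UNIV. (1 / r i * \<xi> $ i)\<^sup>2)"
  proof (intro sum_mono)
    fix i
    have "(1 / N)\<^sup>2 \<le> (1 / r i)\<^sup>2"
      using r_le[of i] rpos[of i] N_pos by (intro power_mono divide_left_mono) auto
    then show "(1 / N * \<xi> $ i)\<^sup>2 \<le> (1 / r i * \<xi> $ i)\<^sup>2"
      unfolding power_mult_distrib by (rule mult_right_mono) simp
  qed
  finally have 1: "1 / N\<^sup>2 * (norm \<xi>)\<^sup>2 \<le> (\<Sum>i\<in>UNIV. (1 / r i * \<xi> $ i)\<^sup>2)" .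
  have "1 / N\<^sup>2 * (norm \<xi>)\<^sup>2 * t \<le> 1 / N\<^sup>2 * (norm \<xi>)\<^sup>2 * 1"
    using assms by (intro mult_left_mono) auto
  with 1 have "1 / N\<^sup>2 * (norm \<xi>)\<^sup>2 * t \<le> (\<Sum>i\<in>UNIV. (1 / r i * \<xi> $ i)\<^sup>2)" by linarith
  moreover have "(h \<xi>)\<^sup>2 = exp (- (\<Sum>i\<in>UNIV. (1 / r i * \<xi> $ i)\<^sup>2))"
    unfolding h_def gaussian_def power2_eq_square[of "exp _"] exp_add[symmetric] by simp
  ultimately show ?thesis by simp
qed

lemma gaussian_sq:
  shows "integrable lborel (\<lambda>x. (gaussian r x)\<^sup>2)"
    and "(LBINT x. (gaussian r x)\<^sup>2) = sqrt pi ^ CARD('n) / \<rho>"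
proof -
  have e: "(gaussian r x)\<^sup>2 = gaussian (\<lambda>i. sqrt 2 * r i) x" for x
    by (simp add: gaussian_def power2_eq_square[of "exp _"] exp_add[symmetric] power_mult_distrib sum_distrib_left[symmetric] mult.assoc)
  have p: "0 < sqrt 2 * r i" for i using rpos[of i] by simp
  show "integrable lborel (\<lambda>x. (gaussian r x)\<^sup>2)" unfolding e by (rule integrable_gaussian) (rule p)
  have "(LBINT x. (gaussian r x)\<^sup>2) = (\<Prod>i\<in>UNIV. sqrt (2 * pi) / (sqrt 2 * r i))"
    unfolding e by (rule integral_gaussian) (rule p)
  also have "\<dots> = sqrt pi ^ CARD('n) / \<rho>"
    by (simp add: real_sqrt_mult prod_dividef \<rho>_def)
  finally show "(LBINT x. (gaussian r x)\<^sup>2) = sqrt pi ^ CARD('n) / \<rho>" .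
qed

text \<open>
  Initial energy and dissipation are bounded by constants depending on the dimension only, although \<open>N\<close> and the half sides are arbitrary subject to
  the smallness conditions. For the dissipation, \<open>\<partial>\<^sub>i\<^sub>1 u\<^sub>i\<^sub>2\<close> is paired with the Gaussian of widths \<open>1 / r i\<close>, whose transform is a multiple of
  \<open>h\<close>. The linear part then contributes the moment of \<open>gaussian_moment\<close>, of size \<open>amp N \<rho>\<close>; the nonlinear part, after its two factors of \<open>\<xi>\<close> are
  absorbed by the heat kernel, is smaller by a multiple of \<open>N \<surd>\<rho>\<close>.
\<close>

theorem packet_solution:
  "\<exists>(u :: real \<Rightarrow> real^'n \<Rightarrow> real^'n) p. smooth_NS_solution (1 / N\<^sup>2) (u 0) u p \<and> Cinf_on (u 0) UNIV \<and> in_L2 (u 0) \<and>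
     L2_norm (u 0) \<le> sqrt (energy_const (CARD('n))) \<and> finite_dissipation u \<and> dissipation (1 / N\<^sup>2) u \<ge> dissipation_const (CARD('n))"
proof -
  obtain b where b: "continuous_on UNIV (\<lambda>p. b (fst p) (snd p))" "\<And>t \<xi>. norm (b t \<xi>) \<le> W \<xi>"
    "\<And>t \<xi>. b t (- \<xi>) = - b t \<xi>"
    "\<And>t \<xi>. t \<in> I01 \<Longrightarrow> b t \<xi> = exp (- (1 / N\<^sup>2 * (norm \<xi>)\<^sup>2 * t)) *\<^sub>R
     (b0 \<xi> - integral {0..t} (\<lambda>s. exp (1 / N\<^sup>2 * (norm \<xi>)\<^sup>2 * s) *\<^sub>R leray_conv (b s) (b s) \<xi>))"
    and dev: "\<And>t \<xi>. t \<in> I01 \<Longrightarrow> norm (b t \<xi> - exp (- (1 / N\<^sup>2 * (norm \<xi>)\<^sup>2 * t)) *\<^sub>R b0 \<xi>) \<le> duhamel_factor (1 / N\<^sup>2 * (norm \<xi>)\<^sup>2) t * (\<Lambda> * norm \<xi> * W \<xi>)"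
    by (rule mild_solution) blast
  define u where "u t = vsynth (- (pi/2)) (b t)" for t
  let ?d = "CARD('n)"
  have "(L2_norm (u 0))\<^sup>2 \<le> energy_const ?d"
  proof -
    have "b 0 = b0" by (rule ext) (rule b_init[OF b])
    then show ?thesis
      unfolding u_def using order_trans[OF L2_norm_u[OF b, of 0]] energy_bound by simp
  qed
  then have init: "L2_norm (u 0) \<le> sqrt (energy_const ?d)" by (rule real_le_rsqrt)
  have lower: "N\<^sup>2 * dissipation_const ?d \<le> (L2_norm (vgradient (u t)))\<^sup>2" if t: "t \<in> I01" for t
  proof -
    let ?a = "\<lambda>\<xi>. \<xi> $ i1 * b t \<xi> $ i2" and ?g = "gaussian r"
    let ?f = "synth 0 ?a"
    define Z where "Z = (\<Prod>i\<in>UNIV. sqrt (2 * pi) / r i)"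
    define Q where "Q = amp * N * \<rho> * (moment_const ?d / 2)"
    define S where "S = sqrt pi ^ ?d / \<rho>"
    define P where "P = (LBINT x. ?f x * ?g x)"
    have Z: "Z = sqrt (2 * pi) ^ ?d / \<rho>" by (simp add: Z_def \<rho>_def prod_dividef)
    have pos: "Z > 0" "Q > 0" "S > 0"
      unfolding Z Q_def S_def
      by (intro divide_pos_pos mult_pos_pos zero_less_power amp_pos N_pos rho_pos const_pos real_sqrt_gt_zero pi_gt_zero; simp)+
    have ea: "edec ?a" by (rule xb_edec[OF b])
    have eah: "edec (\<lambda>\<xi>. h \<xi> * ?a \<xi>)"
      using h_pos h_le1 by (intro edec_mult ea tempered_bounded[of _ 1] borel_measurable_continuous_onI[OF h_cont]) (auto simp: abs_of_pos)
    have point: "amp * N * ((\<xi> $ i1 / r i1)\<^sup>2 * (h \<xi>) ^ 4) - N\<^sup>2 * \<Lambda> * M * weight r \<xi> \<le> h \<xi> * ?a \<xi>" for \<xi>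
    proof -
      let ?e = "exp (- (1 / N\<^sup>2 * (norm \<xi>)\<^sup>2 * t))"
      let ?w = "b t \<xi> - ?e *\<^sub>R b0 \<xi>"
      have "\<bar>\<xi> $ i1 * ?w $ i2\<bar> \<le> norm \<xi> * (duhamel_factor (1 / N\<^sup>2 * (norm \<xi>)\<^sup>2) t * (\<Lambda> * norm \<xi> * W \<xi>))"
        unfolding abs_mult by (intro mult_mono component_le_norm_cart order_trans[OF component_le_norm_cart dev[OF t]]) auto
      also have "\<dots> = (norm \<xi> * (norm \<xi> * duhamel_factor (1 / N\<^sup>2 * (norm \<xi>)\<^sup>2) t)) * (\<Lambda> * W \<xi>)" by simp
      also have "\<dots> \<le> (1 / (1 / N\<^sup>2)) * (\<Lambda> * W \<xi>)"
        using t Lambda_nonneg W_pos[of \<xi>] nu_pos by (intro mult_right_mono norm_duhamel_factor(2)) auto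
      finally have w: "\<bar>\<xi> $ i1 * ?w $ i2\<bar> \<le> N\<^sup>2 * \<Lambda> * M * weight r \<xi>" by (simp add: W_def mult_ac)
      have "\<bar>h \<xi> * (\<xi> $ i1 * ?w $ i2)\<bar> \<le> 1 * (N\<^sup>2 * \<Lambda> * M * weight r \<xi>)"
        unfolding abs_mult[of "h \<xi>"] using h_pos[of \<xi>] h_le1[of \<xi>] by (intro mult_mono w) auto
      moreover have "h \<xi> * ?a \<xi> = ?e * (amp * N * ((\<xi> $ i1 / r i1)\<^sup>2 * (h \<xi>)\<^sup>2)) + h \<xi> * (\<xi> $ i1 * ?w $ i2)"
        using ne N_pos by (simp add: b0_def r_i1 power2_eq_square field_simps)
      moreover have "(h \<xi>)\<^sup>2 * (amp * N * ((\<xi> $ i1 / r i1)\<^sup>2 * (h \<xi>)\<^sup>2)) \<le> ?e * (amp * N * ((\<xi> $ i1 / r i1)\<^sup>2 * (h \<xi>)\<^sup>2))"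
        using amp_pos N_pos by (intro mult_right_mono heat_factor t) auto
      moreover have "(h \<xi>)\<^sup>2 * (amp * N * ((\<xi> $ i1 / r i1)\<^sup>2 * (h \<xi>)\<^sup>2)) = amp * N * ((\<xi> $ i1 / r i1)\<^sup>2 * (h \<xi>) ^ 4)"
        by (simp add: power4_eq_xxxx power2_eq_square mult_ac)
      ultimately show ?thesis by linarith
    qed
    have "Q \<le> amp * N * (\<rho> * moment_const ?d) - N\<^sup>2 * \<Lambda> * M * (pi ^ ?d * \<rho>)"
    proof -
      have "N\<^sup>2 * \<Lambda> * M * (pi ^ ?d * \<rho>) = amp * N * \<rho> * (error_const ?d * (N * sqrt \<rho>))"
        unfolding \<Lambda>_def Lambda_eq by (simp add: error_const_def M_def power2_eq_square)
      also have "\<dots> \<le> amp * N * \<rho> * (moment_const ?d / 2)"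
        using amp_pos N_pos rho_pos sm2 by (intro mult_left_mono) (auto simp: \<rho>_def)
      moreover have "amp * N * (\<rho> * moment_const ?d) = amp * N * \<rho> * (moment_const ?d / 2) + amp * N * \<rho> * (moment_const ?d / 2)"
        by simp
      ultimately show ?thesis unfolding Q_def by linarith
    qed
    also have "\<dots> \<le> amp * N * (\<rho> * moment_const ?d) - N\<^sup>2 * \<Lambda> * M * (LBINT \<xi>. weight r \<xi>)"
      using Lambda_nonneg M_pos weight_integral[of r, OF rpos] by (intro diff_left_mono mult_left_mono) (auto simp: \<rho>_def)
    also have "\<dots> = (LBINT \<xi>. amp * N * ((\<xi> $ i1 / r i1)\<^sup>2 * (h \<xi>) ^ 4) - N\<^sup>2 * \<Lambda> * M * weight r \<xi>)"
      unfolding Bochner_Integration.integral_diff[OF integrable_mult_right[OF gaussian_moment(1)] integrable_mult_right[OF edec_integrable[OF weight_edec[of r, OF rpos]]]]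
        integral_mult_right_zero gaussian_moment(2) ..
    also have "\<dots> \<le> (LBINT \<xi>. h \<xi> * ?a \<xi>)"
      by (intro Bochner_Integration.integral_mono point edec_integrable eah Bochner_Integration.integrable_diff
          integrable_mult_right gaussian_moment weight_edec rpos)
    finally have "Z * Q \<le> Z * (LBINT \<xi>. h \<xi> * ?a \<xi>)" using pos by (intro mult_left_mono) auto
    also have "\<dots> = P"
      unfolding P_def synth_pairing(1)[OF ea integrable_gaussian[of r, OF rpos]] add_0_right
        gaussian_fourier[of r, OF rpos] Z_def[symmetric] h_def[symmetric] integral_mult_right_zero[symmetric]
      by (simp only: mult_ac)
    finally have ZQ: "Z * Q \<le> P" .
    \<comment> \<open>Cauchy-Schwarz for the pairing, as positivity of \<open>\<integral> (f - l g)\<^sup>2\<close> for every \<open>l\<close>.\<close>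
    have sq: "(LBINT x. (?f x)\<^sup>2) \<ge> 2 * l * P - l\<^sup>2 * S" for l
    proof -
      note i = synth_L2(1)[OF ea, of 0] synth_pairing(2)[OF ea integrable_gaussian[of r, OF rpos], of 0] gaussian_sq(1)
      have "0 \<le> (LBINT x. (?f x - l * ?g x)\<^sup>2)"
        by (rule Bochner_Integration.integral_nonneg) simp
      also have "\<dots> = (LBINT x. (?f x)\<^sup>2 - 2 * l * (?f x * ?g x) + l\<^sup>2 * (?g x)\<^sup>2)"
        by (intro Bochner_Integration.integral_cong refl) (simp add: power2_eq_square algebra_simps)
      also have "\<dots> = (LBINT x. (?f x)\<^sup>2) - 2 * l * P + l\<^sup>2 * S"
        using i by (simp add: P_def gaussian_sq(2) S_def)
      finally show ?thesis by simp
    qed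
    \<comment> \<open>The optimal choice is \<open>l = Z Q / S\<close>.\<close>
    have "(Z * Q)\<^sup>2 / S = 2 * (Z * Q / S) * (Z * Q) - (Z * Q / S)\<^sup>2 * S"
      using pos by (simp add: field_simps power2_eq_square)
    also have "\<dots> \<le> 2 * (Z * Q / S) * P - (Z * Q / S)\<^sup>2 * S"
      using pos ZQ by (intro diff_right_mono mult_left_mono) auto
    also have "\<dots> \<le> (LBINT x. (?f x)\<^sup>2)" by (rule sq)
    also have "\<dots> \<le> (L2_norm (vgradient (u t)))\<^sup>2"
      unfolding u_def by (rule grad_component_le[OF b])
    finally have fin: "(Z * Q)\<^sup>2 / S \<le> (L2_norm (vgradient (u t)))\<^sup>2" .
    have "(Z * Q)\<^sup>2 / S = N\<^sup>2 * ((sqrt (2 * pi) ^ ?d)\<^sup>2 * (moment_const ?d)\<^sup>2 / (4 * sqrt pi ^ ?d)) * (amp\<^sup>2 * \<rho>)"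
      using rho_pos by (simp add: Z Q_def S_def power_mult_distrib power_divide field_simps power2_eq_square)
    also have "(sqrt (2 * pi) ^ ?d)\<^sup>2 = (2 * pi) ^ ?d"
      by (simp add: power_mult[symmetric] mult.commute[of _ 2]) (simp add: power_mult)
    finally have "(Z * Q)\<^sup>2 / S = N\<^sup>2 * dissipation_const ?d" by (simp add: dissipation_const_def amp2_rho)
    with fin show ?thesis by simp
  qed
  have fd: "finite_dissipation u" unfolding u_def by (rule finite_dissipation_u[OF b])
  have "N\<^sup>2 * dissipation_const ?d = (LBINT t:I01. N\<^sup>2 * dissipation_const ?d)"
    by (simp add: set_lebesgue_integral_def)
  also have "\<dots> \<le> (LBINT t:I01. (L2_norm (vgradient (u t)))\<^sup>2)"
    using fd lower by (intro set_integral_mono) (auto simp: finite_dissipation_def set_integrable_def)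
  finally have "dissipation_const ?d \<le> dissipation (1 / N\<^sup>2) u"
    using N_pos by (simp add: dissipation_def field_simps)
  moreover have "smooth_NS_solution (1 / N\<^sup>2) (u 0) u (\<lambda>t. synth 0 (pressure_amp b t))"
    unfolding u_def by (rule NS_solution[OF b])
  moreover have "Cinf_on (u 0) UNIV" unfolding u_def by (rule u0_smooth[OF b])
  moreover have "in_L2 (u 0)" unfolding u_def by (rule in_L2_u[OF b])
  ultimately show ?thesis
    using init fd by (intro exI[of _ u] exI[of _ "\<lambda>t. synth 0 (pressure_amp b t)"] conjI)
qed

end

theorem uniformly_dissipative_solution:
  assumes card: "CARD('n::finite) \<ge> 2" and nu: "\<nu> > 0"
  shows "\<exists>(u :: real \<Rightarrow> real^'n \<Rightarrow> real^'n) p. smooth_NS_solution \<nu> (u 0) u p \<and> Cinf_on (u 0) UNIV \<and> in_L2 (u 0) \<and>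
     L2_norm (u 0) \<le> sqrt (energy_const (CARD('n))) \<and> finite_dissipation u \<and> dissipation \<nu> u \<ge> dissipation_const (CARD('n))"
proof -
  let ?d = "CARD('n)"
  have "\<exists>i1 i2 :: 'n. i1 \<noteq> i2"
  proof (rule ccontr)
    assume "\<not> (\<exists>i1 i2 :: 'n. i1 \<noteq> i2)"
    then have "is_singleton (UNIV :: 'n set)" by (auto intro: is_singletonI')
    with card show False by (simp add: is_singleton_altdef)
  qed
  then obtain i1 i2 :: 'n where ne: "i1 \<noteq> i2" by blast
  define N where "N = 1 / sqrt \<nu>"
  have N: "N > 0" "1 / N\<^sup>2 = \<nu>" using nu by (auto simp: N_def power_divide)
  define \<sigma> where "\<sigma> = min (1 / (4 * contraction_const ?d)) (moment_const ?d / (2 * error_const ?d))"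
  have C: "contraction_const ?d > 0" "error_const ?d > 0" by (auto intro: const_pos)
  have \<sigma>: "\<sigma> > 0" using C const_pos(2) by (simp add: \<sigma>_def)
  \<comment> \<open>As \<open>\<rho> \<le> N q\<close>, this makes \<open>N \<surd>\<rho> \<le> \<sigma>\<close>.\<close>
  define q where "q = min (min 1 N) (\<sigma>\<^sup>2 / N ^ 3)"
  have q: "q > 0" "q \<le> 1" "q \<le> N" "q \<le> \<sigma>\<^sup>2 / N ^ 3" using N \<sigma> by (auto simp: q_def)
  define r where "r i = (if i = i1 then N else q)" for i
  have rpos: "r i > 0" for i using N q by (simp add: r_def)
  have "(\<Prod>i\<in>UNIV. r i) \<le> (\<Prod>i\<in>UNIV. if i = i1 then N else if i = i2 then q else 1)"
    using rpos q by (intro prod_mono) (auto simp: r_def less_imp_le)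
  also have "\<dots> = (\<Prod>i\<in>{i1, i2}. if i = i1 then N else if i = i2 then q else 1)"
    by (rule prod.mono_neutral_right) auto
  also have "\<dots> = N * q" using ne by simp
  also have "\<dots> \<le> N * (\<sigma>\<^sup>2 / N ^ 3)" using q N by (intro mult_left_mono) auto
  also have "\<dots> = (\<sigma> / N)\<^sup>2" using N by (simp add: power2_eq_square power3_eq_cube)
  finally have "sqrt (\<Prod>i\<in>UNIV. r i) \<le> \<sigma> / N"
    using \<sigma> N by (intro real_le_lsqrt) (auto intro: prod_nonneg less_imp_le[OF rpos])
  then have s: "N * sqrt (\<Prod>i\<in>UNIV. r i) \<le> \<sigma>" using N by (simp add: field_simps)
  interpret packet r i1 i2 N
  proof
    show "r i > 0" for i by (rule rpos)
    show "r i1 = N" by (simp add: r_def)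
    show "r i \<le> N" for i using q by (simp add: r_def)
    show "i1 \<noteq> i2" by fact
    have "contraction_const ?d * (N * sqrt (\<Prod>i\<in>UNIV. r i)) \<le> contraction_const ?d * (1 / (4 * contraction_const ?d))"
      using s C by (intro mult_left_mono) (auto simp: \<sigma>_def)
    then show "contraction_const ?d * (N * sqrt (\<Prod>i\<in>UNIV. r i)) \<le> 1 / 4" using C by simp
    have "error_const ?d * (N * sqrt (\<Prod>i\<in>UNIV. r i)) \<le> error_const ?d * (moment_const ?d / (2 * error_const ?d))"
      using s C by (intro mult_left_mono) (auto simp: \<sigma>_def)
    then show "error_const ?d * (N * sqrt (\<Prod>i\<in>UNIV. r i)) \<le> moment_const ?d / 2" using C by simp
  qed
  show ?thesis using packet_solution unfolding N(2) .
qed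

theorem theorem1p1:
  assumes "CARD('n::finite) \<ge> 2"
  shows "\<exists>(u\<^sub>0 :: nat \<Rightarrow> real^'n \<Rightarrow> real^'n)
          (u :: nat \<Rightarrow> real \<Rightarrow> real^'n \<Rightarrow> real^'n)
          (p :: nat \<Rightarrow> real \<Rightarrow> real^'n \<Rightarrow> real).
      (\<forall>n. Cinf_on (u\<^sub>0 n) UNIV \<and> in_L2 (u\<^sub>0 n)) \<and>
      bdd_above (range (\<lambda>n. L2_norm (u\<^sub>0 n))) \<and>
      (\<forall>n. smooth_NS_solution (visc n) (u\<^sub>0 n) (u n) (p n) \<and> finite_dissipation (u n)) \<and>
      (\<exists>c>0. \<forall>n. dissipation (visc n) (u n) \<ge> c * L2_norm (u\<^sub>0 n)) \<and>
      (\<exists>\<eta>>0. liminf (\<lambda>n. ereal (dissipation (visc n) (u n))) \<ge> ereal \<eta>)"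
proof -
  let ?c = "dissipation_const (CARD('n))" and ?U = "sqrt (energy_const (CARD('n)))"
  have "\<forall>n. \<exists>u :: (real \<Rightarrow> real^'n \<Rightarrow> real^'n). \<exists>p. smooth_NS_solution (visc n) (u 0) u p \<and> Cinf_on (u 0) UNIV \<and>
      in_L2 (u 0) \<and> L2_norm (u 0) \<le> ?U \<and> finite_dissipation u \<and> dissipation (visc n) u \<ge> ?c"
    by (intro allI uniformly_dissipative_solution[OF assms]) (simp add: visc_def)
  then obtain u :: "nat \<Rightarrow> real \<Rightarrow> real^'n \<Rightarrow> real^'n" and p where
    u: "\<And>n. smooth_NS_solution (visc n) (u n 0) (u n) (p n)" "\<And>n. Cinf_on (u n 0) UNIV" "\<And>n. in_L2 (u n 0)"
      "\<And>n. L2_norm (u n 0) \<le> ?U" "\<And>n. finite_dissipation (u n)" "\<And>n. dissipation (visc n) (u n) \<ge> ?c"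
    unfolding choice_iff by blast
  have U: "0 \<le> ?U" by (simp add: energy_const_def)
  have c: "?c > 0" by (rule const_pos)
  have "?c / (?U + 1) * L2_norm (u n 0) \<le> dissipation (visc n) (u n)" for n
  proof -
    have "?c / (?U + 1) * L2_norm (u n 0) \<le> ?c / (?U + 1) * (?U + 1)"
      using c U u(4)[of n] by (intro mult_left_mono) auto
    also have "\<dots> = ?c"
    proof -
      have "?U + 1 \<noteq> 0" using U by linarith
      then show ?thesis by simp
    qed
    also have "\<dots> \<le> dissipation (visc n) (u n)" by (rule u(6))
    finally show ?thesis .
  qed
  moreover have "?c / (?U + 1) > 0" by (rule divide_pos_pos[OF c]) (use U in linarith)
  moreover have "ereal ?c \<le> liminf (\<lambda>n. ereal (dissipation (visc n) (u n)))"
    using u(6) by (intro Liminf_bounded always_eventually) auto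
  moreover have "bdd_above (range (\<lambda>n. L2_norm (u n 0)))"
    by (rule bdd_aboveI[of _ "?U"]) (use u(4) in auto)
  ultimately show ?thesis
    using u(1,2,3,5) c by (intro exI[of _ "\<lambda>n. u n 0"] exI[of _ u] exI[of _ p]) blast
qed

end
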